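(* Let $X\in\mathcal M_{\mathbf r}$ with a minimal left-orthogonal TT decomposition $U_1,\dots,U_d$ and a minimal right-orthogonal TT decomposition $\tilde U_1,\dots,\tilde U_d$ of $X$. Let $R_k\in\mathbb R^{r_k\times r_k}$ ($k\in[d-1]$) be the invertible matrices with $X_{\ge k+1}=\tilde X_{\ge k+1}R_k$. Let $V\in \mathrm T_X\mathcal M_{\mathbf r}$ be given by cores $\delta V_1,\dots,\delta V_d$ satisfying the gauge conditions, and let $V_{\le k},V_{\ge k}$ be its variational interface matrices. Then for every $Z\in\mathbb R^{n_1\times\cdots\times n_d}$ and every $k\in[d-1]$, \begin{align*} (\mathcal P_X^k (\mathrm D_V \mathcal P_X^k) Z)^{<k>} &= (I_{n_k}\otimes X_{<k})\Big((I_{r_{k-1}n_k}-U_k^L(U_k^L)^\top)(I_{n_k}\otimes V_{<k}^\top)Z^{<k>}\tilde X_{\ge k+1}\Big)\tilde X_{\ge k+1}^\top\\ &\quad-(I_{n_k}\otimes X_{<k})\Big(\delta V_k^L(U_k^L)^\top(I_{n_k}\otimes X_{<k}^\top)Z^{<k>}\tilde X_{\ge k+1}\Big)\tilde X_{\ge k+1}^\top\\ &\quad+(I_{n_k}\otimes X_{<k})\Big((I_{r_{k-1}n_k}-U_k^L(U_k^L)^\top)(I_{n_k}\otimes X_{\le k-1}^\top)Z^{<k>}(I-\tilde X_{\ge k+1}\tilde X_{\ge k+1}^\top)V_{\ge k+1}R_k^{-1}\Big)\tilde X_{\ge k+1}^\top, \end{align*} and for $k=d$, \[(\mathcal P_X^d(\mathrm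 D_V\mathcal P_X^d)Z)^{<d>}=(I_{n_d}\otimes X_{\le d-1})(I_{n_d}\otimes V_{<d}^\top)Z^{<d>}.\]
   Context: Fix $d\ge2$, positive integers $n_1,\dots,n_d$, and $\mathbf r=(r_1,\dots,r_{d-1})$ with $r_0=r_d=1$; $[m]=\{1,\dots,m\}$. For $Z\in\mathbb R^{n_1\times\cdots\times n_d}$, the flattening $Z^{<\mu>}\in\mathbb R^{(n_1\cdots n_\mu)\times(n_{\mu+1}\cdots n_d)}$ has rows indexed by $(i_1,\dots,i_\mu)$ and columns by $(i_{\mu+1},\dots,i_d)$, multi-indices ordered colexicographically (first index fastest, as in Matlab reshape). $\mathrm{rank}_{TT}(Z)=(\mathrm{rank}\,Z^{<1>},\dots,\mathrm{rank}\,Z^{<d-1>})$ and $\mathcal M_{\mathbf r}$ is the smooth embedded submanifold of tensors with TT-rank $\mathbf r$, with the Euclidean inner product. A TT decomposition of $X$ consists of cores $U_k\in\mathbb R^{r_{k-1}\times n_k\times r_k}$ with slices $U_k(i)\in\mathbb R^{r_{k-1}\times r_k}$ such that $X(i_1,\dots,i_d)=U_1(i_1)\cdots U_d(i_d)$; it is minimal if $\mathrm{rank}_{TT}(X)=\mathbf r$. $U_k^L:=U_k^{<2>}\in\mathbb R^{r_{k-1}n_k\times r_k}$, $U_k^R:=U_k^{<1>}\in\mathbb R^{r_{k-1}\times n_kr_k}$. Left-orthogonal: $(U_k^L)^\top U_k^L=I$ for $k\in[d-1]$; right-orthogonal: $U_k^R(U_k^R)^\top=I$ for $k=2,\dots,d$.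 Interface matrices: $X_{\le0}=1$, $X_{\le k}=(I_{n_k}\otimes X_{\le k-1})U_k^L$; $X_{\ge d+1}=1$, $X_{\ge k}^\top=U_k^R(X_{\ge k+1}^\top\otimes I_{n_k})$ (so $X_{\ge k}\in\mathbb R^{n_k\cdots n_d\times r_{k-1}}$); $\tilde X_{\le k},\tilde X_{\ge k}$ are defined the same way from $\tilde U_k$. Shorthand: $X_{<k}:=X_{\le k-1}$, $V_{<k}:=V_{\le k-1}$. Tangent vectors: every $V\in\mathrm T_X\mathcal M_{\mathbf r}$ can be written $V(i_1,\dots,i_d)=\sum_{k=1}^d U_1(i_1)\cdots U_{k-1}(i_{k-1})\delta V_k(i_k)U_{k+1}(i_{k+1})\cdots U_d(i_d)$ with $\delta V_k\in\mathbb R^{r_{k-1}\times n_k\times r_k}$ and gauge conditions $(\delta V_k^L)^\top U_k^L=0$ for $k\in[d-1]$ (with $\delta V_k^L=\delta V_k^{<2>}$, $\delta V_k^R=\delta V_k^{<1>}$). Variational interface matrices: $V_{\le0}=0$, $V_{\le k}=(I_{n_k}\otimes V_{\le k-1})U_k^L+(I_{n_k}\otimes X_{\le k-1})\delta V_k^L$; $V_{\ge d+1}=0$, $V_{\ge k}^\top=U_k^R(V_{\ge k+1}^\top\otimes I_{n_k})+\delta V_k^R(X_{\ge k+1}^\top\otimes I_{n_k})$. Projectors: for $Y\in\mathcal M_{\mathbf r}$ (computed from any minimal left-orthogonal and right-orthogonal decompositions of $Y$; the result depends only on $Y$), $(\mathcal P_Y^kZ)^{<k>}=(I_{n_k}\otimes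 Y_{\le k-1})(I-U_k^L(U_k^L)^\top)(I_{n_k}\otimes Y_{\le k-1}^\top)Z^{<k>}\tilde Y_{\ge k+1}\tilde Y_{\ge k+1}^\top$ for $k\in[d-1]$ and $(\mathcal P_Y^dZ)^{<d>}=(I_{n_d}\otimes Y_{\le d-1}Y_{\le d-1}^\top)Z^{<d>}$; these are orthogonal projectors onto mutually orthogonal subspaces whose sum is $\mathrm T_Y\mathcal M_{\mathbf r}$. $(\mathrm D_V\mathcal P_X^k)Z:=\lim_{t\to0}(\mathcal P^k_{c(t)}Z-\mathcal P^k_{c(0)}Z)/t$ for any smooth curve $c$ in $\mathcal M_{\mathbf r}$ with $c(0)=X$, $c'(0)=V$. *)

theory Defs
  imports Complex_Main "Jordan_Normal_Form.DL_Rank"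
begin

(* Conventions: dimensions n k (k = 1..d) and ranks r k (k = 0..d, r 0 = r d = 1)
   are functions nat => nat, indices of modes are 1-based.
   Entry indices i_k are 0-based (i_k < n k).
   A tensor of order d is a function  nat list => real  (index list of length d,
   entry number k-1 holds i_k), vanishing outside the valid index set.
   Matrices are Jordan_Normal_Form matrices (real mat). *)

type_synonym tensor = "nat list \<Rightarrow> real"

definition valid_idx :: "nat \<Rightarrow> (nat \<Rightarrow> nat) \<Rightarrow> nat list \<Rightarrow> bool" where
  "valid_idx d n is \<longleftrightarrow> length is = d \<and> (\<forall>j<d. is ! j < n (Suc j))"

definition tensors :: "nat \<Rightarrow> (nat \<Rightarrow> nat) \<Rightarrow> tensor set" where
  "tensors d n = {Z. \<forall>is. \<not> valid_idx d n is \<longrightarrow> Z is = 0}"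

definition nprod :: "(nat \<Rightarrow> nat) \<Rightarrow> nat \<Rightarrow> nat \<Rightarrow> nat" where
  "nprod n lo hi = (\<Prod>l\<in>{lo..hi}. n l)"

definition colex_dec :: "(nat \<Rightarrow> nat) \<Rightarrow> nat \<Rightarrow> nat \<Rightarrow> nat \<Rightarrow> nat list" where
  "colex_dec n lo hi a = map (\<lambda>j. (a div (\<Prod>l\<in>{lo..<j}. n l)) mod n j) [lo..<Suc hi]"

definition colex_enc :: "(nat \<Rightarrow> nat) \<Rightarrow> nat \<Rightarrow> nat \<Rightarrow> nat list \<Rightarrow> nat" where
  "colex_enc n lo hi is = (\<Sum>j=lo..hi. is ! (j - 1) * (\<Prod>l\<in>{lo..<j}. n l))"

definition flat :: "nat \<Rightarrow> (nat \<Rightarrow> nat) \<Rightarrow> nat \<Rightarrow> tensor \<Rightarrow> real mat" where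
  "flat d n mu Z = mat (nprod n 1 mu) (nprod n (Suc mu) d)
     (\<lambda>(a, b). Z (colex_dec n 1 mu a @ colex_dec n (Suc mu) d b))"

definition unflat :: "nat \<Rightarrow> (nat \<Rightarrow> nat) \<Rightarrow> nat \<Rightarrow> real mat \<Rightarrow> tensor" where
  "unflat d n mu M = (\<lambda>is. if valid_idx d n is
      then M $$ (colex_enc n 1 mu is, colex_enc n (Suc mu) d is) else 0)"

definition mrank :: "real mat \<Rightarrow> nat" where
  "mrank A = vec_space.rank (dim_row A) A"

definition tt_rank :: "nat \<Rightarrow> (nat \<Rightarrow> nat) \<Rightarrow> tensor \<Rightarrow> nat \<Rightarrow> nat" where
  "tt_rank d n Z mu = mrank (flat d n mu Z)"

definition Mr :: "nat \<Rightarrow> (nat \<Rightarrow> nat) \<Rightarrow> (nat \<Rightarrow> nat) \<Rightarrow> tensor set" where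
  "Mr d n r = {Z \<in> tensors d n. \<forall>mu\<in>{1..<d}. tt_rank d n Z mu = r mu}"

definition kron :: "real mat \<Rightarrow> real mat \<Rightarrow> real mat" where
  "kron A B = mat (dim_row A * dim_row B) (dim_col A * dim_col B)
     (\<lambda>(i, j). A $$ (i div dim_row B, j div dim_col B) * B $$ (i mod dim_row B, j mod dim_col B))"

(* cores: U k i is the slice U_k(i) \<in> R^{r_{k-1} x r_k}, for k = 1..d and i < n k *)
type_synonym cores = "nat \<Rightarrow> nat \<Rightarrow> real mat"

definition cores_ok :: "nat \<Rightarrow> (nat \<Rightarrow> nat) \<Rightarrow> (nat \<Rightarrow> nat) \<Rightarrow> cores \<Rightarrow> bool" where
  "cores_ok d n r U \<longleftrightarrow> (\<forall>k\<in>{1..d}. \<forall>i<n k. U k i \<in> carrier_mat (r (k - 1)) (r k))"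

fun core_prod :: "(nat \<Rightarrow> nat) \<Rightarrow> cores \<Rightarrow> nat list \<Rightarrow> nat \<Rightarrow> nat \<Rightarrow> real mat" where
  "core_prod r U is lo 0 = 1\<^sub>m (r (lo - 1))"
| "core_prod r U is lo (Suc m) = core_prod r U is lo m * U (lo + m) (is ! (lo + m - 1))"

definition tt_eval :: "nat \<Rightarrow> (nat \<Rightarrow> nat) \<Rightarrow> (nat \<Rightarrow> nat) \<Rightarrow> cores \<Rightarrow> tensor" where
  "tt_eval d n r U = (\<lambda>is. if valid_idx d n is then core_prod r U is 1 d $$ (0, 0) else 0)"

definition is_TT :: "nat \<Rightarrow> (nat \<Rightarrow> nat) \<Rightarrow> (nat \<Rightarrow> nat) \<Rightarrow> cores \<Rightarrow> tensor \<Rightarrow> bool" where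
  "is_TT d n r U X \<longleftrightarrow> cores_ok d n r U \<and> X = tt_eval d n r U"

definition minimal_TT :: "nat \<Rightarrow> (nat \<Rightarrow> nat) \<Rightarrow> (nat \<Rightarrow> nat) \<Rightarrow> cores \<Rightarrow> tensor \<Rightarrow> bool" where
  "minimal_TT d n r U X \<longleftrightarrow> is_TT d n r U X \<and> (\<forall>mu\<in>{1..<d}. tt_rank d n X mu = r mu)"

(* U_k^L = U_k^{<2>} \<in> R^{r_{k-1} n_k x r_k} *)
definition coreL :: "(nat \<Rightarrow> nat) \<Rightarrow> (nat \<Rightarrow> nat) \<Rightarrow> cores \<Rightarrow> nat \<Rightarrow> real mat" where
  "coreL n r U k = mat (r (k - 1) * n k) (r k)
     (\<lambda>(a, b). U k (a div r (k - 1)) $$ (a mod r (k - 1), b))"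

(* U_k^R = U_k^{<1>} \<in> R^{r_{k-1} x n_k r_k} *)
definition coreR :: "(nat \<Rightarrow> nat) \<Rightarrow> (nat \<Rightarrow> nat) \<Rightarrow> cores \<Rightarrow> nat \<Rightarrow> real mat" where
  "coreR n r U k = mat (r (k - 1)) (n k * r k)
     (\<lambda>(a, b). U k (b mod n k) $$ (a, b div n k))"

definition left_orth :: "nat \<Rightarrow> (nat \<Rightarrow> nat) \<Rightarrow> (nat \<Rightarrow> nat) \<Rightarrow> cores \<Rightarrow> bool" where
  "left_orth d n r U \<longleftrightarrow> (\<forall>k\<in>{1..<d}. (coreL n r U k)\<^sup>T * coreL n r U k = 1\<^sub>m (r k))"

definition right_orth :: "nat \<Rightarrow> (nat \<Rightarrow> nat) \<Rightarrow> (nat \<Rightarrow> nat) \<Rightarrow> cores \<Rightarrow> bool" where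
  "right_orth d n r U \<longleftrightarrow> (\<forall>k\<in>{2..d}. coreR n r U k * (coreR n r U k)\<^sup>T = 1\<^sub>m (r (k - 1)))"

fun Xle :: "(nat \<Rightarrow> nat) \<Rightarrow> (nat \<Rightarrow> nat) \<Rightarrow> cores \<Rightarrow> nat \<Rightarrow> real mat" where
  "Xle n r U 0 = 1\<^sub>m 1"
| "Xle n r U (Suc k) = kron (1\<^sub>m (n (Suc k))) (Xle n r U k) * coreL n r U (Suc k)"

(* XgeT_aux m = X_{>= d+1-m}^T *)
fun XgeT_aux :: "nat \<Rightarrow> (nat \<Rightarrow> nat) \<Rightarrow> (nat \<Rightarrow> nat) \<Rightarrow> cores \<Rightarrow> nat \<Rightarrow> real mat" where
  "XgeT_aux d n r U 0 = 1\<^sub>m 1"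
| "XgeT_aux d n r U (Suc m) = coreR n r U (d - m) * kron (XgeT_aux d n r U m) (1\<^sub>m (n (d - m)))"

definition Xge :: "nat \<Rightarrow> (nat \<Rightarrow> nat) \<Rightarrow> (nat \<Rightarrow> nat) \<Rightarrow> cores \<Rightarrow> nat \<Rightarrow> real mat" where
  "Xge d n r U k = (XgeT_aux d n r U (Suc d - k))\<^sup>T"

fun Vle :: "(nat \<Rightarrow> nat) \<Rightarrow> (nat \<Rightarrow> nat) \<Rightarrow> cores \<Rightarrow> cores \<Rightarrow> nat \<Rightarrow> real mat" where
  "Vle n r U dV 0 = 0\<^sub>m 1 1"
| "Vle n r U dV (Suc k) = kron (1\<^sub>m (n (Suc k))) (Vle n r U dV k) * coreL n r U (Suc k)
     + kron (1\<^sub>m (n (Suc k))) (Xle n r U k) * coreL n r dV (Suc k)"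

fun VgeT_aux :: "nat \<Rightarrow> (nat \<Rightarrow> nat) \<Rightarrow> (nat \<Rightarrow> nat) \<Rightarrow> cores \<Rightarrow> cores \<Rightarrow> nat \<Rightarrow> real mat" where
  "VgeT_aux d n r U dV 0 = 0\<^sub>m 1 1"
| "VgeT_aux d n r U dV (Suc m) = coreR n r U (d - m) * kron (VgeT_aux d n r U dV m) (1\<^sub>m (n (d - m)))
     + coreR n r dV (d - m) * kron (XgeT_aux d n r U m) (1\<^sub>m (n (d - m)))"

definition Vge :: "nat \<Rightarrow> (nat \<Rightarrow> nat) \<Rightarrow> (nat \<Rightarrow> nat) \<Rightarrow> cores \<Rightarrow> cores \<Rightarrow> nat \<Rightarrow> real mat" where
  "Vge d n r U dV k = (VgeT_aux d n r U dV (Suc d - k))\<^sup>T"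

definition tt_tangent :: "nat \<Rightarrow> (nat \<Rightarrow> nat) \<Rightarrow> (nat \<Rightarrow> nat) \<Rightarrow> cores \<Rightarrow> cores \<Rightarrow> tensor" where
  "tt_tangent d n r U dV = (\<lambda>is. if valid_idx d n is then
     (\<Sum>k=1..d. (core_prod r U is 1 (k - 1) * dV k (is ! (k - 1))
                 * core_prod r U is (Suc k) (d - k)) $$ (0, 0)) else 0)"

definition gauge :: "nat \<Rightarrow> (nat \<Rightarrow> nat) \<Rightarrow> (nat \<Rightarrow> nat) \<Rightarrow> cores \<Rightarrow> cores \<Rightarrow> bool" where
  "gauge d n r U dV \<longleftrightarrow> (\<forall>k\<in>{1..<d}. (coreL n r dV k)\<^sup>T * coreL n r U k = 0\<^sub>m (r k) (r k))"

definition lo_dec :: "nat \<Rightarrow> (nat \<Rightarrow> nat) \<Rightarrow> (nat \<Rightarrow> nat) \<Rightarrow> tensor \<Rightarrow> cores" where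
  "lo_dec d n r Y = (SOME U. minimal_TT d n r U Y \<and> left_orth d n r U)"

definition ro_dec :: "nat \<Rightarrow> (nat \<Rightarrow> nat) \<Rightarrow> (nat \<Rightarrow> nat) \<Rightarrow> tensor \<Rightarrow> cores" where
  "ro_dec d n r Y = (SOME U. minimal_TT d n r U Y \<and> right_orth d n r U)"

definition proj :: "nat \<Rightarrow> (nat \<Rightarrow> nat) \<Rightarrow> (nat \<Rightarrow> nat) \<Rightarrow> nat \<Rightarrow> tensor \<Rightarrow> tensor \<Rightarrow> tensor" where
  "proj d n r k Y Z = (let U = lo_dec d n r Y; tU = ro_dec d n r Y in
     if k < d then unflat d n k
       (kron (1\<^sub>m (n k)) (Xle n r U (k - 1))
        * (1\<^sub>m (r (k - 1) * n k) - coreL n r U k * (coreL n r U k)\<^sup>T)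
        * (kron (1\<^sub>m (n k)) (Xle n r U (k - 1)))\<^sup>T
        * flat d n k Z * Xge d n r tU (Suc k) * (Xge d n r tU (Suc k))\<^sup>T)
     else unflat d n d
       (kron (1\<^sub>m (n d)) (Xle n r U (d - 1) * (Xle n r U (d - 1))\<^sup>T) * flat d n d Z))"

definition smooth_on_ival :: "(real \<Rightarrow> real) \<Rightarrow> real \<Rightarrow> bool" where
  "smooth_on_ival f e \<longleftrightarrow> (\<exists>fs. fs 0 = f \<and>
     (\<forall>m t. \<bar>t\<bar> < e \<longrightarrow> (fs m has_real_derivative fs (Suc m) t) (at t)))"

definition smooth_curve_through :: "nat \<Rightarrow> (nat \<Rightarrow> nat) \<Rightarrow> (nat \<Rightarrow> nat) \<Rightarrow> (real \<Rightarrow> tensor)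
    \<Rightarrow> tensor \<Rightarrow> tensor \<Rightarrow> bool" where
  "smooth_curve_through d n r c X V \<longleftrightarrow>
     (\<exists>e>0. (\<forall>t. \<bar>t\<bar> < e \<longrightarrow> c t \<in> Mr d n r) \<and> (\<forall>is. smooth_on_ival (\<lambda>t. c t is) e))
     \<and> c 0 = X \<and> (\<forall>is. ((\<lambda>t. c t is) has_real_derivative V is) (at 0))"

definition DP_along :: "nat \<Rightarrow> (nat \<Rightarrow> nat) \<Rightarrow> (nat \<Rightarrow> nat) \<Rightarrow> nat \<Rightarrow> (real \<Rightarrow> tensor) \<Rightarrow> tensor \<Rightarrow> tensor" where
  "DP_along d n r k c Z = (\<lambda>is. SOME D. ((\<lambda>t. proj d n r k (c t) Z is) has_real_derivative D) (at 0))"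

end

theory Submission
  imports Defs
begin

text \<open>Up to flattening, \<open>\<P>\<^sub>Y\<^sup>k Z = (I \<otimes> \<Pi>\<^sub>k\<^sub>-\<^sub>1 - \<Pi>\<^sub>k) Z Q\<^sub>k\<close>, where \<open>\<Pi>\<^sub>k\<close> and \<open>Q\<^sub>k\<close> are the orthogonal projectors
  onto the column and row space of the \<open>k\<close>-th flattening of \<open>Y\<close>. Along a curve of constant rank these projectors
  are differentiable: if \<open>P(t) A(t) = A(t)\<close>, \<open>P(t)\<close> has constant trace and \<open>S = A(0) W\<close> is an orthonormal basis
  of the range of \<open>P(0)\<close>, then \<open>P' = D S\<^sup>T + S D\<^sup>T\<close> with \<open>D = (I - S S\<^sup>T) A' W\<close>. Taking for \<open>S\<close> the interface
  matrices of \<open>X\<close>, the gauge conditions reduce \<open>D\<close> to \<open>V\<^sub>\<le>\<^sub>k\<close> for the columns and to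
  \<open>(I - S S\<^sup>T) V\<^sub>\<ge>\<^sub>k\<^sub>+\<^sub>1 R\<^sub>k\<^sup>-\<^sup>1\<close> for the rows; the formulas follow from the product rule.\<close>

text \<open>The obstacle is that \<open>proj\<close> is computed from decompositions picked by
  \<open>SOME\<close>, separately for every tensor. Along the curve the chosen cores may jump, so
  neither they nor their interface matrices can be differentiated; only products like
  \<open>S * S\<^sup>T\<close> have a chance, and even these are not known to be continuous. What is
  known is that they are symmetric, idempotent, of trace \<open>r k\<close>, and fix the flattening
  A(t). The derivative is therefore bootstrapped: idempotence bounds the entries of P(t); this bound
  and P A = A give continuity at 0; continuity gives the derivative of (P - I) S; and the remaining
  part of P is of second order because P(t) and P(0) have the same rank. Rank enters as a trace,
  which turns equality of ranks into an equation between entries. The choices mean something only if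
  orthogonal decompositions exist for every tensor of the manifold, hence the TT-SVD constructions.
  Freedom of choice pays off at X: there both projectors may be written with the given
  \<open>U\<close> and \<open>tU\<close>, to which the gauge conditions apply.\<close>

declare One_nat_def [simp del] plus_1_eq_Suc [simp]

section \<open>Matrix algebra\<close>

text \<open>Sums over an index range can be swapped, regrouped and differentiated termwise;
  \<open>index_mult_mat(1)\<close> would give scalar products of rows and columns instead and is
  often removed from the simpset for that reason.\<close>

lemma mult_index_sum:
  assumes "i < dim_row A" "j < dim_col B" "dim_col A = dim_row B"
  shows "(A * B :: real mat) $$ (i, j) = (\<Sum>l<dim_col A. A $$ (i, l) * B $$ (l, j))"
  using assms by (auto simp: scalar_prod_def atLeast0LessThan intro!: sum.cong)

text \<open>This law and the following ones have equations between dimensions in place of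
  \<open>carrier_mat\<close> premises: no intermediate dimension is left free, so simp can discharge
  them.\<close>

lemma mat_assoc:
  fixes A B C :: "real mat"
  assumes "dim_col A = dim_row B" "dim_col B = dim_row C"
  shows "A * B * C = A * (B * C)"
  using assms by (intro assoc_mult_mat[of _ "dim_row A" "dim_col A" _ "dim_col B" _ "dim_col C"]) auto

lemma mat_trans_mult:
  fixes A B :: "real mat"
  assumes "dim_col A = dim_row B"
  shows "(A * B)\<^sup>T = B\<^sup>T * A\<^sup>T"
  using assms by (intro transpose_mult[of _ "dim_row A" "dim_col A" _ "dim_col B"]) auto

lemma mat_left_add:
  fixes A B C :: "real mat"
  assumes "dim_col A = dim_row B" "dim_row B = dim_row C" "dim_col B = dim_col C"
  shows "A * (B + C) = A * B + A * C"
  using assms by (intro mult_add_distrib_mat[of _ "dim_row A" "dim_col A" _ "dim_col B"]) auto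

lemma mat_right_add:
  fixes A B C :: "real mat"
  assumes "dim_col B = dim_row A" "dim_row B = dim_row C" "dim_col B = dim_col C"
  shows "(B + C) * A = B * A + C * A"
  using assms by (intro add_mult_distrib_mat[of _ "dim_row B" "dim_col B" _ _ "dim_col A"]) auto

lemma mat_left_diff:
  fixes A B C :: "real mat"
  assumes "dim_col A = dim_row B" "dim_row B = dim_row C" "dim_col B = dim_col C"
  shows "A * (B - C) = A * B - A * C"
  using assms by (intro mult_minus_distrib_mat[of _ "dim_row A" "dim_col A" _ "dim_col B"]) auto

lemma mat_right_diff:
  fixes A B C :: "real mat"
  assumes "dim_col B = dim_row A" "dim_row B = dim_row C" "dim_col B = dim_col C"
  shows "(B - C) * A = B * A - C * A"
  using assms by (intro minus_mult_distrib_mat[of _ "dim_row B" "dim_col B" _ _ "dim_col A"]) auto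

lemma mat_add_assoc:
  fixes A B C :: "real mat"
  assumes "dim_row A = dim_row B" "dim_row B = dim_row C" "dim_col A = dim_col B" "dim_col B = dim_col C"
  shows "A + B + C = A + (B + C)"
  using assms by (intro eq_matI) auto

lemma mat_trans_add:
  fixes A B :: "real mat"
  assumes "dim_row A = dim_row B" "dim_col A = dim_col B"
  shows "(A + B)\<^sup>T = A\<^sup>T + B\<^sup>T"
  using assms by (intro eq_matI) auto

lemma mat_trans_diff:
  fixes A B :: "real mat"
  assumes "dim_row A = dim_row B" "dim_col A = dim_col B"
  shows "(A - B)\<^sup>T = A\<^sup>T - B\<^sup>T"
  using assms by (intro eq_matI) auto

lemma mat_left_one: "dim_row A = m \<Longrightarrow> 1\<^sub>m m * (A :: real mat) = A"
  by (intro left_mult_one_mat[of _ m "dim_col A"]) auto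

lemma mat_right_one: "dim_col A = m \<Longrightarrow> (A :: real mat) * 1\<^sub>m m = A"
  by (intro right_mult_one_mat[of _ "dim_row A" m]) auto

lemma mat_left_zero: "dim_row A = m \<Longrightarrow> 0\<^sub>m p m * (A :: real mat) = 0\<^sub>m p (dim_col A)"
  by (intro left_mult_zero_mat[of _ m "dim_col A"]) auto

lemma mat_right_zero: "dim_col A = m \<Longrightarrow> (A :: real mat) * 0\<^sub>m m p = 0\<^sub>m (dim_row A) p"
  by (intro right_mult_zero_mat[of _ "dim_row A" m]) auto

lemma mat_add_zero:
  fixes A :: "real mat"
  assumes "dim_row A = m" "dim_col A = p"
  shows "A + 0\<^sub>m m p = A" "0\<^sub>m m p + A = A" "A - 0\<^sub>m m p = A"
  using assms by (auto intro!: eq_matI)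

lemmas mat_distribs = mat_left_add mat_right_add mat_left_diff mat_right_diff
  mat_trans_mult mat_trans_add mat_trans_diff

lemmas mat_units = mat_left_one mat_right_one mat_left_zero mat_right_zero mat_add_zero

text \<open>In the right-nested normal form produced by \<open>mat_assoc\<close>,
  \<open>A * B\<close> is no longer a subterm; this is the cancellation rule for that form.\<close>

lemma mat_cancel:
  fixes A B C :: "real mat"
  assumes "A * B = 1\<^sub>m p" "dim_col A = dim_row B" "dim_col B = dim_row C" "p = dim_row C"
  shows "A * (B * C) = C"
proof -
  have "A * (B * C) = (A * B) * C" using assms(2,3) by (simp add: mat_assoc)
  then show ?thesis using assms(1,4) by (simp add: mat_units)
qed

section \<open>Kronecker products\<close>

lemma kron_dims [simp]:
  "dim_row (kron A B) = dim_row A * dim_row B" "dim_col (kron A B) = dim_col A * dim_col B"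
  by (simp_all add: kron_def)

lemma div_less_mult: "i < p * q \<Longrightarrow> i div q < (p :: nat)"
  by (simp add: less_mult_imp_div_less)

lemma mod_less_mult: "i < p * q \<Longrightarrow> i mod q < (q :: nat)"
  by (metis mod_less_divisor mult_0_right not_less_zero neq0_conv)

lemma kron_index:
  assumes "i < dim_row A * dim_row B" "j < dim_col A * dim_col B"
  shows "kron A B $$ (i, j) = A $$ (i div dim_row B, j div dim_col B) * B $$ (i mod dim_row B, j mod dim_col B)"
  using assms by (simp add: kron_def)

text \<open>Writing l = a q + b cuts the range into \<open>p\<close> blocks of length
  \<open>q\<close>; this is how the inner index of a product of Kronecker products splits.\<close>

lemma sum_div_mod:
  fixes f :: "nat \<Rightarrow> nat \<Rightarrow> real"
  shows "(\<Sum>l<p * q. f (l div q) (l mod q)) = (\<Sum>a<p. \<Sum>b<q. f a b)"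
proof -
  have "(\<Sum>l<p * q. f (l div q) (l mod q)) = (\<Sum>a<p. \<Sum>l\<in>{a * q..<a * q + q}. f (l div q) (l mod q))"
    by (rule sum.nat_group[symmetric])
  also have "\<dots> = (\<Sum>a<p. \<Sum>b<q. f a b)"
  proof (rule sum.cong)
    fix a
    have "(\<Sum>l\<in>{a * q..<a * q + q}. f (l div q) (l mod q)) =
        (\<Sum>b\<in>{0..<q}. f ((b + a * q) div q) ((b + a * q) mod q))"
      using sum.shift_bounds_nat_ivl[of "\<lambda>l. f (l div q) (l mod q)" 0 "a * q" q]
      by (simp add: add.commute)
    also have "\<dots> = (\<Sum>b<q. f a b)"
      by (auto simp: atLeast0LessThan intro!: sum.cong)
    finally show "(\<Sum>l\<in>{a * q..<a * q + q}. f (l div q) (l mod q)) = (\<Sum>b<q. f a b)" .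
  qed simp
  finally show ?thesis .
qed

lemma kron_mult:
  assumes "dim_col A = dim_row C" "dim_col B = dim_row D"
  shows "kron A B * kron C D = kron (A * C) (B * D)"
proof (rule eq_matI)
  fix i j assume "i < dim_row (kron (A * C) (B * D))" "j < dim_col (kron (A * C) (B * D))"
  then have i: "i < dim_row A * dim_row B" and j: "j < dim_col C * dim_col D" by simp_all
  have "(kron A B * kron C D) $$ (i, j) = (\<Sum>l<dim_col A * dim_col B.
      kron A B $$ (i, l) * kron C D $$ (l, j))"
    using i j assms by (subst mult_index_sum) auto
  also have "\<dots> = (\<Sum>l<dim_col A * dim_col B.
      (A $$ (i div dim_row B, l div dim_col B) * B $$ (i mod dim_row B, l mod dim_col B))
      * (C $$ (l div dim_col B, j div dim_col D) * D $$ (l mod dim_col B, j mod dim_col D)))"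
    using i j assms by (intro sum.cong) (auto simp: kron_index)
  also have "\<dots> = (\<Sum>a<dim_col A. \<Sum>b<dim_col B.
      (A $$ (i div dim_row B, a) * B $$ (i mod dim_row B, b))
      * (C $$ (a, j div dim_col D) * D $$ (b, j mod dim_col D)))"
    by (rule sum_div_mod)
  also have "\<dots> = (\<Sum>a<dim_col A. A $$ (i div dim_row B, a) * C $$ (a, j div dim_col D))
     * (\<Sum>b<dim_col B. B $$ (i mod dim_row B, b) * D $$ (b, j mod dim_col D))"
    by (simp add: sum_product algebra_simps)
  also have "\<dots> = (A * C) $$ (i div dim_row B, j div dim_col D) * (B * D) $$ (i mod dim_row B, j mod dim_col D)"
    using i j assms by (simp add: mult_index_sum div_less_mult mod_less_mult del: index_mult_mat(1))
  also have "\<dots> = kron (A * C) (B * D) $$ (i, j)"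
    using i j by (subst kron_index) auto
  finally show "(kron A B * kron C D) $$ (i, j) = kron (A * C) (B * D) $$ (i, j)" .
qed auto

lemma kron_trans: "(kron A B)\<^sup>T = kron (A\<^sup>T) (B\<^sup>T)"
  by (rule eq_matI) (auto simp: kron_index div_less_mult mod_less_mult)

lemma kron_one: "kron (1\<^sub>m p) (1\<^sub>m q) = 1\<^sub>m (p * q)"
proof (rule eq_matI)
  fix i j assume "i < dim_row (1\<^sub>m (p * q) :: real mat)" "j < dim_col (1\<^sub>m (p * q) :: real mat)"
  then have ij: "i < p * q" "j < p * q" by auto
  have "i = j \<longleftrightarrow> i div q = j div q \<and> i mod q = j mod q"
    by (metis div_mult_mod_eq)
  then show "kron (1\<^sub>m p) (1\<^sub>m q) $$ (i, j) = (1\<^sub>m (p * q) :: real mat) $$ (i, j)"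
    using ij by (auto simp: kron_index div_less_mult mod_less_mult)
qed auto

lemma kron_add_right:
  assumes "dim_row B = dim_row C" "dim_col B = dim_col C"
  shows "kron A (B + C) = kron A B + kron A C"
  using assms
  by (intro eq_matI) (auto simp: kron_index div_less_mult mod_less_mult algebra_simps)

lemma kron_zero: "kron A (0\<^sub>m p q) = 0\<^sub>m (dim_row A * p) (dim_col A * q)"
  by (intro eq_matI) (auto simp: kron_index div_less_mult mod_less_mult)

lemma kron_mult_id:
  assumes "dim_col A = dim_row B"
  shows "kron (1\<^sub>m p) A * kron (1\<^sub>m p) B = kron (1\<^sub>m p) (A * B)"
    and "kron A (1\<^sub>m p) * kron B (1\<^sub>m p) = kron (A * B) (1\<^sub>m p)"
  using assms by (simp_all add: kron_mult mat_units)

text \<open>The trace of an orthogonal projector is its rank; in this form equality of ranks can be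
  used in computations with entries.\<close>

definition mtrace :: "real mat \<Rightarrow> real" where
  "mtrace A = (\<Sum>i<dim_row A. A $$ (i, i))"

lemma mtrace_comm:
  assumes "dim_col A = dim_row B" "dim_col B = dim_row A"
  shows "mtrace (A * B) = mtrace (B * A)"
proof -
  have "mtrace (A * B) = (\<Sum>i<dim_row A. \<Sum>l<dim_col A. A $$ (i, l) * B $$ (l, i))"
    using assms by (simp add: mtrace_def mult_index_sum del: index_mult_mat(1))
  also have "\<dots> = (\<Sum>l<dim_col A. \<Sum>i<dim_row A. A $$ (i, l) * B $$ (l, i))"
    by (rule sum.swap)
  also have "\<dots> = mtrace (B * A)"
    using assms by (simp add: mtrace_def mult_index_sum mult.commute del: index_mult_mat(1))
  finally show ?thesis .
qed

lemma mtrace_one: "mtrace (1\<^sub>m m) = real m"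
  by (simp add: mtrace_def)

lemma mtrace_add: "dim_row A = dim_row B \<Longrightarrow> dim_col A = dim_col B \<Longrightarrow> dim_row A = dim_col A \<Longrightarrow> mtrace (A + B) = mtrace A + mtrace B"
  by (simp add: mtrace_def sum.distrib)

lemma mtrace_diff: "dim_row A = dim_row B \<Longrightarrow> dim_col A = dim_col B \<Longrightarrow> dim_row A = dim_col A \<Longrightarrow> mtrace (A - B) = mtrace A - mtrace B"
  by (simp add: mtrace_def sum_subtractf)

lemma mtrace_gram: "mtrace (A\<^sup>T * A) = (\<Sum>j<dim_col A. \<Sum>l<dim_row A. (A $$ (l, j))\<^sup>2)"
  by (simp add: mtrace_def mult_index_sum power2_eq_square del: index_mult_mat(1))

section \<open>Orthonormal bases and rank\<close>

definition is_projector :: "nat \<Rightarrow> real mat \<Rightarrow> bool" where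
  "is_projector m P \<longleftrightarrow> P \<in> carrier_mat m m \<and> P\<^sup>T = P \<and> P * P = P"

lemma is_projectorD:
  assumes "is_projector m P"
  shows "dim_row P = m" "dim_col P = m" "P\<^sup>T = P" "P * P = P"
  using assms by (auto simp: is_projector_def)

lemma is_projector_gram:
  fixes S :: "real mat"
  assumes "S \<in> carrier_mat m s" "S\<^sup>T * S = 1\<^sub>m s"
  shows "is_projector m (S * S\<^sup>T)"
proof -
  have d: "dim_row S = m" "dim_col S = s" using assms by auto
  have "S * S\<^sup>T * (S * S\<^sup>T) = S * ((S\<^sup>T * S) * S\<^sup>T)"
    by (simp add: mat_assoc d)
  also have "\<dots> = S * S\<^sup>T" by (simp add: assms(2) mat_units d)
  finally have "S * S\<^sup>T * (S * S\<^sup>T) = S * S\<^sup>T" .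
  moreover have "(S * S\<^sup>T)\<^sup>T = S * S\<^sup>T" by (simp add: mat_trans_mult d)
  ultimately show ?thesis using d unfolding is_projector_def by auto
qed

text \<open>Symmetry and idempotence make \<open>P $$ (i, i)\<close> the squared norm of row
  \<open>i\<close>. It dominates its own square, hence is at most 1, and it dominates the square of
  every entry of the row. This is the bound available before the projectors are known to be
  continuous.\<close>

lemma is_projector_entry:
  assumes P: "is_projector m P" and i: "i < m" and j: "j < m"
  shows "\<bar>P $$ (i, j)\<bar> \<le> 1"
proof -
  note d = is_projectorD[OF P]
  have sym: "P $$ (l, i) = P $$ (i, l)" if "l < m" for l
    using d i that by (metis index_transpose_mat(1))
  have "P $$ (i, i) = (\<Sum>l<m. P $$ (i, l) * P $$ (l, i))"
    using mult_index_sum[of i P i P] d(1,2) i unfolding d(4) by simp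
  also have "\<dots> = (\<Sum>l<m. (P $$ (i, l))\<^sup>2)"
    by (intro sum.cong) (simp_all add: sym[symmetric] power2_eq_square)
  finally have eq: "P $$ (i, i) = (\<Sum>l<m. (P $$ (i, l))\<^sup>2)" .
  have "(P $$ (i, l))\<^sup>2 \<le> P $$ (i, i)" if "l < m" for l
    using member_le_sum[of l "{..<m}" "\<lambda>l. (P $$ (i, l))\<^sup>2"] that unfolding eq[symmetric] by simp
  from this[OF i] this[OF j] have "(P $$ (i, i))\<^sup>2 \<le> P $$ (i, i)" "(P $$ (i, j))\<^sup>2 \<le> P $$ (i, i)"
    by auto
  moreover from this have "P $$ (i, i) \<le> 1"
    using mult_strict_left_mono[of 1 "P $$ (i, i)" "P $$ (i, i)"]
    by (force simp: power2_eq_square not_le[symmetric])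
  ultimately have "(P $$ (i, j))\<^sup>2 \<le> 1" by simp
  then show ?thesis by (simp add: abs_square_le_1)
qed

lemma mtrace_projector:
  fixes S :: "real mat"
  assumes "S \<in> carrier_mat m s" "S\<^sup>T * S = 1\<^sub>m s"
  shows "mtrace (S * S\<^sup>T) = real s"
  using assms mtrace_comm[of S "S\<^sup>T"] by (simp add: mtrace_one)

text \<open>The trace of \<open>S * S\<^sup>T\<close> is \<open>s\<close>, and each of its
  \<open>m\<close> diagonal entries is at most 1.\<close>

lemma orthonormal_card_le:
  fixes S :: "real mat"
  assumes "S \<in> carrier_mat m s" "S\<^sup>T * S = 1\<^sub>m s"
  shows "s \<le> m"
proof -
  have "mtrace (S * S\<^sup>T) \<le> (\<Sum>i<m. 1)"
    using assms(1) is_projector_entry[OF is_projector_gram[OF assms]] abs_le_D1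
    unfolding mtrace_def by (intro order.trans[OF eq_refl sum_mono]) (auto simp del: index_mult_mat(1))
  then show ?thesis using mtrace_projector[OF assms] by simp
qed

text \<open>The columns of \<open>S\<close> are an orthonormal basis of the column space of
  \<open>A\<close>: \<open>S * S\<^sup>T * A = A\<close> says that they span it,
  \<open>S = A * W\<close> that they lie in it.\<close>

definition orth_basis :: "real mat \<Rightarrow> real mat \<Rightarrow> bool" where
  "orth_basis A S \<longleftrightarrow> dim_row S = dim_row A \<and> S\<^sup>T * S = 1\<^sub>m (dim_col S) \<and> S * S\<^sup>T * A = A
     \<and> (\<exists>W \<in> carrier_mat (dim_col A) (dim_col S). S = A * W)"

lemma orth_basisE:
  assumes "orth_basis A S"
  obtains W where "dim_row S = dim_row A" "S\<^sup>T * S = 1\<^sub>m (dim_col S)" "S * S\<^sup>T * A = A"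
    "W \<in> carrier_mat (dim_col A) (dim_col S)" "S = A * W"
  using assms unfolding orth_basis_def by (elim conjE bexE) (rule that)

lemma orthonormal_append:
  fixes S :: "real mat"
  assumes S: "S \<in> carrier_mat m s" "S\<^sup>T * S = 1\<^sub>m s"
    and w: "\<And>a. a < s \<Longrightarrow> (\<Sum>i<m. S $$ (i, a) * w i) = 0" "(\<Sum>i<m. (w i)\<^sup>2) = 1"
  defines "S' \<equiv> mat m (Suc s) (\<lambda>(i, a). if a < s then S $$ (i, a) else w i)"
  shows "S'\<^sup>T * S' = 1\<^sub>m (Suc s)"
proof (rule eq_matI)
  fix a b assume "a < dim_row (1\<^sub>m (Suc s) :: real mat)" "b < dim_col (1\<^sub>m (Suc s) :: real mat)"
  then have ab: "a < Suc s" "b < Suc s" by auto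
  have SS: "(\<Sum>i<m. S $$ (i, a) * S $$ (i, b)) = (if a = b then 1 else 0)" if "a < s" "b < s" for a b
    using mult_index_sum[of a "S\<^sup>T" b S] S that by auto
  have "(S'\<^sup>T * S') $$ (a, b) = (\<Sum>i<m. S' $$ (i, a) * S' $$ (i, b))"
    using ab by (subst mult_index_sum) (auto simp: S'_def)
  also have "\<dots> = (\<Sum>i<m. (if a < s then S $$ (i, a) else w i) * (if b < s then S $$ (i, b) else w i))"
    using ab by (intro sum.cong) (auto simp: S'_def)
  also have "\<dots> = (if a = b then 1 else 0)"
  proof (cases "a < s")
    case a: True
    show ?thesis
    proof (cases "b < s")
      case True
      then show ?thesis unfolding if_P[OF a] if_P[OF True] using a by (intro SS)
    next
      case False
      then show ?thesis unfolding if_P[OF a] if_not_P[OF False] using a w(1)[OF a] by simp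
    qed
  next
    case a: False
    show ?thesis
    proof (cases "b < s")
      case True
      then show ?thesis unfolding if_not_P[OF a] if_P[OF True]
        using a w(1)[OF True] by (simp add: mult.commute)
    next
      case False
      then have "a = b" using a ab by simp
      then show ?thesis unfolding if_not_P[OF False] using w(2) False by (simp add: power2_eq_square)
    qed
  qed
  finally show "(S'\<^sup>T * S') $$ (a, b) = (1\<^sub>m (Suc s) :: real mat) $$ (a, b)"
    using ab by simp
qed (auto simp: S'_def)

text \<open>One Gram-Schmidt step. Since \<open>S = A * W\<close>, the residual
  \<open>A - S * (S\<^sup>T * A)\<close> equals \<open>A * K\<close>; some column of it is nonzero,
  and after normalization it is a new basis vector that is still a combination of columns of
  \<open>A\<close>.\<close>

lemma orth_basis_extend:
  fixes S A W :: "real mat"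
  assumes S: "S \<in> carrier_mat m s" "S\<^sup>T * S = 1\<^sub>m s" and A: "A \<in> carrier_mat m N"
    and W: "W \<in> carrier_mat N s" "S = A * W" and ne: "S * S\<^sup>T * A \<noteq> A"
  shows "\<exists>S' W'. S' \<in> carrier_mat m (Suc s) \<and> S'\<^sup>T * S' = 1\<^sub>m (Suc s)
    \<and> W' \<in> carrier_mat N (Suc s) \<and> S' = A * W'"
proof -
  define K where "K = 1\<^sub>m N - W * (S\<^sup>T * A)"
  define E where "E = A * K"
  note [simp] = carrier_matD[OF S(1)] carrier_matD[OF A] carrier_matD[OF W(1)]
  have [simp]: "dim_row K = N" "dim_col K = N" "dim_row E = m" "dim_col E = N"
    by (simp_all add: K_def E_def)
  have "E = A - A * (W * (S\<^sup>T * A))"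
    unfolding E_def K_def by (simp add: mat_distribs mat_units)
  also have "A * (W * (S\<^sup>T * A)) = (A * W) * (S\<^sup>T * A)" by (simp add: mat_assoc)
  finally have E: "E = A - S * (S\<^sup>T * A)" using W(2) by simp
  have "S\<^sup>T * E = S\<^sup>T * A - (S\<^sup>T * S) * (S\<^sup>T * A)"
    unfolding E by (simp add: mat_distribs mat_assoc)
  also have "\<dots> = 0\<^sub>m s N" by (intro eq_matI) (auto simp: S(2) mat_units)
  finally have SE: "S\<^sup>T * E = 0\<^sub>m s N" .
  have "\<exists>i j. i < m \<and> j < N \<and> E $$ (i, j) \<noteq> 0"
  proof (rule ccontr)
    assume "\<not> ?thesis"
    then have "S * (S\<^sup>T * A) = A"
      unfolding E by (intro eq_matI) (auto simp del: index_mult_mat(1))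
    then show False using ne by (simp add: mat_assoc)
  qed
  then obtain i0 j where ij: "i0 < m" "j < N" "E $$ (i0, j) \<noteq> 0" by blast
  define c where "c = sqrt (\<Sum>i<m. (E $$ (i, j))\<^sup>2)"
  have "(\<Sum>i<m. (E $$ (i, j))\<^sup>2) > 0"
    using ij by (intro sum_pos2[of _ i0]) auto
  then have c: "c > 0" "c\<^sup>2 = (\<Sum>i<m. (E $$ (i, j))\<^sup>2)" by (auto simp: c_def)
  define S' where "S' = mat m (Suc s) (\<lambda>(i, a). if a < s then S $$ (i, a) else E $$ (i, j) / c)"
  define W' where "W' = mat N (Suc s) (\<lambda>(i, a). if a < s then W $$ (i, a) else K $$ (i, j) / c)"
  have orth: "S'\<^sup>T * S' = 1\<^sub>m (Suc s)"
    unfolding S'_def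
  proof (rule orthonormal_append[OF S])
    fix a assume a: "a < s"
    have "(\<Sum>i<m. S $$ (i, a) * E $$ (i, j)) = (S\<^sup>T * E) $$ (a, j)"
      using a ij by (subst mult_index_sum) auto
    then have "(\<Sum>i<m. S $$ (i, a) * E $$ (i, j)) = 0" using a ij SE by simp
    then show "(\<Sum>i<m. S $$ (i, a) * (E $$ (i, j) / c)) = 0"
      by (simp flip: sum_divide_distrib)
  next
    show "(\<Sum>i<m. (E $$ (i, j) / c)\<^sup>2) = 1"
      using c(1) unfolding power_divide sum_divide_distrib[symmetric] c(2)[symmetric] by simp
  qed
  have "S' = A * W'"
  proof (rule eq_matI)
    fix i a assume "i < dim_row (A * W')" "a < dim_col (A * W')"
    then have ia: "i < m" "a < Suc s" by (auto simp: W'_def)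
    have "(A * W') $$ (i, a) = (\<Sum>l<N. A $$ (i, l) * W' $$ (l, a))"
      using ia by (subst mult_index_sum) (auto simp: W'_def)
    also have "\<dots> = (\<Sum>l<N. A $$ (i, l) * (if a < s then W $$ (l, a) else K $$ (l, j) / c))"
      using ia by (intro sum.cong) (auto simp: W'_def)
    also have "\<dots> = (if a < s then (A * W) $$ (i, a) else (A * K) $$ (i, j) / c)"
      using ia ij by (auto simp: mult_index_sum sum_divide_distrib simp del: index_mult_mat(1))
    also have "\<dots> = S' $$ (i, a)"
      using ia unfolding W(2)[symmetric] E_def[symmetric] by (simp add: S'_def)
    finally show "S' $$ (i, a) = (A * W') $$ (i, a)" by simp
  qed (auto simp: S'_def W'_def)
  with orth show ?thesis by (intro exI[of _ S'] exI[of _ W']) (auto simp: S'_def W'_def)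
qed

text \<open>An orthonormal family inside the column space that has the largest possible size, which
  exists because the size is at most \<open>m\<close>, must fix \<open>A\<close>; otherwise it could
  be extended.\<close>

lemma orth_basis_exists: "\<exists>S. orth_basis A S"
proof -
  define m N where "m = dim_row A" and "N = dim_col A"
  have A: "A \<in> carrier_mat m N" by (simp add: m_def N_def)
  define Q where "Q s \<longleftrightarrow> (\<exists>S W. S \<in> carrier_mat m s \<and> S\<^sup>T * S = 1\<^sub>m s
    \<and> W \<in> carrier_mat N s \<and> S = A * W)" for s
  have "Q 0" unfolding Q_def
    by (intro exI[of _ "0\<^sub>m m 0"] exI[of _ "0\<^sub>m N 0"]) (auto simp: m_def N_def)
  moreover have bound: "s \<le> m" if "Q s" for s
    using that orthonormal_card_le unfolding Q_def by blast
  ultimately obtain s where s: "Q s" "\<And>s'. Q s' \<Longrightarrow> s' \<le> s"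
    using Nat.ex_has_greatest_nat[of Q 0 m] by blast
  from s(1) obtain S W where SW: "S \<in> carrier_mat m s" "S\<^sup>T * S = 1\<^sub>m s"
    "W \<in> carrier_mat N s" "S = A * W" unfolding Q_def by blast
  have "S * S\<^sup>T * A = A"
  proof (rule ccontr)
    assume "S * S\<^sup>T * A \<noteq> A"
    from orth_basis_extend[OF SW(1,2) A SW(3,4) this] have "Q (Suc s)" unfolding Q_def by blast
    from s(2)[OF this] show False by simp
  qed
  then show ?thesis unfolding orth_basis_def
    using SW m_def N_def by (intro exI[of _ S]) auto
qed

text \<open>Each column of \<open>B * W\<close> is \<open>B\<close> applied to a column of
  \<open>W\<close>. The inclusion is phrased with the span of \<open>vec_space\<close>, in terms of
  which its \<open>rank\<close> is defined, so that two inclusions give equality of ranks.\<close>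

lemma span_cols_mult:
  fixes B W :: "real mat"
  assumes B: "B \<in> carrier_mat m s" and W: "W \<in> carrier_mat s N"
  shows "LinearCombinations.module.span class_ring (module_vec TYPE(real) m) (set (cols (B * W)))
    \<subseteq> LinearCombinations.module.span class_ring (module_vec TYPE(real) m) (set (cols B))"
proof -
  interpret vec_space "TYPE(real)" m .
  have cB: "set (cols B) \<subseteq> carrier_vec m" using cols_dim[of B] B by auto
  have "set (cols (B * W)) \<subseteq> span (set (cols B))"
  proof
    fix v assume "v \<in> set (cols (B * W))"
    then obtain j where j: "j < N" "v = col (B * W) j"
      using B W by (auto simp: cols_def)
    have "v = B *\<^sub>v col W j" using j B W by (auto simp: col_mult2)
    also have "\<dots> = mat_of_cols m (cols B) *\<^sub>v vec (length (cols B)) (\<lambda>i. col W j $ i)"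
    proof -
      have "mat_of_cols m (cols B) = B" using B mat_of_cols_cols[of B] by auto
      moreover have "vec (length (cols B)) (\<lambda>i. col W j $ i) = col W j"
        using B W by (intro eq_vecI) auto
      ultimately show ?thesis by (simp only:)
    qed
    also have "\<dots> = lincomb_list (\<lambda>i. col W j $ i) (cols B)"
    proof (rule lincomb_list_as_mat_mult[where ws = "cols B" and c = "\<lambda>i. col W j $ i", symmetric])
      show "\<forall>w\<in>set (cols B). dim_vec w = m" using cB carrier_vecD by blast
    qed
    also have "\<dots> \<in> span_list (cols B)" by (rule in_span_listI[OF TrueI refl])
    finally show "v \<in> span (set (cols B))" using span_list_as_span[OF cB] by simp
  qed
  then show ?thesis by (rule span_subsetI[OF cB])
qed

lemma mrank_orthonormal:
  fixes S :: "real mat"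
  assumes S: "S \<in> carrier_mat m s" "S\<^sup>T * S = 1\<^sub>m s"
  shows "mrank S = s"
proof -
  interpret vec_space "TYPE(real)" m .
  have entry: "col S a \<bullet> col S b = (if a = b then 1 else 0)" if "a < s" "b < s" for a b
  proof -
    have "(S\<^sup>T * S) $$ (a, b) = col S a \<bullet> col S b" using S(1) that by simp
    then show ?thesis using S(2) that by simp
  qed
  \<comment> \<open>The rank depends on the set of columns, so coinciding columns have to be
    excluded before counting them.\<close>
  have dist: "distinct (cols S)"
  proof (unfold distinct_conv_nth, intro allI impI)
    fix a b assume "a < length (cols S)" "b < length (cols S)" "a \<noteq> b"
    then have ab: "a < s" "b < s" "a \<noteq> b" using S(1) by auto
    then show "cols S ! a \<noteq> cols S ! b"
      using S(1) entry[of a b] entry[of a a] by auto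
  qed
  have "lin_indpt (set (cols S))"
  proof
    assume "lin_dep (set (cols S))"
    from lin_depE[OF S(1) this dist] obtain v where v: "v \<in> carrier_vec s" "v \<noteq> 0\<^sub>v s"
      "S *\<^sub>v v = 0\<^sub>v m" by blast
    have "v = (S\<^sup>T * S) *\<^sub>v v" using v(1) S(2) by simp
    also have "\<dots> = S\<^sup>T *\<^sub>v (S *\<^sub>v v)"
      using S(1) v(1) by (intro assoc_mult_mat_vec[of _ s m _ s]) auto
    also have "\<dots> = 0\<^sub>v s" unfolding v(3) using S(1) by (intro eq_vecI) auto
    finally show False using v(2) by simp
  qed
  from lin_indpt_full_rank[OF S(1) dist this] show ?thesis
    unfolding mrank_def using S(1) by simp
qed

text \<open>\<open>A\<close> and \<open>S\<close> have the same column span, by one inclusion for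
  each of the two conditions in \<open>orth_basis\<close>. Through this lemma the prescribed
  TT-ranks become the sizes of the cores.\<close>

lemma orth_basis_rank:
  assumes "orth_basis A S"
  shows "dim_col S = mrank A"
proof -
  define m N s where mN: "m = dim_row A" "N = dim_col A" "s = dim_col S"
  from assms obtain W where h: "dim_row S = dim_row A" "S\<^sup>T * S = 1\<^sub>m (dim_col S)" "S * S\<^sup>T * A = A"
     "W \<in> carrier_mat (dim_col A) (dim_col S)" "S = A * W" by (rule orth_basisE)
  have S: "S \<in> carrier_mat m s" and A: "A \<in> carrier_mat m N" using h(1) mN by auto
  interpret vec_space "TYPE(real)" m .
  have "S * (S\<^sup>T * A) = A" using h(3) by (simp add: mat_assoc h(1))
  moreover have "S\<^sup>T * A \<in> carrier_mat s N" using S A by simp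
  ultimately have "span (set (cols A)) \<subseteq> span (set (cols S))"
    using span_cols_mult[OF S, of "S\<^sup>T * A" N] by (simp only:)
  moreover have "span (set (cols S)) \<subseteq> span (set (cols A))"
    using span_cols_mult[OF A, of W s] h(4) unfolding mN h(5)[symmetric] .
  ultimately have "rank A = rank S" unfolding rank_def by simp
  moreover have "mrank A = rank A" "mrank S = rank S"
    unfolding mrank_def using S A by (simp_all only: carrier_matD)
  moreover have "mrank S = s" using mrank_orthonormal[OF S] h(2) mN by (simp only:)
  ultimately show ?thesis using mN by (simp only:)
qed

text \<open>With orthonormal bases \<open>S\<close> of the column space and \<open>T\<close> of the
  row space, the matrix \<open>G\<close> of \<open>A\<close> between them has right inverse
  \<open>L\<close> and left inverse \<open>L'\<close>. These coincide, and comparing the traces of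
  \<open>G * L\<close> and \<open>L' * G\<close> shows that \<open>G\<close> is square.\<close>

lemma mrank_transpose: "mrank (A\<^sup>T) = mrank A"
proof -
  obtain S where S: "orth_basis A S" using orth_basis_exists by blast
  obtain T where T: "orth_basis (A\<^sup>T) T" using orth_basis_exists by blast
  from S obtain W where S': "dim_row S = dim_row A" "S\<^sup>T * S = 1\<^sub>m (dim_col S)" "S * S\<^sup>T * A = A"
     "W \<in> carrier_mat (dim_col A) (dim_col S)" "S = A * W" by (rule orth_basisE)
  from T obtain Y where T': "dim_row T = dim_col A" "T\<^sup>T * T = 1\<^sub>m (dim_col T)" "T * T\<^sup>T * A\<^sup>T = A\<^sup>T"
     "Y \<in> carrier_mat (dim_row A) (dim_col T)" "T = A\<^sup>T * Y" by (rule orth_basisE) (simp only: index_transpose_mat)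
  note [simp] = S'(1) T'(1) carrier_matD[OF S'(4)] carrier_matD[OF T'(4)]
  define G where "G = S\<^sup>T * A * T"
  define L where "L = T\<^sup>T * W"
  define L' where "L' = Y\<^sup>T * S"
  have [simp]: "dim_row G = dim_col S" "dim_col G = dim_col T" "dim_row L = dim_col T" "dim_col L = dim_col S"
     "dim_row L' = dim_col T" "dim_col L' = dim_col S"
    by (simp_all add: G_def L_def L'_def)
  have AT: "A * (T * T\<^sup>T) = A"
    using arg_cong[OF T'(3), of transpose_mat] by (simp add: mat_trans_mult mat_assoc)
  have "G * L = S\<^sup>T * ((A * (T * T\<^sup>T)) * W)" by (simp add: G_def L_def mat_assoc)
  also have "\<dots> = 1\<^sub>m (dim_col S)" by (simp only: AT S'(5)[symmetric] S'(2))
  finally have GL: "G * L = 1\<^sub>m (dim_col S)" .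
  have YA: "T\<^sup>T = Y\<^sup>T * A" using arg_cong[OF T'(5), of transpose_mat] by (simp add: mat_trans_mult)
  have "L' * G = Y\<^sup>T * ((S * S\<^sup>T * A) * T)" by (simp add: G_def L'_def mat_assoc)
  also have "\<dots> = Y\<^sup>T * A * T" unfolding S'(3) by (simp add: mat_assoc)
  finally have LG: "L' * G = 1\<^sub>m (dim_col T)" by (simp only: YA[symmetric] T'(2))
  have "L' * (G * L) = (L' * G) * L" by (simp add: mat_assoc)
  then have "L' = L" unfolding GL LG by (simp add: mat_units)
  then have "mtrace (G * L) = mtrace (L' * G)" by (simp add: mtrace_comm)
  then have "dim_col S = dim_col T" unfolding GL LG by (simp add: mtrace_one)
  then show ?thesis using orth_basis_rank[OF S] orth_basis_rank[OF T] by simp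
qed

section \<open>Colexicographic indices and flattenings\<close>

lemma nprod_empty: "hi < lo \<Longrightarrow> nprod n lo hi = 1"
  and nprod_Suc: "lo \<le> Suc hi \<Longrightarrow> nprod n lo (Suc hi) = n (Suc hi) * nprod n lo hi"
  and nprod_lower: "lo \<le> hi \<Longrightarrow> nprod n lo hi = nprod n (Suc lo) hi * n lo"
  by (auto simp: nprod_def mult.commute prod.atLeast_Suc_atMost)

lemma nprod_less: "(\<Prod>l\<in>{lo..<Suc j}. n l) = nprod n lo j"
  by (simp add: nprod_def atLeastLessThanSuc_atLeastAtMost del: prod.op_ivl_Suc)

lemma nprod_pos_factor:
  assumes "a < nprod n lo hi" "j \<in> {lo..hi}"
  shows "n j > 0"
proof (rule Nat.gr0I)
  assume "n j = 0"
  then have "nprod n lo hi = 0" using assms(2) by (auto simp: nprod_def intro: prod_zero)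
  then show False using assms(1) by simp
qed

lemma colex_enc_simps:
  "hi < lo \<Longrightarrow> colex_enc n lo hi is = 0"
  "lo \<le> Suc hi \<Longrightarrow> colex_enc n lo (Suc hi) is = colex_enc n lo hi is + is ! hi * nprod n lo hi"
  by (auto simp: colex_enc_def nprod_less simp del: prod.op_ivl_Suc)

text \<open>Peels off the fastest index, where \<open>colex_enc_simps\<close> peels off the slowest
  one. Lowering the cut from \<open>Suc k\<close> to \<open>k\<close> adds a fastest index to the
  column multi-index.\<close>

lemma colex_enc_lower:
  assumes "lo \<le> hi"
  shows "colex_enc n lo hi is = colex_enc n (Suc lo) hi is * n lo + is ! (lo - 1)"
proof -
  have "(\<Prod>l\<in>{lo..<j}. n l) = (\<Prod>l\<in>{Suc lo..<j}. n l) * n lo" if "j \<in> {Suc lo..hi}" for j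
    using that by (simp add: prod.atLeast_Suc_lessThan mult.commute)
  then have "(\<Sum>j=Suc lo..hi. is ! (j - 1) * (\<Prod>l\<in>{lo..<j}. n l)) = colex_enc n (Suc lo) hi is * n lo"
    unfolding colex_enc_def sum_distrib_right by (intro sum.cong) auto
  then show ?thesis
    using assms by (simp add: colex_enc_def sum.atLeast_Suc_atMost)
qed

lemma colex_enc_less:
  assumes "\<And>j. j \<in> {lo..hi} \<Longrightarrow> is ! (j - 1) < n j"
  shows "colex_enc n lo hi is < nprod n lo hi"
  using assms
proof (induction hi)
  case 0
  then show ?case by (cases "lo = 0") (auto simp: colex_enc_def nprod_def)
next
  case (Suc hi)
  show ?case
  proof (cases "lo \<le> Suc hi")
    case True
    have "colex_enc n lo hi is < nprod n lo hi" using Suc by simp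
    moreover have "Suc (is ! hi) * nprod n lo hi \<le> n (Suc hi) * nprod n lo hi"
      using Suc.prems[of "Suc hi"] True by (intro mult_right_mono) auto
    ultimately show ?thesis using True by (simp add: colex_enc_simps nprod_Suc)
  qed (simp add: colex_enc_simps nprod_empty)
qed

lemma colex_enc_digit:
  assumes "\<And>j. j \<in> {lo..hi} \<Longrightarrow> is ! (j - 1) < n j" "j \<in> {lo..hi}"
  shows "colex_enc n lo hi is div (\<Prod>l\<in>{lo..<j}. n l) mod n j = is ! (j - 1)"
  using assms
proof (induction hi)
  case 0
  then show ?case by (auto simp: colex_enc_def)
next
  case (Suc hi)
  have less: "colex_enc n lo hi is < nprod n lo hi" using Suc by (intro colex_enc_less) auto
  have lo: "lo \<le> Suc hi" using Suc.prems(2) by simp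
  show ?case
  proof (cases "j = Suc hi")
    case True
    then show ?thesis
      using less lo Suc.prems(1)[of "Suc hi"]
      by (simp add: colex_enc_simps nprod_less del: prod.op_ivl_Suc)
  next
    case False
    then have j: "j \<in> {lo..hi}" using Suc.prems by simp
    let ?p = "\<Prod>l\<in>{lo..<j}. n l"
    \<comment> \<open>The weight of the mode \<open>Suc hi\<close> is a multiple of
      \<open>?p * n j\<close>, so its contribution disappears after division by \<open>?p\<close>
      and reduction modulo \<open>n j\<close>.\<close>
    have "nprod n lo hi = ?p * (\<Prod>l\<in>{j..<Suc hi}. n l)"
      using j unfolding nprod_less[symmetric] by (intro prod.atLeastLessThan_concat[symmetric]) auto
    also have "(\<Prod>l\<in>{j..<Suc hi}. n l) = n j * (\<Prod>l\<in>{Suc j..<Suc hi}. n l)"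
      using j by (intro prod.atLeast_Suc_lessThan) auto
    finally obtain q where q: "nprod n lo hi = ?p * (n j * q)" by blast
    have p: "?p > 0" using less q by (metis mult_0 not_less_zero neq0_conv)
    have "colex_enc n lo (Suc hi) is = colex_enc n lo hi is + ?p * (n j * q * is ! hi)"
      using lo q by (simp add: colex_enc_simps)
    then have "colex_enc n lo (Suc hi) is div ?p = colex_enc n lo hi is div ?p + n j * (q * is ! hi)"
      using p by (simp add: mult.assoc)
    then show ?thesis using Suc.IH j Suc.prems by simp
  qed
qed

text \<open>The remainder on the right makes the statement hold for every \<open>a\<close>; a bound
  on \<open>a\<close> by the product up to \<open>Suc hi\<close> would not survive the
  induction.\<close>

lemma colex_digits_sum:
  "(\<Sum>j=lo..hi. (a div (\<Prod>l\<in>{lo..<j}. n l)) mod n j * (\<Prod>l\<in>{lo..<j}. n l)) = a mod nprod n lo hi"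
proof (induction hi)
  case 0
  then show ?case by (cases "lo = 0") (auto simp: nprod_def)
next
  case (Suc hi)
  have "a mod nprod n lo (Suc hi)
      = nprod n lo hi * (a div nprod n lo hi mod n (Suc hi)) + a mod nprod n lo hi" if "lo \<le> Suc hi"
    using that by (simp add: nprod_Suc mult.commute[of "n (Suc hi)"] mod_mult2_eq)
  then show ?case
    using Suc by (cases "lo \<le> Suc hi")
      (auto simp: nprod_empty nprod_less mult.commute simp del: prod.op_ivl_Suc)
qed

lemma colex_dec_nth:
  "length (colex_dec n lo hi a) = Suc hi - lo"
  "i < Suc hi - lo \<Longrightarrow> colex_dec n lo hi a ! i = (a div (\<Prod>l\<in>{lo..<lo + i}. n l)) mod n (lo + i)"
  by (simp_all add: colex_dec_def del: upt_Suc)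

lemma split_index:
  assumes "k \<le> d" "a < nprod n 1 k" "b < nprod n (Suc k) d"
  defines "is \<equiv> colex_dec n 1 k a @ colex_dec n (Suc k) d b"
  shows "valid_idx d n is" "colex_enc n 1 k is = a" "colex_enc n (Suc k) d is = b"
proof -
  have d1: "is ! (j - 1) = (a div (\<Prod>l\<in>{1..<j}. n l)) mod n j" if "j \<in> {1..k}" for j
    using that by (auto simp: is_def nth_append colex_dec_nth)
  have d2: "is ! (j - 1) = (b div (\<Prod>l\<in>{Suc k..<j}. n l)) mod n j" if "j \<in> {Suc k..d}" for j
    using that assms(1) by (auto simp: is_def nth_append colex_dec_nth)
  have "is ! j < n (Suc j)" if "j < d" for j
    using d1[of "Suc j"] d2[of "Suc j"] that
      nprod_pos_factor[OF assms(2), of "Suc j"] nprod_pos_factor[OF assms(3), of "Suc j"]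
    by (cases "Suc j \<le> k") auto
  then show "valid_idx d n is"
    using assms(1) by (auto simp: valid_idx_def is_def colex_dec_nth)
  have "colex_enc n 1 k is = a mod nprod n 1 k"
    unfolding colex_enc_def colex_digits_sum[symmetric] by (intro sum.cong) (simp_all only: d1)
  then show "colex_enc n 1 k is = a" using assms(2) by simp
  have "colex_enc n (Suc k) d is = b mod nprod n (Suc k) d"
    unfolding colex_enc_def colex_digits_sum[symmetric] by (intro sum.cong) (simp_all only: d2)
  then show "colex_enc n (Suc k) d is = b" using assms(3) by simp
qed

lemma valid_enc_less:
  assumes "valid_idx d n is" "k \<le> d"
  shows "colex_enc n 1 k is < nprod n 1 k" "1 \<le> lo \<Longrightarrow> colex_enc n lo d is < nprod n lo d"
proof -
  have v: "is ! (j - 1) < n j" if "1 \<le> j" "j \<le> d" for j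
    using assms(1) that unfolding valid_idx_def by (cases j) auto
  show "colex_enc n 1 k is < nprod n 1 k"
    using v assms(2) by (intro colex_enc_less) auto
  show "colex_enc n lo d is < nprod n lo d" if "1 \<le> lo"
    using v that by (intro colex_enc_less) auto
qed

lemma dec_enc:
  assumes "valid_idx d n is" "k \<le> d"
  shows "colex_dec n 1 k (colex_enc n 1 k is) @ colex_dec n (Suc k) d (colex_enc n (Suc k) d is) = is"
    (is "?js = is")
proof (rule nth_equalityI)
  have v: "is ! (j - 1) < n j" if "1 \<le> j" "j \<le> d" for j
    using assms(1) that unfolding valid_idx_def by (cases j) auto
  show "length ?js = length is"
    using assms by (auto simp: colex_dec_nth valid_idx_def)
  fix i assume "i < length ?js"
  then have i: "i < d" using assms(2) by (auto simp: colex_dec_nth)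
  have "colex_enc n 1 k is div (\<Prod>l\<in>{1..<Suc i}. n l) mod n (Suc i) = is ! (Suc i - 1)" if "i < k"
    using v that assms(2) by (intro colex_enc_digit) auto
  moreover have "colex_enc n (Suc k) d is div (\<Prod>l\<in>{Suc k..<Suc i}. n l) mod n (Suc i) = is ! (Suc i - 1)"
    if "k \<le> i"
    using v that i by (intro colex_enc_digit) auto
  ultimately show "?js ! i = is ! i"
    using i by (cases "i < k") (auto simp: nth_append colex_dec_nth plus_1_eq_Suc simp del: prod.op_ivl_Suc)
qed

lemma flat_dims [simp]:
  "dim_row (flat d n k Z) = nprod n 1 k" "dim_col (flat d n k Z) = nprod n (Suc k) d"
  by (simp_all add: flat_def)

lemma flat_enc:
  assumes "valid_idx d n is" "k \<le> d"
  shows "flat d n k Z $$ (colex_enc n 1 k is, colex_enc n (Suc k) d is) = Z is"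
  using valid_enc_less[OF assms] dec_enc[OF assms] by (simp add: flat_def)

lemma flat_eqI:
  assumes "k \<le> d" "dim_row M = nprod n 1 k" "dim_col M = nprod n (Suc k) d"
    and "\<And>is. valid_idx d n is \<Longrightarrow> M $$ (colex_enc n 1 k is, colex_enc n (Suc k) d is) = Z is"
  shows "flat d n k Z = M"
proof (rule eq_matI)
  fix a b assume "a < dim_row M" "b < dim_col M"
  then have ab: "a < nprod n 1 k" "b < nprod n (Suc k) d" using assms by auto
  show "flat d n k Z $$ (a, b) = M $$ (a, b)"
    using split_index[OF assms(1) ab] assms(4)[OF split_index(1)[OF assms(1) ab]] ab
    by (simp add: flat_def)
qed (use assms in auto)

lemma flat_unflat:
  assumes "k \<le> d" "dim_row M = nprod n 1 k" "dim_col M = nprod n (Suc k) d"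
  shows "flat d n k (unflat d n k M) = M"
  using assms by (intro flat_eqI) (auto simp: unflat_def)

lemma unflat_flat:
  assumes "k \<le> d" "Z \<in> tensors d n"
  shows "unflat d n k (flat d n k Z) = Z"
  using assms by (auto simp: unflat_def flat_enc tensors_def fun_eq_iff)

text \<open>Both sides are the same entry of the tensor: mode \<open>Suc k\<close> is the slowest
  row index of one flattening and the fastest column index of the other.\<close>

lemma flat_shift:
  assumes "k < d" "l < nprod n 1 k" "i < n (Suc k)" "b < nprod n (Suc (Suc k)) d"
  shows "flat d n (Suc k) Z $$ (i * nprod n 1 k + l, b) = flat d n k Z $$ (l, b * n (Suc k) + i)"
proof -
  have "i * nprod n 1 k + l < Suc i * nprod n 1 k" using assms by simp
  also have "\<dots> \<le> n (Suc k) * nprod n 1 k" using assms by (intro mult_right_mono) auto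
  finally have a: "i * nprod n 1 k + l < nprod n 1 (Suc k)" by (simp add: nprod_Suc)
  have "Suc k \<le> d" using assms by simp
  note sp = split_index[OF this a assms(4)]
  define js where "js = colex_dec n 1 (Suc k) (i * nprod n 1 k + l) @ colex_dec n (Suc (Suc k)) d b"
  note sp = sp[folded js_def]
  have less: "colex_enc n 1 k js < nprod n 1 k" using valid_enc_less sp(1) assms(1) by simp
  have "colex_enc n 1 k js + js ! k * nprod n 1 k = l + i * nprod n 1 k"
    using sp(2) by (simp add: colex_enc_simps)
  then have "(colex_enc n 1 k js + js ! k * nprod n 1 k) mod nprod n 1 k = (l + i * nprod n 1 k) mod nprod n 1 k"
    "(colex_enc n 1 k js + js ! k * nprod n 1 k) div nprod n 1 k = (l + i * nprod n 1 k) div nprod n 1 k"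
    by simp_all
  then have li: "colex_enc n 1 k js = l" "js ! k = i"
    using less assms(2) by simp_all
  have "colex_enc n (Suc k) d js = b * n (Suc k) + i"
    using colex_enc_lower[of "Suc k" d n js] assms(1) sp(3) li by simp
  then show ?thesis
    using flat_enc[OF sp(1), of "Suc k" Z] flat_enc[OF sp(1), of k Z] sp(2,3) li assms(1) by simp
qed

text \<open>The left factor is block diagonal with \<open>p\<close> copies of \<open>A\<close>, so
  row \<open>i\<close> meets only the block of \<open>B\<close> with number
  \<open>i div dim_row A\<close>.\<close>

lemma kron_id_mult_index:
  assumes "dim_row B = p * dim_col A" "i < p * dim_row A" "j < dim_col B"
  shows "(kron (1\<^sub>m p) A * B) $$ (i, j) =
    (\<Sum>l<dim_col A. A $$ (i mod dim_row A, l) * B $$ (i div dim_row A * dim_col A + l, j))"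
proof -
  let ?c = "dim_col A"
  have ip: "i div dim_row A < p" using assms(2) by (rule div_less_mult)
  have "(kron (1\<^sub>m p) A * B) $$ (i, j) = (\<Sum>l<p * ?c. kron (1\<^sub>m p) A $$ (i, l) * B $$ (l, j))"
    using assms by (subst mult_index_sum) auto
  also have "\<dots> = (\<Sum>l<p * ?c. (if i div dim_row A = l div ?c then 1 else 0)
      * A $$ (i mod dim_row A, l mod ?c) * B $$ (l div ?c * ?c + l mod ?c, j))"
    using assms ip by (intro sum.cong) (auto simp: kron_index div_less_mult)
  also have "\<dots> = (\<Sum>u<p. \<Sum>l<?c. (if i div dim_row A = u then 1 else 0)
      * A $$ (i mod dim_row A, l) * B $$ (u * ?c + l, j))"
    by (rule sum_div_mod)
  also have "\<dots> = (\<Sum>u<p. if i div dim_row A = u then \<Sum>l<?c.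
       A $$ (i mod dim_row A, l) * B $$ (u * ?c + l, j) else 0)"
    by (intro sum.cong) auto
  also have "\<dots> = (\<Sum>l<?c. A $$ (i mod dim_row A, l) * B $$ (i div dim_row A * ?c + l, j))"
    using ip by (simp add: sum.delta')
  finally show ?thesis .
qed

lemma mult_kron_id_index:
  assumes "dim_col B = dim_row A * p" "i < dim_row B" "j < dim_col A * p"
  shows "(B * kron A (1\<^sub>m p)) $$ (i, j) = (\<Sum>l<dim_row A. B $$ (i, l * p + j mod p) * A $$ (l, j div p))"
proof -
  let ?c = "dim_row A"
  have jp: "j mod p < p" using assms(3) by (rule mod_less_mult)
  have "(B * kron A (1\<^sub>m p)) $$ (i, j) = (\<Sum>l<?c * p. B $$ (i, l) * kron A (1\<^sub>m p) $$ (l, j))"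
    using assms by (subst mult_index_sum) auto
  also have "\<dots> = (\<Sum>l<?c * p. B $$ (i, l div p * p + l mod p) * A $$ (l div p, j div p)
       * (if l mod p = j mod p then 1 else 0))"
    using assms jp by (intro sum.cong) (auto simp: kron_index mod_less_mult)
  also have "\<dots> = (\<Sum>l<?c. \<Sum>u<p. B $$ (i, l * p + u) * A $$ (l, j div p)
       * (if u = j mod p then 1 else 0))"
    by (rule sum_div_mod)
  also have "\<dots> = (\<Sum>l<?c. B $$ (i, l * p + j mod p) * A $$ (l, j div p))"
    using jp by (intro sum.cong) (auto simp: if_distrib[of "\<lambda>x. _ * x"] cong: if_cong)
  finally show ?thesis .
qed

text \<open>A column of the flattening at \<open>k + 1\<close> is a stack of columns of the flattening at \<open>k\<close>, and dually for rows;
  so a matrix fixing the column space of one flattening fixes, after tensoring with the identity, that of the next.\<close>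

lemma flat_Suc_fixed:
  assumes "k < d" "dim_row P = nprod n 1 k" "dim_col P = nprod n 1 k" "P * flat d n k Y = flat d n k Y"
  shows "kron (1\<^sub>m (n (Suc k))) P * flat d n (Suc k) Y = flat d n (Suc k) Y"
proof (rule eq_matI)
  let ?N = "nprod n 1 k" let ?n = "n (Suc k)"
  have N: "nprod n 1 (Suc k) = ?n * ?N" by (simp add: nprod_Suc)
  have N': "nprod n (Suc k) d = nprod n (Suc (Suc k)) d * ?n" using assms(1) by (simp add: nprod_lower)
  fix i j assume "i < dim_row (flat d n (Suc k) Y)" "j < dim_col (flat d n (Suc k) Y)"
  then have ij: "i < ?n * ?N" "j < nprod n (Suc (Suc k)) d" using N by auto
  let ?i = "i div ?N" let ?l = "i mod ?N"
  have il: "?i < ?n" "?l < ?N" using ij(1) by (auto intro: div_less_mult mod_less_mult)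
  have "j * ?n + ?i < Suc j * ?n" using il by simp
  also have "\<dots> \<le> nprod n (Suc (Suc k)) d * ?n" using ij by (intro mult_right_mono) auto
  finally have b: "j * ?n + ?i < nprod n (Suc k) d" using N' by simp
  have "(kron (1\<^sub>m ?n) P * flat d n (Suc k) Y) $$ (i, j) =
      (\<Sum>l<?N. P $$ (?l, l) * flat d n (Suc k) Y $$ (?i * ?N + l, j))"
    using assms ij N by (subst kron_id_mult_index) auto
  also have "\<dots> = (\<Sum>l<?N. P $$ (?l, l) * flat d n k Y $$ (l, j * ?n + ?i))"
    using assms(1) il ij by (intro sum.cong) (simp_all add: flat_shift)
  also have "\<dots> = (P * flat d n k Y) $$ (?l, j * ?n + ?i)"
    using assms il b by (subst mult_index_sum) auto
  also have "\<dots> = flat d n (Suc k) Y $$ (?i * ?N + ?l, j)"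
    unfolding assms(4) using flat_shift[OF assms(1) il(2,1) ij(2), of Y] by simp
  finally show "(kron (1\<^sub>m ?n) P * flat d n (Suc k) Y) $$ (i, j) = flat d n (Suc k) Y $$ (i, j)"
    by simp
qed (use assms in \<open>auto simp: nprod_Suc\<close>)

lemma flat_pred_fixed:
  assumes "k < d" "dim_row P = nprod n (Suc (Suc k)) d" "dim_col P = nprod n (Suc (Suc k)) d"
    "flat d n (Suc k) Y * P = flat d n (Suc k) Y"
  shows "flat d n k Y * kron P (1\<^sub>m (n (Suc k))) = flat d n k Y"
proof (rule eq_matI)
  let ?N = "nprod n 1 k" let ?n = "n (Suc k)" let ?M = "nprod n (Suc (Suc k)) d"
  have N: "nprod n 1 (Suc k) = ?n * ?N" by (simp add: nprod_Suc)
  have N': "nprod n (Suc k) d = ?M * ?n" using assms(1) by (simp add: nprod_lower)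
  fix i j assume "i < dim_row (flat d n k Y)" "j < dim_col (flat d n k Y)"
  then have ij: "i < ?N" "j < ?M * ?n" using N' by auto
  let ?j = "j div ?n" let ?l = "j mod ?n"
  have jl: "?j < ?M" "?l < ?n" using ij(2) by (auto intro: div_less_mult mod_less_mult)
  have "?l * ?N + i < Suc ?l * ?N" using ij by simp
  also have "\<dots> \<le> ?n * ?N" using jl by (intro mult_right_mono) auto
  finally have b: "?l * ?N + i < nprod n 1 (Suc k)" using N by simp
  have "(flat d n k Y * kron P (1\<^sub>m ?n)) $$ (i, j) =
      (\<Sum>l<?M. flat d n k Y $$ (i, l * ?n + ?l) * P $$ (l, ?j))"
    using assms ij N' by (subst mult_kron_id_index) auto
  also have "\<dots> = (\<Sum>l<?M. flat d n (Suc k) Y $$ (?l * ?N + i, l) * P $$ (l, ?j))"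
    using assms(1) jl ij by (intro sum.cong) (simp_all add: flat_shift)
  also have "\<dots> = (flat d n (Suc k) Y * P) $$ (?l * ?N + i, ?j)"
    using assms jl b by (subst mult_index_sum) auto
  also have "\<dots> = flat d n k Y $$ (i, ?j * ?n + ?l)"
    unfolding assms(4) using assms(1) jl ij by (simp add: flat_shift)
  finally show "(flat d n k Y * kron P (1\<^sub>m ?n)) $$ (i, j) = flat d n k Y $$ (i, j)"
    by simp
qed (use assms in \<open>auto simp: nprod_lower\<close>)

section \<open>Interface matrices\<close>

lemma core_dims [simp]:
  "dim_row (coreL n r U k) = r (k - 1) * n k" "dim_col (coreL n r U k) = r k"
  "dim_row (coreR n r U k) = r (k - 1)" "dim_col (coreR n r U k) = n k * r k"
  by (simp_all add: coreL_def coreR_def)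

lemma coreL_index:
  assumes "i < n k" "a < r (k - 1)" "b < r k"
  shows "coreL n r U k $$ (i * r (k - 1) + a, b) = U k i $$ (a, b)"
proof -
  have "i * r (k - 1) + a < Suc i * r (k - 1)" using assms by simp
  also have "\<dots> \<le> n k * r (k - 1)" using assms by (intro mult_right_mono) auto
  finally show ?thesis using assms by (simp add: coreL_def mult.commute)
qed

lemma coreR_index:
  assumes "i < n k" "a < r (k - 1)" "b < r k"
  shows "coreR n r U k $$ (a, b * n k + i) = U k i $$ (a, b)"
proof -
  have "b * n k + i < Suc b * n k" using assms by simp
  also have "\<dots> \<le> r k * n k" using assms by (intro mult_right_mono) auto
  finally show ?thesis using assms by (simp add: coreR_def mult.commute)
qed

lemma Xle_dims:
  assumes "r 0 = 1"
  shows "dim_row (Xle n r U k) = nprod n 1 k" "dim_col (Xle n r U k) = r k"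
    "dim_row (Vle n r U dV k) = nprod n 1 k" "dim_col (Vle n r U dV k) = r k"
  using assms by (induction k) (auto simp: nprod_empty nprod_Suc)

lemma XgeT_dims:
  assumes "r d = 1" "m \<le> d"
  shows "dim_row (XgeT_aux d n r U m) = r (d - m)"
    "dim_col (XgeT_aux d n r U m) = nprod n (Suc (d - m)) d"
    "dim_row (VgeT_aux d n r U dV m) = r (d - m)"
    "dim_col (VgeT_aux d n r U dV m) = nprod n (Suc (d - m)) d"
proof -
  have "dim_row (XgeT_aux d n r U m) = r (d - m) \<and> dim_col (XgeT_aux d n r U m) = nprod n (Suc (d - m)) d
    \<and> dim_row (VgeT_aux d n r U dV m) = r (d - m) \<and> dim_col (VgeT_aux d n r U dV m) = nprod n (Suc (d - m)) d"
    using assms(2)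
  proof (induction m)
    case 0
    then show ?case using assms(1) by (simp add: nprod_empty)
  next
    case (Suc m)
    have "d - Suc m = d - m - 1" by simp
    moreover have "nprod n (d - m) d = nprod n (Suc (d - m)) d * n (d - m)"
      using Suc.prems by (intro nprod_lower) auto
    moreover have "Suc (d - Suc m) = d - m" using Suc.prems by simp
    ultimately show ?case using Suc by simp
  qed
  then show "dim_row (XgeT_aux d n r U m) = r (d - m)"
    "dim_col (XgeT_aux d n r U m) = nprod n (Suc (d - m)) d"
    "dim_row (VgeT_aux d n r U dV m) = r (d - m)"
    "dim_col (VgeT_aux d n r U dV m) = nprod n (Suc (d - m)) d" by auto
qed

lemma Xge_dims:
  assumes "r d = 1" "k \<le> d"
  shows "dim_row (Xge d n r U (Suc k)) = nprod n (Suc k) d" "dim_col (Xge d n r U (Suc k)) = r k"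
    "dim_row (Vge d n r U dV (Suc k)) = nprod n (Suc k) d" "dim_col (Vge d n r U dV (Suc k)) = r k"
  using XgeT_dims[where r = r and d = d, OF assms(1), of "d - k"] assms(2) by (simp_all add: Xge_def Vge_def)

lemma Xge_rec:
  assumes "1 \<le> k" "k \<le> d"
  shows "(Xge d n r U k)\<^sup>T = coreR n r U k * kron ((Xge d n r U (Suc k))\<^sup>T) (1\<^sub>m (n k))"
    "(Vge d n r U dV k)\<^sup>T = coreR n r U k * kron ((Vge d n r U dV (Suc k))\<^sup>T) (1\<^sub>m (n k))
      + coreR n r dV k * kron ((Xge d n r U (Suc k))\<^sup>T) (1\<^sub>m (n k))"
proof -
  have e: "Suc d - k = Suc (d - k)" "d - (d - k) = k" using assms by auto
  show "(Xge d n r U k)\<^sup>T = coreR n r U k * kron ((Xge d n r U (Suc k))\<^sup>T) (1\<^sub>m (n k))"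
    "(Vge d n r U dV k)\<^sup>T = coreR n r U k * kron ((Vge d n r U dV (Suc k))\<^sup>T) (1\<^sub>m (n k))
      + coreR n r dV k * kron ((Xge d n r U (Suc k))\<^sup>T) (1\<^sub>m (n k))"
    by (simp_all add: Xge_def Vge_def e)
qed

section \<open>Entries of the interface matrices at a fixed multi-index\<close>

context
  fixes d :: nat and n r :: "nat \<Rightarrow> nat" and U :: cores and "is" :: "nat list"
  assumes r0: "r 0 = 1" and rd: "r d = 1" and U: "cores_ok d n r U" and v: "valid_idx d n is"
begin

lemma slice_carrier:
  assumes "cores_ok d n r W" "1 \<le> k" "k \<le> d"
  shows "dim_row (W k (is ! (k - 1))) = r (k - 1)" "dim_col (W k (is ! (k - 1))) = r k"
    "is ! (k - 1) < n k"
proof -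
  have "k - 1 < d" "Suc (k - 1) = k" using assms by auto
  then show i: "is ! (k - 1) < n k" using v unfolding valid_idx_def by metis
  from assms have "W k (is ! (k - 1)) \<in> carrier_mat (r (k - 1)) (r k)"
    using i unfolding cores_ok_def by auto
  then show "dim_row (W k (is ! (k - 1))) = r (k - 1)" "dim_col (W k (is ! (k - 1))) = r k"
    by auto
qed

lemma core_prod_dims:
  assumes "1 \<le> lo" "lo + m \<le> Suc d"
  shows "dim_row (core_prod r U is lo m) = r (lo - 1)" "dim_col (core_prod r U is lo m) = r (lo + m - 1)"
  using assms by (induction m) (auto simp: slice_carrier[OF U])

text \<open>The first variation of \<open>core_prod\<close> over the window of cores that starts at
  \<open>lo\<close>: the sum of all products in which exactly one core is replaced by the slice of
  \<open>dV\<close>. The recursion is the product rule.\<close>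

fun tprod :: "cores \<Rightarrow> nat \<Rightarrow> nat \<Rightarrow> real mat" where
  "tprod dV lo 0 = 0\<^sub>m (r (lo - 1)) (r (lo - 1))"
| "tprod dV lo (Suc m) = tprod dV lo m * U (lo + m) (is ! (lo + m - 1))
     + core_prod r U is lo m * dV (lo + m) (is ! (lo + m - 1))"

lemma core_prod_add:
  assumes "1 \<le> lo" "lo + p + q \<le> Suc d"
  shows "core_prod r U is lo (p + q) = core_prod r U is lo p * core_prod r U is (lo + p) q"
  using assms(2)
proof (induction q)
  case 0
  then show ?case using assms(1) by (simp add: core_prod_dims mat_units)
next
  case (Suc q)
  then show ?case using assms(1)
    by (simp add: mat_assoc core_prod_dims slice_carrier[OF U] add.assoc)
qed

context
  fixes dV :: cores
  assumes dV: "cores_ok d n r dV"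
begin

lemma tprod_dims:
  assumes "1 \<le> lo" "lo + m \<le> Suc d"
  shows "dim_row (tprod dV lo m) = r (lo - 1)" "dim_col (tprod dV lo m) = r (lo + m - 1)"
  using assms by (induction m) (auto simp: slice_carrier[OF dV] core_prod_dims)

lemma tprod_add:
  assumes "1 \<le> lo" "lo + p + q \<le> Suc d"
  shows "tprod dV lo (p + q) = tprod dV lo p * core_prod r U is (lo + p) q
    + core_prod r U is lo p * tprod dV (lo + p) q"
  using assms(2)
proof (induction q)
  case 0
  then show ?case using assms(1) by (simp add: core_prod_dims tprod_dims mat_units)
next
  case (Suc q)
  have eq: "lo + (p + q) = lo + p + q" by simp
  show ?case using assms(1) Suc
    by (simp add: eq core_prod_add mat_assoc core_prod_dims tprod_dims slice_carrier[OF U]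
        slice_carrier[OF dV] mat_distribs mat_add_assoc)
qed

text \<open>Unfolds the recursion into the sum that defines \<open>tt_tangent\<close>, the case
  \<open>m = d\<close> and \<open>b = 0\<close>. The column \<open>b\<close> is general because
  appending a core mixes all columns of the partial products.\<close>

lemma tprod_index:
  assumes "m \<le> d" "b < r m"
  shows "tprod dV 1 m $$ (0, b) = (\<Sum>k=1..m. (core_prod r U is 1 (k - 1) * dV k (is ! (k - 1))
    * core_prod r U is (Suc k) (m - k)) $$ (0, b))"
  using assms
proof (induction m arbitrary: b)
  case 0
  then show ?case using r0 by simp
next
  case (Suc m)
  let ?s = "U (Suc m) (is ! m)" let ?t = "dV (Suc m) (is ! m)"
  let ?F = "\<lambda>k m. core_prod r U is 1 (k - 1) * dV k (is ! (k - 1)) * core_prod r U is (Suc k) (m - k)"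
  have sd: "dim_row ?s = r m" "dim_col ?s = r (Suc m)" "dim_row ?t = r m" "dim_col ?t = r (Suc m)"
    using slice_carrier[OF U, of "Suc m"] slice_carrier[OF dV, of "Suc m"] Suc.prems by auto
  have dF: "dim_row (?F k m) = 1" "dim_col (?F k m) = r m" if "k \<in> {1..m}" for k
    using that Suc.prems r0 by (auto simp: core_prod_dims)
  have F: "?F k (Suc m) $$ (0, b) = (\<Sum>l<r m. ?F k m $$ (0, l) * ?s $$ (l, b))" if k: "k \<in> {1..m}" for k
  proof -
    have "Suc m - k = Suc (m - k)" "Suc k + (m - k) = Suc m" using k by auto
    then have "?F k (Suc m) = ?F k m * ?s"
      using k Suc.prems sd by (simp add: mat_assoc core_prod_dims slice_carrier[OF dV])
    then show ?thesis using mult_index_sum[of 0 "?F k m" b ?s] dF[OF k] sd Suc.prems by simp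
  qed
  have "tprod dV 1 (Suc m) $$ (0, b) = (tprod dV 1 m * ?s) $$ (0, b) + (core_prod r U is 1 m * ?t) $$ (0, b)"
    using Suc.prems sd r0 by (simp add: core_prod_dims)
  also have "(tprod dV 1 m * ?s) $$ (0, b) = (\<Sum>l<r m. tprod dV 1 m $$ (0, l) * ?s $$ (l, b))"
    using Suc.prems sd r0 by (subst mult_index_sum) (auto simp: tprod_dims)
  also have "\<dots> = (\<Sum>l<r m. (\<Sum>k=1..m. ?F k m $$ (0, l)) * ?s $$ (l, b))"
    using Suc.IH Suc.prems by (intro sum.cong) auto
  also have "\<dots> = (\<Sum>k=1..m. \<Sum>l<r m. ?F k m $$ (0, l) * ?s $$ (l, b))"
    unfolding sum_distrib_right by (rule sum.swap)
  also have "\<dots> = (\<Sum>k=1..m. ?F k (Suc m) $$ (0, b))"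
    by (intro sum.cong) (simp_all only: F)
  also have "core_prod r U is 1 m * ?t = ?F (Suc m) (Suc m)"
    using Suc.prems sd by (simp add: mat_units)
  finally show ?case by simp
qed

end

text \<open>Each step of the recursion multiplies a row of the interface matrix by one more slice,
  and the digit of the new mode selects the block. Row 0 is the only row of \<open>core_prod\<close>
  here, because \<open>r 0 = 1\<close>.\<close>

lemma Xle_index:
  assumes "k \<le> d" "b < r k"
  shows "Xle n r U k $$ (colex_enc n 1 k is, b) = core_prod r U is 1 k $$ (0, b)"
  using assms
proof (induction k arbitrary: b)
  case 0
  then show ?case using r0 by (simp add: colex_enc_simps)
next
  case (Suc k)
  let ?i = "is ! k" let ?e = "colex_enc n 1 k is"
  have i: "?i < n (Suc k)" and sd: "dim_row (U (Suc k) ?i) = r k" "dim_col (U (Suc k) ?i) = r (Suc k)"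
    using slice_carrier[OF U, of "Suc k"] Suc.prems by auto
  have e: "?e < nprod n 1 k" using valid_enc_less[OF v, of k] Suc.prems by simp
  have enc: "colex_enc n 1 (Suc k) is = ?e + ?i * nprod n 1 k" by (simp add: colex_enc_simps)
  have less: "colex_enc n 1 (Suc k) is < n (Suc k) * nprod n 1 k"
    using valid_enc_less[OF v Suc.prems(1)] by (simp add: nprod_Suc)
  have "Xle n r U (Suc k) $$ (colex_enc n 1 (Suc k) is, b)
      = (\<Sum>l<r k. Xle n r U k $$ (?e, l) * coreL n r U (Suc k) $$ (?i * r k + l, b))"
    using Suc.prems less e unfolding Xle.simps
    by (subst kron_id_mult_index) (auto simp: Xle_dims r0 enc)
  also have "\<dots> = (\<Sum>l<r k. core_prod r U is 1 k $$ (0, l) * U (Suc k) ?i $$ (l, b))"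
    using Suc coreL_index[of ?i n "Suc k" _ r b U] i by (intro sum.cong) auto
  also have "\<dots> = core_prod r U is 1 (Suc k) $$ (0, b)"
    using Suc.prems sd r0 by (simp add: mult_index_sum core_prod_dims del: index_mult_mat(1))
  finally show ?case .
qed

lemma XgeT_index:
  assumes "m \<le> d" "a < r (d - m)"
  shows "XgeT_aux d n r U m $$ (a, colex_enc n (Suc (d - m)) d is) = core_prod r U is (Suc (d - m)) m $$ (a, 0)"
  using assms
proof (induction m arbitrary: a)
  case 0
  then show ?case using rd by (simp add: colex_enc_simps)
next
  case (Suc m)
  define k where "k = d - m"
  have k: "1 \<le> k" "k \<le> d" "Suc (d - Suc m) = k" "d - Suc m = k - 1" "Suc k + m = Suc d"
    using Suc.prems by (auto simp: k_def)
  let ?i = "is ! (k - 1)" let ?e = "colex_enc n (Suc k) d is"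
  note sd = slice_carrier[OF U k(1,2)]
  have e: "?e < nprod n (Suc k) d" using valid_enc_less(2)[OF v order_refl, of "Suc k"] by simp
  have enc: "colex_enc n k d is = ?e * n k + ?i" using k by (simp add: colex_enc_lower)
  have less: "colex_enc n k d is < nprod n (Suc k) d * n k"
    using valid_enc_less(2)[OF v order_refl, of k] k by (simp add: nprod_lower)
  have a: "a < r (k - 1)" using Suc.prems k by simp
  have "XgeT_aux d n r U (Suc m) $$ (a, colex_enc n k d is)
      = (\<Sum>l<r k. coreR n r U k $$ (a, l * n k + ?i) * XgeT_aux d n r U m $$ (l, ?e))"
    using Suc.prems less e sd a XgeT_dims[where r = r and d = d, OF rd, of m n U] unfolding XgeT_aux.simps k_def[symmetric]
    by (subst mult_kron_id_index) (auto simp: enc)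
  also have "\<dots> = (\<Sum>l<r k. U k ?i $$ (a, l) * core_prod r U is (Suc k) m $$ (l, 0))"
    using Suc.IH[folded k_def] Suc.prems coreR_index[of ?i n k a r _ U] sd a by (intro sum.cong) auto
  also have "\<dots> = (U k ?i * core_prod r U is (Suc k) m) $$ (a, 0)"
    using a sd k rd by (simp add: mult_index_sum core_prod_dims del: index_mult_mat(1))
  \<comment> \<open>The right interface matrices gain their new core in front, whereas
    \<open>core_prod\<close> grows at its end; \<open>core_prod_add\<close> splits off the first
    core.\<close>
  also have "U k ?i * core_prod r U is (Suc k) m = core_prod r U is k (Suc m)"
    using core_prod_add[of k 1 m] k sd by (simp add: mat_units One_nat_def)
  finally show ?case using k by simp
qed

context
  fixes dV :: cores
  assumes dV: "cores_ok d n r dV"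
begin

lemma Vle_index:
  assumes "k \<le> d" "b < r k"
  shows "Vle n r U dV k $$ (colex_enc n 1 k is, b) = tprod dV 1 k $$ (0, b)"
  using assms
proof (induction k arbitrary: b)
  case 0
  then show ?case using r0 by (simp add: colex_enc_simps)
next
  case (Suc k)
  let ?i = "is ! k" let ?e = "colex_enc n 1 k is"
  have i: "?i < n (Suc k)" and sd: "dim_row (U (Suc k) ?i) = r k" "dim_col (U (Suc k) ?i) = r (Suc k)"
    "dim_row (dV (Suc k) ?i) = r k" "dim_col (dV (Suc k) ?i) = r (Suc k)"
    using slice_carrier[OF U, of "Suc k"] slice_carrier[OF dV, of "Suc k"] Suc.prems by auto
  have e: "?e < nprod n 1 k" using valid_enc_less[OF v, of k] Suc.prems by simp
  have enc: "colex_enc n 1 (Suc k) is = ?e + ?i * nprod n 1 k" by (simp add: colex_enc_simps)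
  have less: "colex_enc n 1 (Suc k) is < n (Suc k) * nprod n 1 k"
    using valid_enc_less[OF v Suc.prems(1)] by (simp add: nprod_Suc)
  have "Vle n r U dV (Suc k) $$ (colex_enc n 1 (Suc k) is, b)
      = (kron (1\<^sub>m (n (Suc k))) (Vle n r U dV k) * coreL n r U (Suc k)) $$ (colex_enc n 1 (Suc k) is, b)
      + (kron (1\<^sub>m (n (Suc k))) (Xle n r U k) * coreL n r dV (Suc k)) $$ (colex_enc n 1 (Suc k) is, b)"
    using Suc.prems less by (simp add: Xle_dims r0 del: index_mult_mat(1))
  also have "\<dots> = (\<Sum>l<r k. Vle n r U dV k $$ (?e, l) * coreL n r U (Suc k) $$ (?i * r k + l, b))
      + (\<Sum>l<r k. Xle n r U k $$ (?e, l) * coreL n r dV (Suc k) $$ (?i * r k + l, b))"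
    using Suc.prems less e
    by (subst (1 2) kron_id_mult_index) (auto simp: Xle_dims r0 enc)
  also have "\<dots> = (\<Sum>l<r k. tprod dV 1 k $$ (0, l) * U (Suc k) ?i $$ (l, b))
      + (\<Sum>l<r k. core_prod r U is 1 k $$ (0, l) * dV (Suc k) ?i $$ (l, b))"
    using Suc coreL_index[of ?i n "Suc k" _ r b U] coreL_index[of ?i n "Suc k" _ r b dV] i
    by (intro arg_cong2[of _ _ _ _ "(+)"] sum.cong) (auto simp: Xle_index)
  also have "\<dots> = tprod dV 1 (Suc k) $$ (0, b)"
    using Suc.prems sd r0 tprod_dims[OF dV]
    by (simp add: mult_index_sum core_prod_dims del: index_mult_mat(1))
  finally show ?case .
qed

lemma VgeT_index:
  assumes "m \<le> d" "a < r (d - m)"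
  shows "VgeT_aux d n r U dV m $$ (a, colex_enc n (Suc (d - m)) d is) = tprod dV (Suc (d - m)) m $$ (a, 0)"
  using assms
proof (induction m arbitrary: a)
  case 0
  then show ?case using rd by (simp add: colex_enc_simps)
next
  case (Suc m)
  define k where "k = d - m"
  have k: "1 \<le> k" "k \<le> d" "Suc (d - Suc m) = k" "d - Suc m = k - 1" "Suc k + m = Suc d" "m \<le> d"
    using Suc.prems by (auto simp: k_def)
  let ?i = "is ! (k - 1)" let ?e = "colex_enc n (Suc k) d is" let ?f = "colex_enc n k d is"
  note sd = slice_carrier[OF U k(1,2)] slice_carrier[OF dV k(1,2)]
  have e: "?e < nprod n (Suc k) d" using valid_enc_less(2)[OF v order_refl, of "Suc k"] by simp
  have enc: "?f = ?e * n k + ?i" using k by (simp add: colex_enc_lower)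
  have less: "?f < nprod n (Suc k) d * n k"
    using valid_enc_less(2)[OF v order_refl, of k] k by (simp add: nprod_lower)
  have a: "a < r (k - 1)" using Suc.prems k by simp
  note Xd = XgeT_dims[where r = r and d = d, OF rd k(6), of n U, folded k_def] XgeT_dims(3,4)[where r = r and d = d, OF rd k(6), of n U dV, folded k_def]
  have "VgeT_aux d n r U dV (Suc m) $$ (a, ?f)
      = (coreR n r U k * kron (VgeT_aux d n r U dV m) (1\<^sub>m (n k))) $$ (a, ?f)
      + (coreR n r dV k * kron (XgeT_aux d n r U m) (1\<^sub>m (n k))) $$ (a, ?f)"
    using less a Xd unfolding VgeT_aux.simps k_def[symmetric]
    by (simp del: index_mult_mat(1))
  also have "\<dots> = (\<Sum>l<r k. coreR n r U k $$ (a, l * n k + ?i) * VgeT_aux d n r U dV m $$ (l, ?e))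
      + (\<Sum>l<r k. coreR n r dV k $$ (a, l * n k + ?i) * XgeT_aux d n r U m $$ (l, ?e))"
    using less e sd a Xd by (subst (1 2) mult_kron_id_index) (auto simp: enc)
  also have "\<dots> = (\<Sum>l<r k. U k ?i $$ (a, l) * tprod dV (Suc k) m $$ (l, 0))
      + (\<Sum>l<r k. dV k ?i $$ (a, l) * core_prod r U is (Suc k) m $$ (l, 0))"
    using Suc.IH[folded k_def] k coreR_index[of ?i n k a r _ U] coreR_index[of ?i n k a r _ dV] sd a
      XgeT_index[OF k(6), folded k_def]
    by (intro arg_cong2[of _ _ _ _ "(+)"] sum.cong) auto
  also have "\<dots> = (U k ?i * tprod dV (Suc k) m + dV k ?i * core_prod r U is (Suc k) m) $$ (a, 0)"
    using a sd k rd tprod_dims[OF dV]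
    by (simp add: mult_index_sum core_prod_dims del: index_mult_mat(1))
  also have "U k ?i * tprod dV (Suc k) m + dV k ?i * core_prod r U is (Suc k) m = tprod dV k (Suc m)"
  proof -
    have "core_prod r U is k 1 = U k ?i" "tprod dV k 1 = dV k ?i"
      using k sd by (simp_all add: One_nat_def mat_units)
    \<comment> \<open>Splitting off the first core gives the two terms of the recursion of
      \<open>VgeT_aux\<close>, in the opposite order.\<close>
    moreover have "tprod dV k (1 + m) = tprod dV k 1 * core_prod r U is (k + 1) m
       + core_prod r U is k 1 * tprod dV (k + 1) m"
      using k by (intro tprod_add dV) auto
    ultimately have "tprod dV k (Suc m) = dV k ?i * core_prod r U is (Suc k) m + U k ?i * tprod dV (Suc k) m"
      by (simp only: plus_1_eq_Suc Suc_eq_plus1[symmetric])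
    also have "\<dots> = U k ?i * tprod dV (Suc k) m + dV k ?i * core_prod r U is (Suc k) m"
      using sd k tprod_dims[OF dV, of "Suc k" m]
      by (intro comm_add_mat[of _ "r (k - 1)" "r d"] carrier_matI) (auto simp: core_prod_dims)
    finally show ?thesis by (rule sym)
  qed
  finally show ?case using k by simp
qed

end

end

text \<open>Cuts the product of cores after position \<open>k\<close>. At the ends
  \<open>k = 0\<close> and \<open>k = d\<close> one factor is 1 and the other is the whole tensor;
  this is how a tensor is later recognized from its interface matrices.\<close>

lemma flat_TT:
  assumes r0: "r 0 = 1" and rd: "r d = 1" and X: "is_TT d n r U X" and k: "k \<le> d"
  shows "flat d n k X = Xle n r U k * (Xge d n r U (Suc k))\<^sup>T"
proof (rule flat_eqI[OF k])
  have U: "cores_ok d n r U" and Xe: "X = tt_eval d n r U" using X by (auto simp: is_TT_def)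
  note dims = Xle_dims[where r = r, OF r0] Xge_dims[where r = r, OF rd k]
  show "dim_row (Xle n r U k * (Xge d n r U (Suc k))\<^sup>T) = nprod n 1 k"
    "dim_col (Xle n r U k * (Xge d n r U (Suc k))\<^sup>T) = nprod n (Suc k) d"
    by (simp_all add: dims)
  fix "is" assume v: "valid_idx d n is"
  note loc = r0 rd U v
  let ?a = "colex_enc n 1 k is" let ?b = "colex_enc n (Suc k) d is"
  have less: "?a < nprod n 1 k" "?b < nprod n (Suc k) d"
    using valid_enc_less[OF v k] by auto
  have ge: "(Xge d n r U (Suc k))\<^sup>T $$ (l, ?b) = core_prod r U is (Suc k) (d - k) $$ (l, 0)" if "l < r k" for l
    using XgeT_index[OF loc, of "d - k" l] that k by (simp add: Xge_def)
  have "(Xle n r U k * (Xge d n r U (Suc k))\<^sup>T) $$ (?a, ?b)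
      = (\<Sum>l<r k. Xle n r U k $$ (?a, l) * (Xge d n r U (Suc k))\<^sup>T $$ (l, ?b))"
    using less by (subst mult_index_sum) (auto simp: dims)
  also have "\<dots> = (\<Sum>l<r k. core_prod r U is 1 k $$ (0, l) * core_prod r U is (Suc k) (d - k) $$ (l, 0))"
    using ge Xle_index[OF loc k] by (intro sum.cong) auto
  also have "\<dots> = (core_prod r U is 1 k * core_prod r U is (Suc k) (d - k)) $$ (0, 0)"
    using k r0 rd by (simp add: mult_index_sum core_prod_dims[OF loc] del: index_mult_mat(1))
  also have "\<dots> = core_prod r U is 1 d $$ (0, 0)"
    using core_prod_add[OF loc, of 1 k "d - k"] k by simp
  finally show "(Xle n r U k * (Xge d n r U (Suc k))\<^sup>T) $$ (?a, ?b) = X is"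
    using v by (simp add: Xe tt_eval_def)
qed

text \<open>The varied core lies to the left or to the right of the cut, which gives the two
  terms.\<close>

lemma flat_tangent:
  assumes r0: "r 0 = 1" and rd: "r d = 1" and U: "cores_ok d n r U" and dV: "cores_ok d n r dV" and k: "k \<le> d"
  shows "flat d n k (tt_tangent d n r U dV) = Vle n r U dV k * (Xge d n r U (Suc k))\<^sup>T
    + Xle n r U k * (Vge d n r U dV (Suc k))\<^sup>T"
proof (rule flat_eqI[OF k])
  let ?M = "Vle n r U dV k * (Xge d n r U (Suc k))\<^sup>T + Xle n r U k * (Vge d n r U dV (Suc k))\<^sup>T"
  note dims = Xle_dims[where r = r, OF r0] Xge_dims[where r = r, OF rd k]
  show "dim_row ?M = nprod n 1 k" "dim_col ?M = nprod n (Suc k) d"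
    by (simp_all add: dims)
  fix "is" assume v: "valid_idx d n is"
  note loc = r0 rd U v
  let ?T = "tprod r U is dV"
  note td = tprod_dims[OF loc dV]
  let ?a = "colex_enc n 1 k is" let ?b = "colex_enc n (Suc k) d is"
  have less: "?a < nprod n 1 k" "?b < nprod n (Suc k) d"
    using valid_enc_less[OF v k] by auto
  have geX: "(Xge d n r U (Suc k))\<^sup>T $$ (l, ?b) = core_prod r U is (Suc k) (d - k) $$ (l, 0)" if "l < r k" for l
    using XgeT_index[OF loc, of "d - k" l] that k by (simp add: Xge_def)
  have geV: "(Vge d n r U dV (Suc k))\<^sup>T $$ (l, ?b) = ?T (Suc k) (d - k) $$ (l, 0)" if "l < r k" for l
    using VgeT_index[OF loc dV, of "d - k" l] that k by (simp add: Vge_def)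
  have "?M $$ (?a, ?b) = (\<Sum>l<r k. Vle n r U dV k $$ (?a, l) * (Xge d n r U (Suc k))\<^sup>T $$ (l, ?b))
      + (\<Sum>l<r k. Xle n r U k $$ (?a, l) * (Vge d n r U dV (Suc k))\<^sup>T $$ (l, ?b))"
    using less by (simp add: mult_index_sum dims del: index_mult_mat(1))
  also have "\<dots> = (\<Sum>l<r k. ?T 1 k $$ (0, l) * core_prod r U is (Suc k) (d - k) $$ (l, 0))
      + (\<Sum>l<r k. core_prod r U is 1 k $$ (0, l) * ?T (Suc k) (d - k) $$ (l, 0))"
    using geX geV Xle_index[OF loc k] Vle_index[OF loc dV k]
    by (intro arg_cong2[of _ _ _ _ "(+)"] sum.cong) auto
  also have "\<dots> = (?T 1 k * core_prod r U is (Suc k) (d - k) + core_prod r U is 1 k * ?T (Suc k) (d - k)) $$ (0, 0)"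
    using k r0 rd by (simp add: mult_index_sum core_prod_dims[OF loc] td del: index_mult_mat(1))
  also have "\<dots> = ?T 1 d $$ (0, 0)"
    using tprod_add[OF loc dV, of 1 k "d - k"] k by simp
  also have "\<dots> = tt_tangent d n r U dV is"
    using tprod_index[OF loc dV, of d 0] rd v by (simp add: tt_tangent_def)
  finally show "?M $$ (?a, ?b) = tt_tangent d n r U dV is" .
qed

section \<open>Orthogonal decompositions\<close>

lemma Xle_orthonormal:
  assumes r0: "r 0 = 1" and lo: "left_orth d n r U" and k: "k < d"
  shows "(Xle n r U k)\<^sup>T * Xle n r U k = 1\<^sub>m (r k)"
  using k
proof (induction k)
  case 0
  then show ?case using r0 by simp
next
  case (Suc k)
  let ?X = "Xle n r U k" let ?L = "coreL n r U (Suc k)" let ?I = "1\<^sub>m (n (Suc k)) :: real mat"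
  note d [simp] = Xle_dims[where r = r, OF r0]
  have L: "?L\<^sup>T * ?L = 1\<^sub>m (r (Suc k))" using lo Suc.prems by (auto simp: left_orth_def)
  have X: "?X\<^sup>T * ?X = 1\<^sub>m (r k)" using Suc by simp
  have K: "kron ?I (?X\<^sup>T) * kron ?I ?X = 1\<^sub>m (n (Suc k) * r k)"
    by (simp only: kron_mult_id d index_transpose_mat X kron_one)
  have "(Xle n r U (Suc k))\<^sup>T * Xle n r U (Suc k) = ?L\<^sup>T * (kron ?I (?X\<^sup>T) * (kron ?I ?X * ?L))"
    by (simp add: mat_trans_mult kron_trans mat_assoc mult.commute)
  also have "kron ?I (?X\<^sup>T) * (kron ?I ?X * ?L) = ?L"
    by (rule mat_cancel[OF K]) (simp_all add: mult.commute)
  finally show ?case using L by simp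
qed

lemma Xge_orthonormal:
  assumes rd: "r d = 1" and ro: "right_orth d n r U" and k: "1 \<le> k" "k \<le> d"
  shows "(Xge d n r U (Suc k))\<^sup>T * Xge d n r U (Suc k) = 1\<^sub>m (r k)"
  using k(2,1)
proof (induction k rule: inc_induct)
  case base
  then show ?case using rd by (simp add: Xge_def)
next
  case (step k)
  let ?X = "Xge d n r U (Suc (Suc k))" let ?R = "coreR n r U (Suc k)" let ?I = "1\<^sub>m (n (Suc k)) :: real mat"
  have d: "dim_row ?X = nprod n (Suc (Suc k)) d" "dim_col ?X = r (Suc k)"
    using Xge_dims[where r = r and d = d, OF rd, of "Suc k"] step.hyps by auto
  have R: "?R * ?R\<^sup>T = 1\<^sub>m (r k)" using ro step by (auto simp: right_orth_def)
  have X: "?X\<^sup>T * ?X = 1\<^sub>m (r (Suc k))" using step by simp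
  have K: "kron (?X\<^sup>T) ?I * kron ?X ?I = 1\<^sub>m (r (Suc k) * n (Suc k))"
    by (simp only: kron_mult_id d index_transpose_mat X kron_one)
  have rec: "(Xge d n r U (Suc k))\<^sup>T = ?R * kron (?X\<^sup>T) ?I"
    using step by (intro Xge_rec) auto
  have "Xge d n r U (Suc k) = ((Xge d n r U (Suc k))\<^sup>T)\<^sup>T" by simp
  also have "\<dots> = kron ?X ?I * ?R\<^sup>T" unfolding rec by (simp add: mat_trans_mult kron_trans d mult.commute)
  finally have "(Xge d n r U (Suc k))\<^sup>T * Xge d n r U (Suc k) = ?R * (kron (?X\<^sup>T) ?I * (kron ?X ?I * ?R\<^sup>T))"
    unfolding rec by (simp add: mat_assoc d mult.commute)
  also have "kron (?X\<^sup>T) ?I * (kron ?X ?I * ?R\<^sup>T) = ?R\<^sup>T"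
    by (rule mat_cancel[OF K]) (simp_all add: d mult.commute)
  finally show ?case using R by simp
qed

text \<open>TT-SVD: orthonormal bases \<open>S k\<close> of the column spaces of all flattenings are nested, and the left cores
  are the coordinates of each basis in terms of the previous one.\<close>

lemma left_orth_exists:
  assumes r0: "r 0 = 1" and rd: "r d = 1" and Y: "Y \<in> Mr d n r" and d: "d \<ge> 1"
  shows "\<exists>U. minimal_TT d n r U Y \<and> left_orth d n r U"
proof -
  have rank: "mrank (flat d n k Y) = r k" if "k \<in> {1..<d}" for k
    using Y that by (auto simp: Mr_def tt_rank_def)
  have YT: "Y \<in> tensors d n" using Y by (auto simp: Mr_def)
  \<comment> \<open>The boundary values extend the family to all cuts: the empty product at 0, and
    at \<open>d\<close> the vectorized tensor itself, a single unnormalized column that carries the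
    norm of \<open>Y\<close>.\<close>
  define S where "S k = (if k = 0 then 1\<^sub>m 1 else if k < d then SOME S. orth_basis (flat d n k Y) S
    else flat d n k Y)" for k
  have S_basis: "orth_basis (flat d n k Y) (S k)" if "k \<in> {1..<d}" for k
    using someI_ex[OF orth_basis_exists[of "flat d n k Y"]] that by (simp add: S_def)
  have S_dims: "dim_row (S k) = nprod n 1 k" "dim_col (S k) = r k" if "k \<le> d" for k
  proof -
    consider "k = 0" | "k \<in> {1..<d}" | "k = d" "k \<noteq> 0" using \<open>k \<le> d\<close> by fastforce
    then have "dim_row (S k) = nprod n 1 k \<and> dim_col (S k) = r k"
    proof cases
      case 2
      then show ?thesis using orth_basis_rank[OF S_basis[OF 2]] rank[OF 2] S_basis[OF 2]
        by (auto simp: orth_basis_def)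
    qed (auto simp: S_def r0 rd nprod_empty)
    then show "dim_row (S k) = nprod n 1 k" "dim_col (S k) = r k" by auto
  qed
  have S_fix: "S k * (S k)\<^sup>T * flat d n k Y = flat d n k Y" if "k < d" for k
  proof (cases "k = 0")
    case True
    then show ?thesis by (simp add: S_def mat_units nprod_empty)
  next
    case False
    then show ?thesis using S_basis[of k] that by (auto simp: orth_basis_def)
  qed
  have S_im: "\<exists>W. dim_row W = dim_col (flat d n k Y) \<and> S k = flat d n k Y * W" if k: "1 \<le> k" "k \<le> d" for k
  proof (cases "k < d")
    case True
    then show ?thesis using S_basis[of k] k unfolding orth_basis_def by (metis atLeastLessThan_iff carrier_matD(1))
  next
    case False
    then show ?thesis using k by (intro exI[of _ "1\<^sub>m (dim_col (flat d n k Y))"]) (simp add: S_def mat_units)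
  qed
  \<comment> \<open>The columns of \<open>S (Suc k)\<close> are combinations of columns of the
    flattening at \<open>Suc k\<close>, and by \<open>flat_Suc_fixed\<close> the projector leaves
    those in place.\<close>
  have nested: "kron (1\<^sub>m (n (Suc k))) (S k * (S k)\<^sup>T) * S (Suc k) = S (Suc k)" if k: "k < d" for k
  proof -
    obtain W where W: "dim_row W = dim_col (flat d n (Suc k) Y)" "S (Suc k) = flat d n (Suc k) Y * W"
      using S_im[of "Suc k"] k by auto
    have fixed: "kron (1\<^sub>m (n (Suc k))) (S k * (S k)\<^sup>T) * flat d n (Suc k) Y = flat d n (Suc k) Y"
      using k S_dims[of k] S_fix[OF k] by (intro flat_Suc_fixed) auto
    have "kron (1\<^sub>m (n (Suc k))) (S k * (S k)\<^sup>T) * S (Suc k)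
        = (kron (1\<^sub>m (n (Suc k))) (S k * (S k)\<^sup>T) * flat d n (Suc k) Y) * W"
      unfolding W(2) using k S_dims[of k] W(1) by (intro mat_assoc[symmetric]) (auto simp: nprod_Suc)
    then show ?thesis unfolding fixed W(2)[symmetric] .
  qed
  define M where "M k = kron (1\<^sub>m (n k)) ((S (k - 1))\<^sup>T) * S k" for k
  have M_dims: "dim_row (M (Suc k)) = r k * n (Suc k)" "dim_col (M (Suc k)) = r (Suc k)" if "k < d" for k
    using that S_dims[of k] S_dims[of "Suc k"] by (auto simp: M_def mult.commute)
  define U where "U k i = mat (r (k - 1)) (r k) (\<lambda>(a, b). M k $$ (i * r (k - 1) + a, b))" for k i
  have U_M: "coreL n r U (Suc k) = M (Suc k)" if "k < d" for k
  proof (rule eq_matI)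
    fix a b assume "a < dim_row (M (Suc k))" "b < dim_col (M (Suc k))"
    then have ab: "a < n (Suc k) * r k" "b < r (Suc k)" using M_dims[OF that] by (auto simp: mult.commute)
    then have "a mod r k < r k" by (intro mod_less_mult)
    then show "coreL n r U (Suc k) $$ (a, b) = M (Suc k) $$ (a, b)"
      using ab by (simp add: coreL_def U_def mult.commute)
  qed (use M_dims[OF that] in auto)
  have Xle_S: "Xle n r U k = S k" if "k \<le> d" for k
    using that
  proof (induction k)
    case 0
    then show ?case by (simp add: S_def)
  next
    case (Suc k)
    then have k: "k < d" by simp
    have "Xle n r U (Suc k) = kron (1\<^sub>m (n (Suc k))) (S k) * (kron (1\<^sub>m (n (Suc k))) ((S k)\<^sup>T) * S (Suc k))"
      using Suc U_M[OF k] by (simp add: M_def)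
    also have "\<dots> = kron (1\<^sub>m (n (Suc k))) (S k) * kron (1\<^sub>m (n (Suc k))) ((S k)\<^sup>T) * S (Suc k)"
      using k S_dims[of k] S_dims[of "Suc k"] by (intro mat_assoc[symmetric]) (auto simp: nprod_Suc)
    also have "\<dots> = S (Suc k)" using nested[OF k] by (simp add: kron_mult_id)
    finally show ?case .
  qed
  have lo: "left_orth d n r U"
    unfolding left_orth_def
  proof
    fix k' assume "k' \<in> {1..<d}"
    then obtain k where k: "k' = Suc k" "Suc k < d" "k < d" by (cases k') auto
    let ?K = "kron (1\<^sub>m (n (Suc k)))"
    have "(M (Suc k))\<^sup>T * M (Suc k) = (S (Suc k))\<^sup>T * (?K (S k) * ?K ((S k)\<^sup>T) * S (Suc k))"
      using k S_dims[of k] S_dims[of "Suc k"]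
      by (simp add: M_def mat_trans_mult kron_trans mat_assoc nprod_Suc)
    also have "?K (S k) * ?K ((S k)\<^sup>T) * S (Suc k) = S (Suc k)"
      using nested[OF k(3)] by (simp add: kron_mult_id)
    also have "(S (Suc k))\<^sup>T * S (Suc k) = 1\<^sub>m (r (Suc k))"
      using S_basis[of "Suc k"] S_dims[of "Suc k"] k by (simp add: orth_basis_def)
    finally show "(coreL n r U k')\<^sup>T * coreL n r U k' = 1\<^sub>m (r k')"
      unfolding k(1) U_M[OF k(3)] .
  qed
  have "cores_ok d n r U" by (auto simp: cores_ok_def U_def)
  then have TT: "is_TT d n r U (tt_eval d n r U)" by (simp add: is_TT_def)
  have XT: "tt_eval d n r U \<in> tensors d n" by (auto simp: tensors_def tt_eval_def)
  \<comment> \<open>At the cut \<open>d\<close> the right interface matrix is 1, so the flattening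
    is the left one, which is \<open>S d\<close>; a tensor is determined by one flattening.\<close>
  have "flat d n d (tt_eval d n r U) = flat d n d Y"
    using flat_TT[OF r0 rd TT order_refl] Xle_S[of d] d by (simp add: Xge_def S_def mat_units nprod_empty)
  then have "tt_eval d n r U = Y"
    using unflat_flat[OF order_refl XT] unflat_flat[OF order_refl YT] by metis
  then have "minimal_TT d n r U Y"
    using TT rank unfolding minimal_TT_def tt_rank_def by metis
  with lo show ?thesis by blast
qed

text \<open>The same construction for row spaces, running from \<open>d\<close> down to 0. By
  \<open>mrank_transpose\<close> the bases of the row spaces have the right number of columns; the
  unnormalized vector now sits at 0.\<close>

lemma right_orth_exists:
  assumes r0: "r 0 = 1" and rd: "r d = 1" and Y: "Y \<in> Mr d n r" and d: "d \<ge> 1"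
  shows "\<exists>U. minimal_TT d n r U Y \<and> right_orth d n r U"
proof -
  have rank: "mrank (flat d n k Y) = r k" if "k \<in> {1..<d}" for k
    using Y that by (auto simp: Mr_def tt_rank_def)
  have YT: "Y \<in> tensors d n" using Y by (auto simp: Mr_def)
  define S where "S k = (if k = d then 1\<^sub>m 1 else if 0 < k then SOME S. orth_basis ((flat d n k Y)\<^sup>T) S
    else (flat d n k Y)\<^sup>T)" for k
  have S_basis: "orth_basis ((flat d n k Y)\<^sup>T) (S k)" if "k \<in> {1..<d}" for k
    using someI_ex[OF orth_basis_exists[of "(flat d n k Y)\<^sup>T"]] that by (simp add: S_def)
  have S_dims: "dim_row (S k) = nprod n (Suc k) d" "dim_col (S k) = r k" if "k \<le> d" for k
  proof -
    consider "k = d" | "k \<in> {1..<d}" | "k = 0" "k \<noteq> d" using \<open>k \<le> d\<close> by fastforce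
    then have "dim_row (S k) = nprod n (Suc k) d \<and> dim_col (S k) = r k"
    proof cases
      case 2
      then show ?thesis using orth_basis_rank[OF S_basis[OF 2]] rank[OF 2] S_basis[OF 2]
        by (auto simp: orth_basis_def mrank_transpose)
    qed (auto simp: S_def r0 rd nprod_empty)
    then show "dim_row (S k) = nprod n (Suc k) d" "dim_col (S k) = r k" by auto
  qed
  have S_fix: "flat d n k Y * (S k * (S k)\<^sup>T) = flat d n k Y" if "1 \<le> k" "k \<le> d" for k
  proof (cases "k = d")
    case True
    then show ?thesis by (simp add: S_def mat_units nprod_empty)
  next
    case False
    then have "S k * (S k)\<^sup>T * (flat d n k Y)\<^sup>T = (flat d n k Y)\<^sup>T"
      using S_basis[of k] that by (auto simp: orth_basis_def)
    from arg_cong[OF this, of transpose_mat] show ?thesis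
      using S_dims[of k] that by (simp add: mat_trans_mult)
  qed
  have S_im: "\<exists>W. dim_row W = nprod n 1 k \<and> S k = (flat d n k Y)\<^sup>T * W" if k: "k < d" for k
  proof (cases "0 < k")
    case True
    then show ?thesis using S_basis[of k] k unfolding orth_basis_def by (auto dest: carrier_matD)
  next
    case False
    then show ?thesis using k by (intro exI[of _ "1\<^sub>m (nprod n 1 k)"]) (simp add: S_def mat_units)
  qed
  have nested: "(S k)\<^sup>T * kron (S (Suc k) * (S (Suc k))\<^sup>T) (1\<^sub>m (n (Suc k))) = (S k)\<^sup>T" if k: "k < d" for k
  proof -
    obtain W where W: "dim_row W = nprod n 1 k" "S k = (flat d n k Y)\<^sup>T * W"
      using S_im[OF k] by auto
    have ST: "(S k)\<^sup>T = W\<^sup>T * flat d n k Y" unfolding W(2) using W(1) by (simp add: mat_trans_mult)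
    have fixed: "flat d n k Y * kron (S (Suc k) * (S (Suc k))\<^sup>T) (1\<^sub>m (n (Suc k))) = flat d n k Y"
      using k S_dims[of "Suc k"] S_fix[of "Suc k"] by (intro flat_pred_fixed) auto
    have "(S k)\<^sup>T * kron (S (Suc k) * (S (Suc k))\<^sup>T) (1\<^sub>m (n (Suc k)))
        = W\<^sup>T * (flat d n k Y * kron (S (Suc k) * (S (Suc k))\<^sup>T) (1\<^sub>m (n (Suc k))))"
      unfolding ST using k S_dims[of "Suc k"] W(1) by (intro mat_assoc) (auto simp: nprod_lower)
    then show ?thesis unfolding fixed ST .
  qed
  define M where "M k = (S (k - 1))\<^sup>T * kron (S k) (1\<^sub>m (n k))" for k
  have M_dims: "dim_row (M (Suc k)) = r k" "dim_col (M (Suc k)) = n (Suc k) * r (Suc k)" if "k < d" for k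
    using that S_dims[of k] S_dims[of "Suc k"] by (auto simp: M_def)
  define U where "U k i = mat (r (k - 1)) (r k) (\<lambda>(a, b). M k $$ (a, b * n k + i))" for k i
  have U_M: "coreR n r U (Suc k) = M (Suc k)" if "k < d" for k
  proof (rule eq_matI)
    fix a b assume "a < dim_row (M (Suc k))" "b < dim_col (M (Suc k))"
    then have ab: "a < r k" "b < r (Suc k) * n (Suc k)" using M_dims[OF that] by (auto simp: mult.commute)
    then have "b div n (Suc k) < r (Suc k)" by (intro div_less_mult)
    then show "coreR n r U (Suc k) $$ (a, b) = M (Suc k) $$ (a, b)"
      using ab by (simp add: coreR_def U_def mult.commute)
  qed (use M_dims[OF that] in auto)
  have Xge_S: "(Xge d n r U (Suc k))\<^sup>T = (S k)\<^sup>T" if "k \<le> d" for k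
    using that
  proof (induction k rule: inc_induct)
    case base
    then show ?case by (simp add: S_def Xge_def)
  next
    case (step k)
    then have k: "k < d" by simp
    let ?K = "\<lambda>A. kron A (1\<^sub>m (n (Suc k)))"
    have "(Xge d n r U (Suc k))\<^sup>T = coreR n r U (Suc k) * ?K ((Xge d n r U (Suc (Suc k)))\<^sup>T)"
      using k by (intro Xge_rec) auto
    also have "\<dots> = (S k)\<^sup>T * ?K (S (Suc k)) * ?K ((S (Suc k))\<^sup>T)"
      using step.IH U_M[OF k] by (simp add: M_def)
    also have "\<dots> = (S k)\<^sup>T * (?K (S (Suc k)) * ?K ((S (Suc k))\<^sup>T))"
      using k S_dims[of k] S_dims[of "Suc k"] by (intro mat_assoc) (auto simp: nprod_lower)
    also have "\<dots> = (S k)\<^sup>T" using nested[OF k] by (simp add: kron_mult_id)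
    finally show ?case .
  qed
  have ro: "right_orth d n r U"
    unfolding right_orth_def
  proof
    fix k' assume "k' \<in> {2..d}"
    then obtain k where k: "k' = Suc k" "k < d" "1 \<le> k" by (cases k') auto
    let ?K = "\<lambda>A. kron A (1\<^sub>m (n (Suc k)))"
    have "M (Suc k) * (M (Suc k))\<^sup>T = ((S k)\<^sup>T * (?K (S (Suc k)) * ?K ((S (Suc k))\<^sup>T))) * S k"
      using k S_dims[of k] S_dims[of "Suc k"]
      by (simp add: M_def mat_trans_mult kron_trans mat_assoc nprod_lower)
    also have "(S k)\<^sup>T * (?K (S (Suc k)) * ?K ((S (Suc k))\<^sup>T)) = (S k)\<^sup>T"
      using nested[OF k(2)] by (simp add: kron_mult_id)
    also have "(S k)\<^sup>T * S k = 1\<^sub>m (r k)"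
      using S_basis[of k] S_dims[of k] k by (simp add: orth_basis_def)
    finally show "coreR n r U k' * (coreR n r U k')\<^sup>T = 1\<^sub>m (r (k' - 1))"
      unfolding k(1) U_M[OF k(2)] by simp
  qed
  have "cores_ok d n r U" by (auto simp: cores_ok_def U_def)
  then have TT: "is_TT d n r U (tt_eval d n r U)" by (simp add: is_TT_def)
  have XT: "tt_eval d n r U \<in> tensors d n" by (auto simp: tensors_def tt_eval_def)
  have "flat d n 0 (tt_eval d n r U) = flat d n 0 Y"
    using flat_TT[OF r0 rd TT, of 0] Xge_S[of 0] d by (simp add: S_def mat_units nprod_empty)
  then have "tt_eval d n r U = Y"
    using unflat_flat[OF le0 XT] unflat_flat[OF le0 YT] by metis
  then have "minimal_TT d n r U Y"
    using TT rank unfolding minimal_TT_def tt_rank_def by metis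
  with ro show ?thesis by blast
qed

section \<open>The tangent space projectors in terms of column and row space projectors\<close>

text \<open>The chosen decomposition may change abruptly with \<open>Y\<close>, but for
  \<open>Y\<close> in the manifold and 0 < k < d the properties in \<open>col_proj_props\<close>
  force this product to be the orthogonal projector onto the column space of the flattening.\<close>

definition col_proj :: "nat \<Rightarrow> (nat \<Rightarrow> nat) \<Rightarrow> (nat \<Rightarrow> nat) \<Rightarrow> nat \<Rightarrow> tensor \<Rightarrow> real mat" where
  "col_proj d n r k Y = Xle n r (lo_dec d n r Y) k * (Xle n r (lo_dec d n r Y) k)\<^sup>T"

definition row_proj :: "nat \<Rightarrow> (nat \<Rightarrow> nat) \<Rightarrow> (nat \<Rightarrow> nat) \<Rightarrow> nat \<Rightarrow> tensor \<Rightarrow> real mat" where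
  "row_proj d n r k Y = Xge d n r (ro_dec d n r Y) (Suc k) * (Xge d n r (ro_dec d n r Y) (Suc k))\<^sup>T"

lemma proj_dims:
  assumes "r 0 = 1" "r d = 1"
  shows "dim_row (col_proj d n r k Y) = nprod n 1 k" "dim_col (col_proj d n r k Y) = nprod n 1 k"
    "k \<le> d \<Longrightarrow> dim_row (row_proj d n r k Y) = nprod n (Suc k) d"
    "k \<le> d \<Longrightarrow> dim_col (row_proj d n r k Y) = nprod n (Suc k) d"
  using assms by (simp_all add: col_proj_def row_proj_def Xle_dims Xge_dims)

text \<open>For \<open>k\<close> at least 1 these three facts characterize the projector, and its
  derivative is computed from them. They hold for the chosen decomposition because a left-orthogonal
  one exists.\<close>

lemma col_proj_props:
  assumes r0: "r 0 = 1" and rd: "r d = 1" and Y: "Y \<in> Mr d n r" and k: "k < d"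
  shows "is_projector (nprod n 1 k) (col_proj d n r k Y)" "mtrace (col_proj d n r k Y) = real (r k)"
    "col_proj d n r k Y * flat d n k Y = flat d n k Y"
proof -
  let ?U = "lo_dec d n r Y"
  have U: "minimal_TT d n r ?U Y" "left_orth d n r ?U"
    using someI_ex[OF left_orth_exists[OF r0 rd Y]] k unfolding lo_dec_def by auto
  let ?X = "Xle n r ?U k"
  have X: "?X \<in> carrier_mat (nprod n 1 k) (r k)" "?X\<^sup>T * ?X = 1\<^sub>m (r k)"
    using Xle_dims[where r = r, OF r0] Xle_orthonormal[OF r0 U(2) k] by auto
  show "is_projector (nprod n 1 k) (col_proj d n r k Y)" "mtrace (col_proj d n r k Y) = real (r k)"
    unfolding col_proj_def by (fact is_projector_gram[OF X] mtrace_projector[OF X])+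
  have f: "flat d n k Y = ?X * (Xge d n r ?U (Suc k))\<^sup>T"
    using U(1) k by (intro flat_TT r0 rd) (auto simp: minimal_TT_def)
  have g: "dim_col (Xge d n r ?U (Suc k)) = r k" using Xge_dims[where r = r and d = d, OF rd] k by simp
  show "col_proj d n r k Y * flat d n k Y = flat d n k Y"
    using X g carrier_matD[OF X(1)] unfolding f col_proj_def by (simp add: mat_assoc mat_cancel[OF X(2)])
qed

lemma row_proj_props:
  assumes r0: "r 0 = 1" and rd: "r d = 1" and Y: "Y \<in> Mr d n r" and k: "1 \<le> k" "k \<le> d"
  shows "is_projector (nprod n (Suc k) d) (row_proj d n r k Y)" "mtrace (row_proj d n r k Y) = real (r k)"
    "row_proj d n r k Y * (flat d n k Y)\<^sup>T = (flat d n k Y)\<^sup>T"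
proof -
  let ?U = "ro_dec d n r Y"
  have U: "minimal_TT d n r ?U Y" "right_orth d n r ?U"
    using someI_ex[OF right_orth_exists[OF r0 rd Y]] k unfolding ro_dec_def by auto
  let ?X = "Xge d n r ?U (Suc k)"
  have X: "?X \<in> carrier_mat (nprod n (Suc k) d) (r k)" "?X\<^sup>T * ?X = 1\<^sub>m (r k)"
    using Xge_dims[where r = r and d = d, OF rd k(2)] Xge_orthonormal[OF rd U(2) k] by auto
  show "is_projector (nprod n (Suc k) d) (row_proj d n r k Y)" "mtrace (row_proj d n r k Y) = real (r k)"
    unfolding row_proj_def by (fact is_projector_gram[OF X] mtrace_projector[OF X])+
  have "flat d n k Y = Xle n r ?U k * ?X\<^sup>T"
    using U(1) k by (intro flat_TT r0 rd) (auto simp: minimal_TT_def)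
  then have f: "(flat d n k Y)\<^sup>T = ?X * (Xle n r ?U k)\<^sup>T"
    using carrier_matD[OF X(1)] Xle_dims[where r = r, OF r0] by (simp add: mat_trans_mult)
  show "row_proj d n r k Y * (flat d n k Y)\<^sup>T = (flat d n k Y)\<^sup>T"
    using X Xle_dims[where r = r, OF r0] carrier_matD[OF X(1)]
    unfolding f row_proj_def by (simp add: mat_assoc mat_cancel[OF X(2)])
qed

text \<open>Expanding the bracket suffices, since \<open>Xle n r U k\<close> is
  \<open>kron (1\<^sub>m (n k)) (Xle n r U j) * coreL n r U k\<close>. It serves twice: for the
  chosen decomposition, and backwards for the given one at \<open>X\<close>.\<close>

lemma interface_complement:
  assumes r0: "r 0 = 1" and k: "k = Suc j"
  shows "kron (1\<^sub>m (n k)) (Xle n r U j) * (1\<^sub>m (r j * n k) - coreL n r U k * (coreL n r U k)\<^sup>T)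
      * (kron (1\<^sub>m (n k)) (Xle n r U j))\<^sup>T
    = kron (1\<^sub>m (n k)) (Xle n r U j * (Xle n r U j)\<^sup>T) - Xle n r U k * (Xle n r U k)\<^sup>T"
  using k by (simp add: Xle_dims r0 mat_distribs mat_assoc mat_units mult.commute kron_trans flip: kron_mult_id)

lemma proj_eq:
  assumes r0: "r 0 = 1" and rd: "r d = 1" and k: "1 \<le> k" "k < d"
  shows "proj d n r k Y Z = unflat d n k
    ((kron (1\<^sub>m (n k)) (col_proj d n r (k - 1) Y) - col_proj d n r k Y) * flat d n k Z * row_proj d n r k Y)"
proof -
  obtain j where j: "k = Suc j" using k by (cases k) auto
  have dims: "dim_row (Xge d n r (ro_dec d n r Y) (Suc k)) = nprod n (Suc k) d"
    "dim_col (Xge d n r (ro_dec d n r Y) (Suc k)) = r k"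
    using Xge_dims[where r = r and d = d, OF rd, of k] k by auto
  have "kron (1\<^sub>m (n k)) (col_proj d n r (k - 1) Y) - col_proj d n r k Y
    = kron (1\<^sub>m (n k)) (Xle n r (lo_dec d n r Y) (k - 1))
      * (1\<^sub>m (r (k - 1) * n k) - coreL n r (lo_dec d n r Y) k * (coreL n r (lo_dec d n r Y) k)\<^sup>T)
      * (kron (1\<^sub>m (n k)) (Xle n r (lo_dec d n r Y) (k - 1)))\<^sup>T"
    using interface_complement[where r = r, OF r0 j, of n "lo_dec d n r Y"] j unfolding col_proj_def by simp
  then show ?thesis
    using k dims j unfolding proj_def Let_def row_proj_def
    by (simp add: mat_assoc Xle_dims r0 nprod_Suc)
qed

lemma proj_eq_last:
  "proj d n r d Y Z = unflat d n d (kron (1\<^sub>m (n d)) (col_proj d n r (d - 1) Y) * flat d n d Z)"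
  by (simp add: proj_def Let_def col_proj_def)

section \<open>Differentiating matrix-valued curves\<close>

definition has_mat_deriv :: "(real \<Rightarrow> real mat) \<Rightarrow> real mat \<Rightarrow> bool" where
  "has_mat_deriv F D \<longleftrightarrow> (\<forall>t. dim_row (F t) = dim_row D \<and> dim_col (F t) = dim_col D) \<and>
    (\<forall>i<dim_row D. \<forall>j<dim_col D. ((\<lambda>t. F t $$ (i, j)) has_real_derivative D $$ (i, j)) (at 0))"

lemma has_mat_derivD:
  assumes "has_mat_deriv F D"
  shows "dim_row (F t) = dim_row D" "dim_col (F t) = dim_col D"
    "i < dim_row D \<Longrightarrow> j < dim_col D \<Longrightarrow> ((\<lambda>t. F t $$ (i, j)) has_real_derivative D $$ (i, j)) (at 0)"
  using assms by (auto simp: has_mat_deriv_def)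

lemma has_mat_deriv_const: "has_mat_deriv (\<lambda>t. A) (0\<^sub>m (dim_row A) (dim_col A))"
  by (auto simp: has_mat_deriv_def)

lemma has_mat_deriv_add:
  assumes "has_mat_deriv F A" "has_mat_deriv G B" "dim_row A = dim_row B" "dim_col A = dim_col B"
  shows "has_mat_deriv (\<lambda>t. F t + G t) (A + B)"
  using assms unfolding has_mat_deriv_def by (auto intro!: derivative_intros)

lemma has_mat_deriv_diff:
  assumes "has_mat_deriv F A" "has_mat_deriv G B" "dim_row A = dim_row B" "dim_col A = dim_col B"
  shows "has_mat_deriv (\<lambda>t. F t - G t) (A - B)"
  using assms unfolding has_mat_deriv_def by (auto intro!: derivative_intros)

lemma has_mat_deriv_transpose:
  "has_mat_deriv F A \<Longrightarrow> has_mat_deriv (\<lambda>t. (F t)\<^sup>T) (A\<^sup>T)"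
  unfolding has_mat_deriv_def by auto

lemma has_mat_deriv_mult:
  assumes F: "has_mat_deriv F A" and G: "has_mat_deriv G B" and d: "dim_col A = dim_row B"
  shows "has_mat_deriv (\<lambda>t. F t * G t) (A * G 0 + F 0 * B)"
proof -
  note dF = has_mat_derivD(1,2)[OF F] and dG = has_mat_derivD(1,2)[OF G]
  show ?thesis unfolding has_mat_deriv_def
  proof (intro conjI allI impI)
    fix i j assume "i < dim_row (A * G 0 + F 0 * B)" "j < dim_col (A * G 0 + F 0 * B)"
    then have ij: "i < dim_row A" "j < dim_col B" using dF dG by auto
    have "((\<lambda>t. \<Sum>l<dim_col A. F t $$ (i, l) * G t $$ (l, j)) has_real_derivative
        (\<Sum>l<dim_col A. A $$ (i, l) * G 0 $$ (l, j) + B $$ (l, j) * F 0 $$ (i, l))) (at 0)"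
      using ij d has_mat_derivD(3)[OF F] has_mat_derivD(3)[OF G]
      by (intro DERIV_sum DERIV_mult) auto
    then show "((\<lambda>t. (F t * G t) $$ (i, j)) has_real_derivative (A * G 0 + F 0 * B) $$ (i, j)) (at 0)"
      using ij d dF dG by (simp add: mult_index_sum sum.distrib mult.commute del: index_mult_mat(1))
  qed (use dF dG d in auto)
qed

lemma has_mat_deriv_mult_const:
  assumes "has_mat_deriv F A" "dim_col A = dim_row B"
  shows "has_mat_deriv (\<lambda>t. F t * B) (A * B)"
  using has_mat_deriv_mult[OF assms(1) has_mat_deriv_const[of B]] assms has_mat_derivD[OF assms(1)]
  by (simp add: mat_units)

lemma has_mat_deriv_const_mult:
  assumes "has_mat_deriv F A" "dim_col B = dim_row A"
  shows "has_mat_deriv (\<lambda>t. B * F t) (B * A)"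
  using has_mat_deriv_mult[OF has_mat_deriv_const[of B] assms(1)] assms has_mat_derivD[OF assms(1)]
  by (simp add: mat_units)

lemma has_mat_deriv_kron:
  assumes "has_mat_deriv F A"
  shows "has_mat_deriv (\<lambda>t. kron B (F t)) (kron B A)"
proof -
  note dF = has_mat_derivD(1,2)[OF assms]
  show ?thesis unfolding has_mat_deriv_def
  proof (intro conjI allI impI)
    fix i j assume "i < dim_row (kron B A)" "j < dim_col (kron B A)"
    then show "((\<lambda>t. kron B (F t) $$ (i, j)) has_real_derivative kron B A $$ (i, j)) (at 0)"
      using dF by (auto simp: kron_index mod_less_mult intro!: DERIV_cmult has_mat_derivD(3)[OF assms])
  qed (use dF in auto)
qed

text \<open>The first factor is only continuous; as the second one vanishes at 0, the difference
  quotient is \<open>f h * (g h / h)\<close>. In the application the first factor is an entry of I -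
  P, before P is known to be differentiable.\<close>

lemma DERIV_mult_continuous_zero:
  fixes f g :: "real \<Rightarrow> real"
  assumes "(f \<longlongrightarrow> f 0) (at 0)" "g 0 = 0" "(g has_real_derivative g') (at 0)"
  shows "((\<lambda>t. f t * g t) has_real_derivative f 0 * g') (at 0)"
proof -
  have "(\<lambda>h. (g (0 + h) - g 0) / h) \<midarrow>0\<rightarrow> g'" using assms(3) unfolding DERIV_def .
  from tendsto_mult[OF assms(1) this] show ?thesis
    unfolding DERIV_def using assms(2) by simp
qed

text \<open>Meant for the remainder in \<open>projector_perturbation\<close>, which is dominated by
  a sum of squares of functions that vanish at 0.\<close>

lemma DERIV_squeeze_zero:
  fixes f q :: "real \<Rightarrow> real"
  assumes "\<And>t. \<bar>f t\<bar> \<le> q t" "q 0 = 0" "(q has_real_derivative 0) (at 0)"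
  shows "f 0 = 0" "(f has_real_derivative 0) (at 0)"
proof -
  show f0: "f 0 = 0" using assms(1)[of 0] assms(2) by simp
  have lim: "((\<lambda>h. (q (0 + h) - q 0) / h) \<longlongrightarrow> 0) (at 0)"
    using assms(3) unfolding DERIV_def .
  have "((\<lambda>h. (f (0 + h) - f 0) / h) \<longlongrightarrow> 0) (at 0)"
  proof (rule tendsto_0_le[OF lim, where K = 1])
    have "\<bar>f h\<bar> \<le> \<bar>q h\<bar>" for h using assms(1)[of h] by linarith
    then show "\<forall>\<^sub>F h in at 0. norm ((f (0 + h) - f 0) / h) \<le> norm ((q (0 + h) - q 0) / h) * 1"
      using f0 assms(2) by (intro always_eventually) (simp add: divide_right_mono)
  qed
  then show "(f has_real_derivative 0) (at 0)" unfolding DERIV_def .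
qed

section \<open>The derivative of an orthogonal projector of constant rank\<close>

text \<open>\<open>\<bar>x * y\<bar> \<le> (x\<^sup>2 + y\<^sup>2) / 2\<close> bounds the entry by
  the mean of two squared column norms, and each of these is at most the squared Frobenius
  norm.\<close>

lemma gram_entry_le_trace:
  assumes "i < dim_col E" "j < dim_col E"
  shows "\<bar>(E\<^sup>T * E) $$ (i, j)\<bar> \<le> mtrace (E\<^sup>T * E)"
proof -
  let ?s = "\<lambda>j. \<Sum>l<dim_row E. (E $$ (l, j))\<^sup>2"
  have "(E\<^sup>T * E) $$ (i, j) = (\<Sum>l<dim_row E. E $$ (l, i) * E $$ (l, j))"
    using assms by (subst mult_index_sum) auto
  also have "\<bar>\<dots>\<bar> \<le> (\<Sum>l<dim_row E. \<bar>E $$ (l, i) * E $$ (l, j)\<bar>)"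
    by (rule sum_abs)
  also have "\<dots> \<le> (\<Sum>l<dim_row E. ((E $$ (l, i))\<^sup>2 + (E $$ (l, j))\<^sup>2) / 2)"
  proof (rule sum_mono)
    fix l
    have "0 \<le> (\<bar>E $$ (l, i)\<bar> - \<bar>E $$ (l, j)\<bar>)\<^sup>2" by simp
    then show "\<bar>E $$ (l, i) * E $$ (l, j)\<bar> \<le> ((E $$ (l, i))\<^sup>2 + (E $$ (l, j))\<^sup>2) / 2"
      by (simp add: power2_diff abs_mult)
  qed
  also have "\<dots> = (?s i + ?s j) / 2" by (simp add: sum.distrib flip: sum_divide_distrib)
  finally have le: "\<bar>(E\<^sup>T * E) $$ (i, j)\<bar> \<le> (?s i + ?s j) / 2" .
  have "?s b \<le> mtrace (E\<^sup>T * E)" if "b < dim_col E" for b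
    unfolding mtrace_gram using that by (intro member_le_sum) (auto intro: sum_nonneg)
  then have "(?s i + ?s j) / 2 \<le> (mtrace (E\<^sup>T * E) + mtrace (E\<^sup>T * E)) / 2"
    using assms by (intro divide_right_mono add_mono) auto
  from order.trans[OF le this] show ?thesis by simp
qed

text \<open>Two projectors of equal rank satisfy \<open>\<parallel>(I - T) P\<parallel>\<^sub>F = \<parallel>(I - P) T\<parallel>\<^sub>F\<close>, so the part of \<open>P\<close> outside the
  range of \<open>T = S S\<^sup>T\<close> is quadratic in \<open>K = (P - I) S\<close>.\<close>

lemma projector_perturbation:
  assumes P: "is_projector m P" "mtrace P = real s"
    and S: "S \<in> carrier_mat m s" "S\<^sup>T * S = 1\<^sub>m s"
  defines "T \<equiv> S * S\<^sup>T" and "K \<equiv> P * S - S"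
  shows "\<exists>L. dim_row L = m \<and> dim_col L = m \<and> P = L + (K * S\<^sup>T + (S * K\<^sup>T + (T - T * (K * S\<^sup>T))))
     \<and> (\<forall>i<m. \<forall>j<m. \<bar>L $$ (i, j)\<bar> \<le> (\<Sum>b<s. \<Sum>a<m. (K $$ (a, b))\<^sup>2))"
proof -
  note dP = is_projectorD[OF P(1)] and dS = carrier_matD[OF S(1)]
  note [simp] = dP(1,2) dS
  have [simp]: "dim_row T = m" "dim_col T = m" "dim_row K = m" "dim_col K = s"
    by (simp_all add: T_def K_def)
  have TT: "T * T = T" "T\<^sup>T = T" using is_projectorD[OF is_projector_gram[OF S]] by (simp_all add: T_def)
  \<comment> \<open>\<open>E\<close> is P (I - T), so \<open>L\<close>, which is (I - T) P (I - T),
    is its Gram matrix, and the trace controls the entries.\<close>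
  define E where "E = P - P * T"
  define L where "L = P - T * P - P * T + T * (P * T)"
  have [simp]: "dim_row E = m" "dim_col E = m" "dim_row L = m" "dim_col L = m"
    by (simp_all add: E_def L_def)
  have PP: "P * (P * A) = P * A" if "dim_row A = m" for A
  proof -
    have "P * (P * A) = (P * P) * A" using that by (simp add: mat_assoc)
    then show ?thesis unfolding dP(4) .
  qed
  have EE: "E\<^sup>T * E = L"
    unfolding E_def L_def
    by (intro eq_matI) (simp_all add: mat_distribs mat_assoc dP(3,4) TT PP del: index_mult_mat(1))
  have SSA: "S\<^sup>T * (S * A) = A" if "dim_row A = s" for A
    by (rule mat_cancel[OF S(2)]) (simp_all add: that)
  have KK: "K\<^sup>T * K = 1\<^sub>m s - S\<^sup>T * (P * S)"
    unfolding K_def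
    by (intro eq_matI) (simp_all add: mat_distribs mat_assoc dP(3,4) PP S(2) del: index_mult_mat(1))
  have t1: "mtrace (T * P) = mtrace (P * T)" by (simp add: mtrace_comm)
  have t2: "mtrace (T * (P * T)) = mtrace (P * T)"
    using mtrace_comm[of T "P * T"] by (simp add: mat_assoc TT)
  have t3: "mtrace (S\<^sup>T * (P * S)) = mtrace (P * T)"
    using mtrace_comm[of "S\<^sup>T" "P * S"] by (simp add: mat_assoc T_def)
  \<comment> \<open>Both Gram matrices have trace \<open>s\<close> minus the trace of
    \<open>P * T\<close>: this is where \<open>P\<close> and \<open>T\<close> having the same rank
    comes in.\<close>
  have "mtrace L = real s - mtrace (P * T)"
    by (simp add: L_def mtrace_add mtrace_diff t1 t2 P(2))
  moreover have "mtrace (K\<^sup>T * K) = real s - mtrace (P * T)"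
    unfolding KK by (simp add: mtrace_diff t3 mtrace_one)
  ultimately have tr: "mtrace (E\<^sup>T * E) = (\<Sum>b<s. \<Sum>a<m. (K $$ (a, b))\<^sup>2)"
    unfolding EE using mtrace_gram[of K] by simp
  have "\<bar>L $$ (i, j)\<bar> \<le> (\<Sum>b<s. \<Sum>a<m. (K $$ (a, b))\<^sup>2)" if "i < m" "j < m" for i j
    using gram_entry_le_trace[of i E j] that unfolding tr unfolding EE by simp
  \<comment> \<open>By definition \<open>P\<close> is \<open>L\<close> plus P T + T P - T P T, and
    the latter is rewritten with \<open>K * S\<^sup>T = P * T - T\<close> and its transpose.\<close>
  moreover have "P = L + (K * S\<^sup>T + (S * K\<^sup>T + (T - T * (K * S\<^sup>T))))"
  proof -
    have KS: "K * S\<^sup>T = P * T - T" unfolding K_def T_def by (simp add: mat_distribs mat_assoc)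
    have SK: "S * K\<^sup>T = T * P - T" unfolding K_def T_def by (simp add: mat_distribs mat_assoc dP(3))
    show ?thesis unfolding KS SK L_def
      by (intro eq_matI) (simp_all add: mat_distribs TT del: index_mult_mat(1))
  qed
  ultimately show ?thesis by (intro exI[of _ L]) auto
qed

text \<open>The family \<open>P\<close> is not assumed to be continuous. Its bounded entries make
  \<open>K\<close> tend to 0; then \<open>projector_perturbation\<close> makes \<open>P\<close>
  continuous at 0; then \<open>K\<close> is differentiable with derivative \<open>D\<close>; and the
  remainder \<open>L\<close> has derivative 0 because it is quadratic in \<open>K\<close>.\<close>

lemma projector_has_mat_deriv:
  assumes P: "\<And>t. is_projector m (P t)" "\<And>t. mtrace (P t) = real s" "\<And>t. P t * A t = A t"
    and A: "has_mat_deriv A A'" "dim_row A' = m"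
    and S: "S \<in> carrier_mat m s" "S\<^sup>T * S = 1\<^sub>m s"
    and W: "dim_row W = dim_col A'" "S = A 0 * W"
  defines "D \<equiv> (1\<^sub>m m - S * S\<^sup>T) * (A' * W)"
  shows "P 0 = S * S\<^sup>T" "has_mat_deriv P (D * S\<^sup>T + S * D\<^sup>T)"
proof -
  note dP = is_projectorD[OF P(1)] and dS = carrier_matD[OF S(1)] and dA = has_mat_derivD(1,2)[OF A(1)]
  note [simp] = dP(1,2) dS dA A(2) W(1)
  define T where "T = S * S\<^sup>T"
  have [simp]: "dim_col W = s" using dS(2) unfolding W(2) by simp
  have [simp]: "dim_row T = m" "dim_col T = m" by (simp_all add: T_def)
  define B where "B t = A t * W" for t
  have [simp]: "dim_row (B t) = m" "dim_col (B t) = s" for t by (simp_all add: B_def)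
  have B0: "B 0 = S" by (simp add: B_def W(2)[symmetric])
  have B': "has_mat_deriv (\<lambda>t. B t - S) (A' * W)"
  proof -
    have "has_mat_deriv B (A' * W)"
      unfolding B_def by (rule has_mat_deriv_mult_const[OF A(1)]) simp
    from has_mat_deriv_diff[OF this has_mat_deriv_const[of S]] show ?thesis by (simp add: mat_units)
  qed
  define K where "K t = P t * S - S" for t
  have [simp]: "dim_row (K t) = m" "dim_col (K t) = s" for t by (simp_all add: K_def)
  have PB: "P t * B t = B t" for t
    using mat_assoc[of "P t" "A t" W] P(3)[of t] by (simp add: B_def)
  \<comment> \<open>\<open>P t\<close> fixes \<open>B t\<close>, a curve that passes through
    \<open>S\<close> at 0. So \<open>K t\<close> is a bounded factor times a difference whose
    first-order behaviour is known.\<close>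
  have K_eq: "K t = (1\<^sub>m m - P t) * (B t - S)" for t
    unfolding K_def by (intro eq_matI) (simp_all add: mat_distribs mat_units PB del: index_mult_mat(1))
  have K_index: "K t $$ (a, b) = (\<Sum>l<m. (1\<^sub>m m - P t) $$ (a, l) * (B t - S) $$ (l, b))"
    if "a < m" "b < s" for t a b
    unfolding K_eq using that by (subst mult_index_sum) auto
  have BS0: "((\<lambda>t. (B t - S) $$ (l, b)) \<longlongrightarrow> 0) (at 0)" "(B 0 - S) $$ (l, b) = 0" if "l < m" "b < s" for l b
  proof -
    show z: "(B 0 - S) $$ (l, b) = 0" using that by (simp add: B0)
    have "isCont (\<lambda>t. (B t - S) $$ (l, b)) 0"
      using has_mat_derivD(3)[OF B', of l b] that by (intro DERIV_isCont) auto
    then show "((\<lambda>t. (B t - S) $$ (l, b)) \<longlongrightarrow> 0) (at 0)" unfolding isCont_def z .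
  qed
  have K_lim: "((\<lambda>t. K t $$ (a, b)) \<longlongrightarrow> 0) (at 0)" if ab: "a < m" "b < s" for a b
  proof -
    have "((\<lambda>t. (1\<^sub>m m - P t) $$ (a, l) * (B t - S) $$ (l, b)) \<longlongrightarrow> 0) (at 0)" if l: "l < m" for l
    proof (rule tendsto_0_le[OF BS0(1)[OF l ab(2)], where K = 2])
      have bound: "\<bar>(1\<^sub>m m - P t) $$ (a, l)\<bar> \<le> 2" for t
        using is_projector_entry[OF P(1)[of t] ab(1) l] ab l by auto
      show "\<forall>\<^sub>F t in at 0. norm ((1\<^sub>m m - P t) $$ (a, l) * (B t - S) $$ (l, b))
          \<le> norm ((B t - S) $$ (l, b)) * 2"
      proof (intro always_eventually allI)
        fix t
        show "norm ((1\<^sub>m m - P t) $$ (a, l) * (B t - S) $$ (l, b)) \<le> norm ((B t - S) $$ (l, b)) * 2"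
          using mult_left_mono[OF bound[of t] abs_ge_zero[of "(B t - S) $$ (l, b)"]]
          by (simp add: abs_mult mult.commute del: index_minus_mat(1))
      qed
    qed
    then have "((\<lambda>t. \<Sum>l<m. (1\<^sub>m m - P t) $$ (a, l) * (B t - S) $$ (l, b)) \<longlongrightarrow> (\<Sum>l<m. 0)) (at 0)"
      by (intro tendsto_sum) auto
    then show ?thesis using K_index[OF ab] by simp
  qed
  have "\<forall>t. \<exists>L. dim_row L = m \<and> dim_col L = m
     \<and> P t = L + (K t * S\<^sup>T + (S * (K t)\<^sup>T + (T - T * (K t * S\<^sup>T))))
     \<and> (\<forall>i<m. \<forall>j<m. \<bar>L $$ (i, j)\<bar> \<le> (\<Sum>b<s. \<Sum>a<m. (K t $$ (a, b))\<^sup>2))"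
    unfolding K_def T_def by (intro allI projector_perturbation P S)
  then obtain L where L: "\<And>t. dim_row (L t) = m" "\<And>t. dim_col (L t) = m"
     "\<And>t. P t = L t + (K t * S\<^sup>T + (S * (K t)\<^sup>T + (T - T * (K t * S\<^sup>T))))"
     "\<And>t i j. i < m \<Longrightarrow> j < m \<Longrightarrow> \<bar>L t $$ (i, j)\<bar> \<le> (\<Sum>b<s. \<Sum>a<m. (K t $$ (a, b))\<^sup>2)"
    by metis
  note [simp] = L(1,2)
  \<comment> \<open>\<open>K\<close> vanishes at 0 because \<open>B 0 = S\<close>; the perturbation
    bound then identifies \<open>P 0\<close> with \<open>S * S\<^sup>T\<close>.\<close>
  have K0: "K 0 = 0\<^sub>m m s" unfolding K_eq B0 by (intro eq_matI) (simp_all add: mat_distribs mat_units)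
  have q0: "(\<Sum>b<s. \<Sum>a<m. (K 0 $$ (a, b))\<^sup>2) = 0" by (simp add: K0)
  have L0: "L 0 = 0\<^sub>m m m"
    using L(4)[of _ _ 0] unfolding q0 by (intro eq_matI) auto
  have P0: "P 0 = T"
    unfolding L(3)[of 0] L0 K0 by (intro eq_matI) (simp_all add: mat_units)
  then show "P 0 = S * S\<^sup>T" by (simp add: T_def)
  have P_cont: "((\<lambda>t. P t $$ (i, j)) \<longlongrightarrow> P 0 $$ (i, j)) (at 0)" if ij: "i < m" "j < m" for i j
  proof -
    have "((\<lambda>t. \<Sum>b<s. \<Sum>a<m. (K t $$ (a, b))\<^sup>2) \<longlongrightarrow> (\<Sum>b<s. \<Sum>a<m. 0\<^sup>2)) (at 0)"
      using K_lim by (intro tendsto_sum tendsto_power) auto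
    then have lim: "((\<lambda>t. \<Sum>b<s. \<Sum>a<m. (K t $$ (a, b))\<^sup>2) \<longlongrightarrow> 0) (at 0)" by simp
    have "((\<lambda>t. L t $$ (i, j)) \<longlongrightarrow> 0) (at 0)"
      using order.trans[OF L(4)[OF ij] abs_ge_self]
      by (intro tendsto_0_le[OF lim, where K = 1] always_eventually) simp
    moreover have KS: "((\<lambda>t. (K t * S\<^sup>T) $$ (i, j)) \<longlongrightarrow> 0) (at 0)" if "i < m" "j < m" for i j
    proof -
      have "((\<lambda>t. \<Sum>l<s. K t $$ (i, l) * S\<^sup>T $$ (l, j)) \<longlongrightarrow> (\<Sum>l<s. 0 * S\<^sup>T $$ (l, j))) (at 0)"
        using K_lim that by (intro tendsto_sum tendsto_mult tendsto_const) auto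
      then show ?thesis using that by (simp add: mult_index_sum del: index_mult_mat(1))
    qed
    moreover have "((\<lambda>t. (S * (K t)\<^sup>T) $$ (i, j)) \<longlongrightarrow> 0) (at 0)"
    proof -
      have "S * (K t)\<^sup>T = (K t * S\<^sup>T)\<^sup>T" for t by (simp add: mat_trans_mult)
      then have "(S * (K t)\<^sup>T) $$ (i, j) = (K t * S\<^sup>T) $$ (j, i)" for t
        using ij by (simp del: index_mult_mat(1))
      then show ?thesis using KS[OF ij(2,1)] by simp
    qed
    moreover have "((\<lambda>t. (T * (K t * S\<^sup>T)) $$ (i, j)) \<longlongrightarrow> 0) (at 0)"
    proof -
      have "((\<lambda>t. \<Sum>l<m. T $$ (i, l) * (K t * S\<^sup>T) $$ (l, j)) \<longlongrightarrow> (\<Sum>l<m. T $$ (i, l) * 0)) (at 0)"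
        using KS ij by (intro tendsto_sum tendsto_mult tendsto_const) auto
      then show ?thesis using ij
        by (subst mult_index_sum) simp_all
    qed
    moreover note KS[OF ij]
    ultimately have "((\<lambda>t. L t $$ (i, j) + ((K t * S\<^sup>T) $$ (i, j) + ((S * (K t)\<^sup>T) $$ (i, j)
        + (T $$ (i, j) - (T * (K t * S\<^sup>T)) $$ (i, j))))) \<longlongrightarrow> 0 + (0 + (0 + (T $$ (i, j) - 0)))) (at 0)"
      by (intro tendsto_intros)
    moreover have "P t $$ (i, j) = L t $$ (i, j) + ((K t * S\<^sup>T) $$ (i, j) + ((S * (K t)\<^sup>T) $$ (i, j)
        + (T $$ (i, j) - (T * (K t * S\<^sup>T)) $$ (i, j))))" for t
      using ij by (subst L(3)) (simp del: index_mult_mat(1))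
    ultimately show ?thesis by (simp add: P0 del: index_mult_mat(1))
  qed
  have [simp]: "dim_row D = m" "dim_col D = s" by (simp_all add: D_def)
  \<comment> \<open>Second use of the product formula for \<open>K\<close>: now the factor I - P is
    continuous at 0, so the product has a derivative.\<close>
  have K': "has_mat_deriv K D"
    unfolding has_mat_deriv_def
  proof (intro conjI allI impI)
    fix a b assume "a < dim_row D" "b < dim_col D"
    then have ab: "a < m" "b < s" by simp_all
    have "((\<lambda>t. \<Sum>l<m. (1\<^sub>m m - P t) $$ (a, l) * (B t - S) $$ (l, b)) has_real_derivative
        (\<Sum>l<m. (1\<^sub>m m - P 0) $$ (a, l) * (A' * W) $$ (l, b))) (at 0)"
    proof (intro DERIV_sum DERIV_mult_continuous_zero)
      fix l assume "l \<in> {..<m}"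
      then have l: "l < m" by simp
      show "((\<lambda>t. (1\<^sub>m m - P t) $$ (a, l)) \<longlongrightarrow> (1\<^sub>m m - P 0) $$ (a, l)) (at 0)"
        using P_cont[OF ab(1) l] ab l by (auto intro!: tendsto_intros)
      show "(B 0 - S) $$ (l, b) = 0" using BS0(2) l ab by simp
      show "((\<lambda>t. (B t - S) $$ (l, b)) has_real_derivative (A' * W) $$ (l, b)) (at 0)"
        using has_mat_derivD(3)[OF B', of l b] l ab by simp
    qed
    moreover have "D $$ (a, b) = (\<Sum>l<m. (1\<^sub>m m - P 0) $$ (a, l) * (A' * W) $$ (l, b))"
      unfolding D_def P0 T_def using ab by (subst mult_index_sum) auto
    ultimately show "((\<lambda>t. K t $$ (a, b)) has_real_derivative D $$ (a, b)) (at 0)"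
      using K_index[OF ab] by simp
  qed simp_all
  have L': "has_mat_deriv L (0\<^sub>m m m)"
    unfolding has_mat_deriv_def
  proof (intro conjI allI impI)
    fix i j assume "i < dim_row (0\<^sub>m m m :: real mat)" "j < dim_col (0\<^sub>m m m :: real mat)"
    then have ij: "i < m" "j < m" by simp_all
    have "((\<lambda>t. \<Sum>b<s. \<Sum>a<m. (K t $$ (a, b))\<^sup>2) has_real_derivative
        (\<Sum>b<s. \<Sum>a<m. of_nat 2 * (D $$ (a, b) * K 0 $$ (a, b) ^ (2 - Suc 0)))) (at 0)"
      using has_mat_derivD(3)[OF K'] by (intro DERIV_sum DERIV_power) auto
    then have "((\<lambda>t. \<Sum>b<s. \<Sum>a<m. (K t $$ (a, b))\<^sup>2) has_real_derivative 0) (at 0)"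
      by (simp add: K0)
    from DERIV_squeeze_zero(2)[OF L(4)[OF ij] q0 this]
    show "((\<lambda>t. L t $$ (i, j)) has_real_derivative 0\<^sub>m m m $$ (i, j)) (at 0)" using ij by simp
  qed simp_all
  have KS': "has_mat_deriv (\<lambda>t. K t * S\<^sup>T) (D * S\<^sup>T)"
    by (rule has_mat_deriv_mult_const[OF K']) simp
  have "has_mat_deriv (\<lambda>t. L t + (K t * S\<^sup>T + (S * (K t)\<^sup>T + (T - T * (K t * S\<^sup>T)))))
      (0\<^sub>m m m + (D * S\<^sup>T + (S * D\<^sup>T + (0\<^sub>m (dim_row T) (dim_col T) - T * (D * S\<^sup>T)))))"
    by (intro has_mat_deriv_add has_mat_deriv_diff L' KS' has_mat_deriv_const has_mat_deriv_const_mult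
        has_mat_deriv_transpose K') simp_all
  \<comment> \<open>\<open>D\<close> starts with the factor I - T, so the last term of the expansion
    contributes nothing.\<close>
  moreover have "T * (D * S\<^sup>T) = 0\<^sub>m m m"
  proof -
    have TTA: "T * (T * Y) = T * Y" if "dim_row Y = m" for Y
    proof -
      have "T * (T * Y) = (T * T) * Y" using that by (simp add: mat_assoc)
      then show ?thesis using is_projectorD(4)[OF is_projector_gram[OF S]] unfolding T_def by (simp only:)
    qed
    show ?thesis
      unfolding D_def T_def[symmetric]
      by (intro eq_matI) (simp_all add: mat_distribs mat_units mat_assoc TTA del: index_mult_mat(1))
  qed
  moreover have "0\<^sub>m m m + (D * S\<^sup>T + (S * D\<^sup>T + (0\<^sub>m m m - 0\<^sub>m m m))) = D * S\<^sup>T + S * D\<^sup>T"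
    by (intro eq_matI) (simp_all del: index_mult_mat(1))
  ultimately show "has_mat_deriv P (D * S\<^sup>T + S * D\<^sup>T)"
    unfolding L(3)[symmetric] by simp
qed

section \<open>The projected derivative\<close>

text \<open>In the recursion the first term inherits orthogonality from the previous step; in the
  second one orthonormality of the interface matrix reduces the product to
  \<open>?M\<^sup>T * ?L\<close>, which vanishes by the gauge condition.\<close>

lemma Vle_orthogonal:
  assumes r0: "r 0 = 1" and lo: "left_orth d n r U" and ga: "gauge d n r U dV" and k: "k < d"
  shows "(Vle n r U dV k)\<^sup>T * Xle n r U k = 0\<^sub>m (r k) (r k)"
  using k
proof (induction k)
  case 0
  then show ?case using r0 by simp
next
  case (Suc k)
  let ?X = "Xle n r U k" let ?V = "Vle n r U dV k" let ?I = "1\<^sub>m (n (Suc k)) :: real mat"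
  let ?L = "coreL n r U (Suc k)" let ?M = "coreL n r dV (Suc k)"
  note d = Xle_dims[where r = r, OF r0]
  have orthL: "?M\<^sup>T * ?L = 0\<^sub>m (r (Suc k)) (r (Suc k))" using ga Suc.prems by (auto simp: gauge_def)
  have X: "?X\<^sup>T * ?X = 1\<^sub>m (r k)" using Suc.prems by (intro Xle_orthonormal[OF r0 lo]) auto
  have VX: "?V\<^sup>T * ?X = 0\<^sub>m (r k) (r k)" using Suc by simp
  have KX: "kron ?I (?X\<^sup>T) * kron ?I ?X = 1\<^sub>m (n (Suc k) * r k)"
    by (simp only: kron_mult_id d index_transpose_mat X kron_one)
  have KV: "kron ?I (?V\<^sup>T) * kron ?I ?X = 0\<^sub>m (n (Suc k) * r k) (n (Suc k) * r k)"
    by (simp only: kron_mult_id d index_transpose_mat VX kron_zero index_one_mat)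
  have "(Vle n r U dV (Suc k))\<^sup>T * Xle n r U (Suc k)
    = ?L\<^sup>T * ((kron ?I (?V\<^sup>T) * kron ?I ?X) * ?L) + ?M\<^sup>T * ((kron ?I (?X\<^sup>T) * kron ?I ?X) * ?L)"
    by (simp add: mat_distribs kron_trans mat_assoc mult.commute d)
  also have "\<dots> = 0\<^sub>m (r (Suc k)) (r (Suc k))"
    unfolding KX KV by (simp add: mat_units orthL mult.commute)
  finally show ?case .
qed

text \<open>The matrix identity behind the case k < d. \<open>G\<close> and \<open>H\<close> stand
  for the left interface matrix at k - 1 and its variation, each tensored with the identity;
  \<open>L\<close> and \<open>M\<close> for the left unfoldings of \<open>U\<close> and
  \<open>dV\<close>; \<open>T\<close> for the right interface matrix of \<open>tU\<close>;
  \<open>N\<close> for the right variation times \<open>Rinv k\<close>. The bracket is the product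
  rule for E Z Q, with \<open>D * T\<^sup>T + T * D\<^sup>T\<close> the derivative of Q.\<close>

lemma projected_derivative:
  fixes G H L M T N Z :: "real mat"
  assumes dims: "dim_row G = a" "dim_col G = b" "dim_row H = a" "dim_col H = b" "dim_row L = b" "dim_col L = c"
    "dim_row M = b" "dim_col M = c" "dim_row T = e" "dim_col T = f" "dim_row N = e" "dim_col N = f"
    "dim_row Z = a" "dim_col Z = e"
    and rel: "G\<^sup>T * G = 1\<^sub>m b" "H\<^sup>T * G = 0\<^sub>m b b" "L\<^sup>T * L = 1\<^sub>m c" "M\<^sup>T * L = 0\<^sub>m c c" "T\<^sup>T * T = 1\<^sub>m f"
  defines "E \<equiv> G * (1\<^sub>m b - L * L\<^sup>T) * G\<^sup>T" and "D \<equiv> (1\<^sub>m e - T * T\<^sup>T) * N"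
    and "V \<equiv> H * L + G * M" and "X \<equiv> G * L"
  shows "E * (((H * G\<^sup>T + G * H\<^sup>T) - (V * X\<^sup>T + X * V\<^sup>T)) * Z * (T * T\<^sup>T) + E * Z * (D * T\<^sup>T + T * D\<^sup>T)) * (T * T\<^sup>T)
    = G * ((1\<^sub>m b - L * L\<^sup>T) * H\<^sup>T * Z * T) * T\<^sup>T - G * (M * L\<^sup>T * G\<^sup>T * Z * T) * T\<^sup>T
      + G * ((1\<^sub>m b - L * L\<^sup>T) * G\<^sup>T * Z * (1\<^sub>m e - T * T\<^sup>T) * N) * T\<^sup>T"
proof -
  note [simp] = dims
  have rel': "G\<^sup>T * H = 0\<^sub>m b b" "L\<^sup>T * M = 0\<^sub>m c c"
    using arg_cong[OF rel(2), of transpose_mat] arg_cong[OF rel(4), of transpose_mat]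
    by (simp_all add: mat_trans_mult)
  have zero: "A * (B * C) = 0\<^sub>m p (dim_col C)"
    if "A * B = 0\<^sub>m p q" "dim_col A = dim_row B" "dim_col B = dim_row C" "q = dim_row C" for A B C :: "real mat" and p q
    using that mat_assoc[of A B C] by (simp add: mat_units)
  note canc = mat_cancel[OF rel(1)] mat_cancel[OF rel(3)] mat_cancel[OF rel(5)]
    zero[OF rel(2)] zero[OF rel(4)] zero[OF rel'(1)] zero[OF rel'(2)]
  \<comment> \<open>Products are expanded and nested to the right, where adjacent frame matrices
    cancel or annihilate each other; \<open>eq_matI\<close> then compares the remaining sums
    entrywise.\<close>
  note nf = mat_distribs mat_assoc mat_units rel rel' canc
  have [simp]: "dim_row E = a" "dim_col E = a" "dim_row D = e" "dim_col D = f"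
     "dim_row V = a" "dim_col V = c" "dim_row X = a" "dim_col X = c"
    by (simp_all add: E_def D_def V_def X_def)
  have EE: "E * E = E"
    unfolding E_def by (intro eq_matI) (simp_all add: nf del: index_mult_mat(1))
  \<comment> \<open>The factor \<open>G\<^sup>T\<close> at the end of \<open>E\<close> annihilates
    \<open>H\<close> and cancels \<open>G\<close>.\<close>
  have E1: "E * (H * G\<^sup>T + G * H\<^sup>T) = G * ((1\<^sub>m b - L * L\<^sup>T) * H\<^sup>T)"
    unfolding E_def by (intro eq_matI) (simp_all add: nf del: index_mult_mat(1))
  \<comment> \<open>\<open>E * X\<close> vanishes because \<open>1\<^sub>m b - L * L\<^sup>T\<close>
    annihilates \<open>L\<close>, and \<open>E * V\<close> is \<open>G * M\<close> because
    \<open>G\<^sup>T * H\<close> and \<open>L\<^sup>T * M\<close> vanish. This yields the subtracted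
    term of the formula.\<close>
  have E2: "E * (V * X\<^sup>T + X * V\<^sup>T) = G * (M * (L\<^sup>T * G\<^sup>T))"
    unfolding E_def V_def X_def by (intro eq_matI) (simp_all add: nf del: index_mult_mat(1))
  have T1: "(D * T\<^sup>T + T * D\<^sup>T) * (T * T\<^sup>T) = D * T\<^sup>T"
    unfolding D_def by (intro eq_matI) (simp_all add: nf del: index_mult_mat(1))
  have T2: "(T * T\<^sup>T) * (T * T\<^sup>T) = T * T\<^sup>T" by (simp add: nf)
  let ?A = "(H * G\<^sup>T + G * H\<^sup>T) - (V * X\<^sup>T + X * V\<^sup>T)"
  have expand: "E * (A * Z * Q + E * Z * C) * Q = (E * A) * (Z * (Q * Q)) + (E * E) * (Z * (C * Q))"
    if "dim_row A = a" "dim_col A = a" "dim_row Q = e" "dim_col Q = e" "dim_row C = e" "dim_col C = e" for A Q C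
    using that by (simp add: mat_left_add mat_right_add mat_assoc)
  have "E * (?A * Z * (T * T\<^sup>T) + E * Z * (D * T\<^sup>T + T * D\<^sup>T)) * (T * T\<^sup>T)
    = (E * ?A) * (Z * ((T * T\<^sup>T) * (T * T\<^sup>T))) + (E * E) * (Z * ((D * T\<^sup>T + T * D\<^sup>T) * (T * T\<^sup>T)))"
    by (rule expand) simp_all
  also have "\<dots> = (E * (H * G\<^sup>T + G * H\<^sup>T) - E * (V * X\<^sup>T + X * V\<^sup>T)) * (Z * (T * T\<^sup>T)) + E * (Z * (D * T\<^sup>T))"
    unfolding EE T1 T2 by (simp add: mat_left_diff[of E])
  also have "\<dots> = G * ((1\<^sub>m b - L * L\<^sup>T) * H\<^sup>T * Z * T) * T\<^sup>T - G * (M * L\<^sup>T * G\<^sup>T * Z * T) * T\<^sup>T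
      + G * ((1\<^sub>m b - L * L\<^sup>T) * G\<^sup>T * Z * (1\<^sub>m e - T * T\<^sup>T) * N) * T\<^sup>T"
    unfolding E1 E2 unfolding E_def D_def by (simp add: mat_assoc mat_right_diff)
  finally show ?thesis .
qed

lemma unflat_has_deriv:
  assumes "has_mat_deriv M M'" "k \<le> d" "dim_row M' = nprod n 1 k" "dim_col M' = nprod n (Suc k) d"
  shows "((\<lambda>t. unflat d n k (M t) is) has_real_derivative unflat d n k M' is) (at 0)"
proof (cases "valid_idx d n is")
  case True
  then show ?thesis
    using has_mat_derivD(3)[OF assms(1)] valid_enc_less[OF True assms(2)] assms(3,4)
    by (simp add: unflat_def)
qed (simp add: unflat_def)

lemma flat_has_mat_deriv:
  assumes "\<And>is. ((\<lambda>t. c t is) has_real_derivative V is) (at 0)"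
  shows "has_mat_deriv (\<lambda>t. flat d n k (c t)) (flat d n k V)"
  using assms by (auto simp: has_mat_deriv_def flat_def)

text \<open>\<open>DP_along\<close> picks some derivative for each entry; once one is known,
  uniqueness of derivatives identifies the choice.\<close>

lemma DP_alongI:
  assumes "\<And>is. ((\<lambda>t. proj d n r k (c t) Z is) has_real_derivative W is) (at 0)"
  shows "DP_along d n r k c Z = W"
proof
  fix "is"
  show "DP_along d n r k c Z is = W is"
    unfolding DP_along_def using assms[of "is"] by (intro some_equality) (auto dest: DERIV_unique)
qed

section \<open>The projectors along a curve that stays in the manifold for all times\<close>

context
  fixes d :: nat and n r :: "nat \<Rightarrow> nat" and X V Z :: tensor and U tU dV :: cores and R Rinv :: "nat \<Rightarrow> real mat"
    and c :: "real \<Rightarrow> tensor"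
  assumes r0: "r 0 = 1" and rd: "r d = 1"
    and U_dec: "minimal_TT d n r U X" and U_lo: "left_orth d n r U"
    and tU_ro: "right_orth d n r tU"
    and R: "\<forall>k\<in>{1..<d}. R k \<in> carrier_mat (r k) (r k)
                  \<and> R k * Rinv k = 1\<^sub>m (r k) \<and> Rinv k * R k = 1\<^sub>m (r k)
                  \<and> Xge d n r U (Suc k) = Xge d n r tU (Suc k) * R k"
    and dV_ok: "cores_ok d n r dV" and dV_gauge: "gauge d n r U dV"
    and V: "V = tt_tangent d n r U dV"
    and c: "\<And>t. c t \<in> Mr d n r" "c 0 = X" "\<And>is. ((\<lambda>t. c t is) has_real_derivative V is) (at 0)"
begin

text \<open>\<open>S\<close> and \<open>T\<close> are orthonormal bases of the column and row space
  of the flattening of \<open>X\<close>, whose matrix in these bases is the transpose of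
  \<open>R k\<close>. The variation \<open>P\<close> is orthogonal to \<open>S\<close> by the gauge
  condition.\<close>

lemma frame:
  assumes k: "k \<in> {1..<d}"
  defines "T \<equiv> Xge d n r tU (Suc k)" and "S \<equiv> Xle n r U k" and "P \<equiv> Vle n r U dV k"
    and "Q \<equiv> Vge d n r U dV (Suc k)"
  shows "dim_row T = nprod n (Suc k) d" "dim_col T = r k" "dim_row S = nprod n 1 k" "dim_col S = r k"
    "dim_row P = nprod n 1 k" "dim_col P = r k" "dim_row Q = nprod n (Suc k) d" "dim_col Q = r k"
    "dim_row (R k) = r k" "dim_col (R k) = r k" "dim_row (Rinv k) = r k" "dim_col (Rinv k) = r k"
    "R k * Rinv k = 1\<^sub>m (r k)" "Rinv k * R k = 1\<^sub>m (r k)"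
    "T\<^sup>T * T = 1\<^sub>m (r k)" "S\<^sup>T * S = 1\<^sub>m (r k)" "P\<^sup>T * S = 0\<^sub>m (r k) (r k)" "S\<^sup>T * P = 0\<^sub>m (r k) (r k)"
    "flat d n k X = S * (T * R k)\<^sup>T" "flat d n k V = P * (T * R k)\<^sup>T + S * Q\<^sup>T"
proof -
  have kd: "k \<le> d" "k < d" "1 \<le> k" using k by auto
  show dims: "dim_row T = nprod n (Suc k) d" "dim_col T = r k" "dim_row S = nprod n 1 k" "dim_col S = r k"
    "dim_row P = nprod n 1 k" "dim_col P = r k" "dim_row Q = nprod n (Suc k) d" "dim_col Q = r k"
    using Xle_dims[where r = r, OF r0] Xge_dims[where r = r and d = d, OF rd kd(1)]
    by (simp_all add: T_def S_def P_def Q_def)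
  show "dim_row (R k) = r k" "dim_col (R k) = r k" using bspec[OF R k] by auto
  show RR: "R k * Rinv k = 1\<^sub>m (r k)" "Rinv k * R k = 1\<^sub>m (r k)" using bspec[OF R k] by auto
  show "dim_row (Rinv k) = r k" "dim_col (Rinv k) = r k"
    using arg_cong[OF RR(2), of dim_row] arg_cong[OF RR(1), of dim_col] by simp_all
  show "T\<^sup>T * T = 1\<^sub>m (r k)" unfolding T_def by (rule Xge_orthonormal[OF rd tU_ro kd(3,1)])
  show "S\<^sup>T * S = 1\<^sub>m (r k)" unfolding S_def by (rule Xle_orthonormal[OF r0 U_lo kd(2)])
  show PS: "P\<^sup>T * S = 0\<^sub>m (r k) (r k)"
    unfolding P_def S_def by (rule Vle_orthogonal[OF r0 U_lo dV_gauge kd(2)])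
  show "S\<^sup>T * P = 0\<^sub>m (r k) (r k)"
    using arg_cong[OF PS, of transpose_mat] dims by (simp add: mat_trans_mult)
  have U: "is_TT d n r U X" "cores_ok d n r U" using U_dec by (auto simp: minimal_TT_def is_TT_def)
  show "flat d n k X = S * (T * R k)\<^sup>T"
    using flat_TT[OF r0 rd U(1) kd(1)] bspec[OF R k] by (simp add: S_def T_def)
  show "flat d n k V = P * (T * R k)\<^sup>T + S * Q\<^sup>T"
    using flat_tangent[OF r0 rd U(2) dV_ok kd(1)] bspec[OF R k] by (simp add: S_def T_def P_def Q_def V)
qed

text \<open>By the gauge condition the left variation is orthogonal to the left interface matrix, so
  the complementary projector leaves exactly that variation.\<close>

lemma col_proj_deriv:
  assumes k: "k < d"
  shows "col_proj d n r k X = Xle n r U k * (Xle n r U k)\<^sup>T"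
    "has_mat_deriv (\<lambda>t. col_proj d n r k (c t))
      (Vle n r U dV k * (Xle n r U k)\<^sup>T + Xle n r U k * (Vle n r U dV k)\<^sup>T)"
proof -
  have "col_proj d n r k X = Xle n r U k * (Xle n r U k)\<^sup>T \<and>
    has_mat_deriv (\<lambda>t. col_proj d n r k (c t))
      (Vle n r U dV k * (Xle n r U k)\<^sup>T + Xle n r U k * (Vle n r U dV k)\<^sup>T)"
  proof (cases "k = 0")
    case True
    \<comment> \<open>At the cut 0, which occurs as k - 1, the projector is the constant 1 and the
      variation is 0.\<close>
    have "(0\<^sub>m 1 1 * (1\<^sub>m 1)\<^sup>T + 1\<^sub>m 1 * (0\<^sub>m 1 1)\<^sup>T :: real mat) = 0\<^sub>m 1 1"
      by (intro eq_matI) auto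
    then show ?thesis using True has_mat_deriv_const[of "1\<^sub>m 1"] by (simp add: col_proj_def)
  next
    case False
    then have k1: "k \<in> {1..<d}" using k by simp
    note fr = frame[OF k1]
    let ?T = "Xge d n r tU (Suc k)" let ?S = "Xle n r U k" let ?P = "Vle n r U dV k"
    let ?Q = "Vge d n r U dV (Suc k)"
    \<comment> \<open>\<open>W\<close> is a right inverse of the row factor
      \<open>(?T * R k)\<^sup>T\<close>, so multiplication by it turns the flattening of
      \<open>X\<close> into \<open>?S\<close>.\<close>
    define W where "W = ?T * (Rinv k)\<^sup>T"
    note [simp] = fr(1-12)
    have [simp]: "dim_row W = nprod n (Suc k) d" "dim_col W = r k" by (simp_all add: W_def)
    have RR: "(R k)\<^sup>T * (Rinv k)\<^sup>T = 1\<^sub>m (r k)"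
      using arg_cong[OF fr(14), of transpose_mat] by (simp add: mat_trans_mult)
    have TRW: "(?T * R k)\<^sup>T * W = 1\<^sub>m (r k)"
      by (simp add: W_def mat_trans_mult mat_assoc mat_cancel[OF fr(15)] RR)
    have SAW: "?S = flat d n k (c 0) * W"
      unfolding c(2) fr(19) by (simp add: mat_assoc TRW mat_units)
    have VW: "flat d n k V * W = ?P + ?S * (?Q\<^sup>T * W)"
      unfolding fr(20) by (simp add: mat_right_add mat_assoc TRW mat_units)
    have D: "(1\<^sub>m (nprod n 1 k) - ?S * ?S\<^sup>T) * (flat d n k V * W) = ?P"
      unfolding VW
      by (intro eq_matI) (simp_all add: mat_distribs mat_assoc mat_units fr(18) mat_cancel[OF fr(16)] del: index_mult_mat(1))
    have S: "?S \<in> carrier_mat (nprod n 1 k) (r k)" using fr(3,4) by auto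
    note props = col_proj_props[OF r0 rd c(1) k]
    have "col_proj d n r k (c 0) = ?S * ?S\<^sup>T \<and> has_mat_deriv (\<lambda>t. col_proj d n r k (c t))
      (((1\<^sub>m (nprod n 1 k) - ?S * ?S\<^sup>T) * (flat d n k V * W)) * ?S\<^sup>T
       + ?S * ((1\<^sub>m (nprod n 1 k) - ?S * ?S\<^sup>T) * (flat d n k V * W))\<^sup>T)"
      by (intro conjI projector_has_mat_deriv[OF props flat_has_mat_deriv[OF c(3)] _ S fr(16) _ SAW]) simp_all
    then show ?thesis unfolding D c(2) .
  qed
  then show "col_proj d n r k X = Xle n r U k * (Xle n r U k)\<^sup>T"
    "has_mat_deriv (\<lambda>t. col_proj d n r k (c t))
      (Vle n r U dV k * (Xle n r U k)\<^sup>T + Xle n r U k * (Vle n r U dV k)\<^sup>T)" by auto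
qed

text \<open>The gauge conditions act on the left cores only, so the part of the right variation in
  the range of \<open>T\<close> has to be projected away; this is the origin of the inner projector
  in the third term of the formula.\<close>

lemma row_proj_deriv:
  assumes k: "k \<in> {1..<d}"
  defines "T \<equiv> Xge d n r tU (Suc k)"
  defines "D \<equiv> (1\<^sub>m (nprod n (Suc k) d) - T * T\<^sup>T) * (Vge d n r U dV (Suc k) * Rinv k)"
  shows "row_proj d n r k X = T * T\<^sup>T" "has_mat_deriv (\<lambda>t. row_proj d n r k (c t)) (D * T\<^sup>T + T * D\<^sup>T)"
proof -
  note fr = frame[OF k, folded T_def]
  have kd: "1 \<le> k" "k \<le> d" using k by auto
  let ?S = "Xle n r U k" let ?P = "Vle n r U dV k" let ?Q = "Vge d n r U dV (Suc k)"
  note [simp] = fr(1-12)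
  \<comment> \<open>Multiplication by \<open>W\<close> turns the transposed flattening of
    \<open>X\<close> into \<open>T\<close>; in that of \<open>V\<close> it removes the
    \<open>?P\<close> part, by the gauge condition.\<close>
  define W where "W = ?S * Rinv k"
  have [simp]: "dim_row W = nprod n 1 k" "dim_col W = r k" by (simp_all add: W_def)
  have TAW: "T = (flat d n k (c 0))\<^sup>T * W"
    unfolding c(2) fr(19) W_def by (simp add: mat_trans_mult mat_assoc mat_cancel[OF fr(16)] fr(13) mat_units)
  have zero: "?P\<^sup>T * (?S * Rinv k) = 0\<^sub>m (r k) (r k)"
    using mat_assoc[of "?P\<^sup>T" ?S "Rinv k"] by (simp add: fr(17) mat_units)
  have VW: "(flat d n k V)\<^sup>T * W = ?Q * Rinv k"
    unfolding fr(20) W_def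
    by (simp add: mat_distribs mat_assoc mat_cancel[OF fr(16)] zero mat_units)
  have S: "T \<in> carrier_mat (nprod n (Suc k) d) (r k)" using fr(1,2) by auto
  note props = row_proj_props[OF r0 rd c(1) kd]
  have "row_proj d n r k (c 0) = T * T\<^sup>T \<and> has_mat_deriv (\<lambda>t. row_proj d n r k (c t))
      (((1\<^sub>m (nprod n (Suc k) d) - T * T\<^sup>T) * ((flat d n k V)\<^sup>T * W)) * T\<^sup>T
       + T * ((1\<^sub>m (nprod n (Suc k) d) - T * T\<^sup>T) * ((flat d n k V)\<^sup>T * W))\<^sup>T)"
    by (intro conjI projector_has_mat_deriv[OF props has_mat_deriv_transpose[OF flat_has_mat_deriv[OF c(3)]] _ S fr(15) _ TAW]) simp_all
  then show "row_proj d n r k X = T * T\<^sup>T" "has_mat_deriv (\<lambda>t. row_proj d n r k (c t)) (D * T\<^sup>T + T * D\<^sup>T)"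
    unfolding VW D_def c(2) by auto
qed

lemma proj_deriv:
  assumes k: "k \<in> {1..<d}"
  shows "\<exists>W. (\<forall>is. ((\<lambda>t. proj d n r k (c t) Z is) has_real_derivative W is) (at 0)) \<and>
    flat d n k (proj d n r k X W) =
          kron (1\<^sub>m (n k)) (Xle n r U (k - 1))
            * ((1\<^sub>m (r (k - 1) * n k) - coreL n r U k * (coreL n r U k)\<^sup>T)
               * kron (1\<^sub>m (n k)) ((Vle n r U dV (k - 1))\<^sup>T) * flat d n k Z
               * Xge d n r tU (Suc k))
            * (Xge d n r tU (Suc k))\<^sup>T
        - kron (1\<^sub>m (n k)) (Xle n r U (k - 1))
            * (coreL n r dV k * (coreL n r U k)\<^sup>T
               * kron (1\<^sub>m (n k)) ((Xle n r U (k - 1))\<^sup>T) * flat d n k Z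
               * Xge d n r tU (Suc k))
            * (Xge d n r tU (Suc k))\<^sup>T
        + kron (1\<^sub>m (n k)) (Xle n r U (k - 1))
            * ((1\<^sub>m (r (k - 1) * n k) - coreL n r U k * (coreL n r U k)\<^sup>T)
               * kron (1\<^sub>m (n k)) ((Xle n r U (k - 1))\<^sup>T) * flat d n k Z
               * (1\<^sub>m (nprod n (Suc k) d) - Xge d n r tU (Suc k) * (Xge d n r tU (Suc k))\<^sup>T)
               * Vge d n r U dV (Suc k) * Rinv k)
            * (Xge d n r tU (Suc k))\<^sup>T"
proof -
  obtain j where j: "k = Suc j" "j < d" using k by (cases k) auto
  have kj: "k - 1 = j" using j by simp
  have kd: "1 \<le> k" "k < d" "k \<le> d" using k by auto
  note fr = frame[OF k]
  let ?I = "1\<^sub>m (n k) :: real mat"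
  let ?T = "Xge d n r tU (Suc k)" let ?Q = "Vge d n r U dV (Suc k)"
  define G where "G = kron ?I (Xle n r U j)"
  define H where "H = kron ?I (Vle n r U dV j)"
  let ?L = "coreL n r U k" let ?M = "coreL n r dV k"
  define D where "D = (1\<^sub>m (nprod n (Suc k) d) - ?T * ?T\<^sup>T) * (?Q * Rinv k)"
  let ?Z = "flat d n k Z"
  note dj = Xle_dims[where r = r, OF r0]
  have N: "nprod n 1 k = n k * nprod n 1 j" using j by (simp add: nprod_Suc)
  have [simp]: "dim_row G = nprod n 1 k" "dim_col G = r j * n k" "dim_row H = nprod n 1 k" "dim_col H = r j * n k"
    by (simp_all add: G_def H_def dj N)
  note [simp] = fr(1-12)
  have [simp]: "dim_row D = nprod n (Suc k) d" "dim_col D = r k" by (simp_all add: D_def)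
  have XG: "Xle n r U k = G * ?L" and VG: "Vle n r U dV k = H * ?L + G * ?M"
    unfolding j G_def H_def by simp_all
  have XX: "(Xle n r U j)\<^sup>T * Xle n r U j = 1\<^sub>m (r j)" by (rule Xle_orthonormal[OF r0 U_lo j(2)])
  have VX: "(Vle n r U dV j)\<^sup>T * Xle n r U j = 0\<^sub>m (r j) (r j)"
    by (rule Vle_orthogonal[OF r0 U_lo dV_gauge j(2)])
  have rel: "G\<^sup>T * G = 1\<^sub>m (r j * n k)" "H\<^sup>T * G = 0\<^sub>m (r j * n k) (r j * n k)"
    unfolding G_def H_def kron_trans transpose_one
    by (simp_all add: kron_mult_id dj XX VX kron_one kron_zero mult.commute)
  have rel2: "?L\<^sup>T * ?L = 1\<^sub>m (r k)" "?M\<^sup>T * ?L = 0\<^sub>m (r k) (r k)"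
    using U_lo dV_gauge k by (auto simp: left_orth_def gauge_def)
  define E where "E Y = kron ?I (col_proj d n r j Y) - col_proj d n r k Y" for Y
  let ?M' = "((H * G\<^sup>T + G * H\<^sup>T) - (Vle n r U dV k * (Xle n r U k)\<^sup>T + Xle n r U k * (Vle n r U dV k)\<^sup>T))
      * ?Z * (?T * ?T\<^sup>T) + E X * ?Z * (D * ?T\<^sup>T + ?T * D\<^sup>T)"
  have pd: "dim_row (col_proj d n r i Y) = nprod n 1 i" "dim_col (col_proj d n r i Y) = nprod n 1 i" for i Y
    using proj_dims[OF r0 rd] by auto
  have [simp]: "dim_row (E Y) = nprod n 1 k" "dim_col (E Y) = nprod n 1 k" for Y
    by (simp_all add: E_def pd N)
  have proj: "proj d n r k Y B = unflat d n k (E Y * flat d n k B * row_proj d n r k Y)" for Y B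
    using proj_eq[OF r0 rd kd(1,2)] j by (simp add: E_def)
  have "has_mat_deriv (\<lambda>t. kron ?I (col_proj d n r j (c t)))
      (kron ?I (Vle n r U dV j * (Xle n r U j)\<^sup>T + Xle n r U j * (Vle n r U dV j)\<^sup>T))"
    by (rule has_mat_deriv_kron[OF col_proj_deriv(2)[OF j(2)]])
  also have "kron ?I (Vle n r U dV j * (Xle n r U j)\<^sup>T + Xle n r U j * (Vle n r U dV j)\<^sup>T) = H * G\<^sup>T + G * H\<^sup>T"
    unfolding G_def H_def by (simp add: kron_add_right kron_trans dj flip: kron_mult_id)
  finally have E': "has_mat_deriv (\<lambda>t. E (c t))
    ((H * G\<^sup>T + G * H\<^sup>T) - (Vle n r U dV k * (Xle n r U k)\<^sup>T + Xle n r U k * (Vle n r U dV k)\<^sup>T))"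
    unfolding E_def by (rule has_mat_deriv_diff[OF _ col_proj_deriv(2)[OF kd(2)]]) simp_all
  have R0: "row_proj d n r k X = ?T * ?T\<^sup>T" by (rule row_proj_deriv(1)[OF k])
  have "has_mat_deriv (\<lambda>t. E (c t) * ?Z * row_proj d n r k (c t)) ?M'"
    using has_mat_deriv_mult[OF has_mat_deriv_mult_const[OF E', of ?Z] row_proj_deriv(2)[OF k]]
    by (simp add: c(2) R0 D_def)
  then have deriv: "((\<lambda>t. proj d n r k (c t) Z is) has_real_derivative unflat d n k ?M' is) (at 0)" for "is"
    unfolding proj by (rule unflat_has_deriv) (simp_all add: kd)
  \<comment> \<open>At \<open>X\<close> the chosen decomposition can be traded for \<open>U\<close>,
    since both give the same column space projectors.\<close>
  have EX: "E X = G * (1\<^sub>m (r j * n k) - ?L * ?L\<^sup>T) * G\<^sup>T"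
    unfolding E_def col_proj_deriv(1)[OF j(2)] col_proj_deriv(1)[OF kd(2)] G_def
    by (rule interface_complement[where r = r, OF r0 j(1), symmetric])
  have "flat d n k (proj d n r k X (unflat d n k ?M')) = E X * ?M' * (?T * ?T\<^sup>T)"
    unfolding proj R0 using kd by (simp add: flat_unflat)
  also have "\<dots> = G * ((1\<^sub>m (r j * n k) - ?L * ?L\<^sup>T) * H\<^sup>T * ?Z * ?T) * ?T\<^sup>T
      - G * (?M * ?L\<^sup>T * G\<^sup>T * ?Z * ?T) * ?T\<^sup>T
      + G * ((1\<^sub>m (r j * n k) - ?L * ?L\<^sup>T) * G\<^sup>T * ?Z * (1\<^sub>m (nprod n (Suc k) d) - ?T * ?T\<^sup>T) * (?Q * Rinv k)) * ?T\<^sup>T"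
    unfolding EX D_def XG VG using kj
    by (intro projected_derivative[of G "nprod n 1 k" "r j * n k" H ?L "r k" ?M ?T "nprod n (Suc k) d" "r k" "?Q * Rinv k"] rel rel2 fr(15))
      simp_all
  also have "G * ((1\<^sub>m (r j * n k) - ?L * ?L\<^sup>T) * G\<^sup>T * ?Z * (1\<^sub>m (nprod n (Suc k) d) - ?T * ?T\<^sup>T) * (?Q * Rinv k))
    = G * ((1\<^sub>m (r j * n k) - ?L * ?L\<^sup>T) * G\<^sup>T * ?Z * (1\<^sub>m (nprod n (Suc k) d) - ?T * ?T\<^sup>T) * ?Q * Rinv k)"
    using kj by (simp add: mat_assoc)
  finally show ?thesis
    using deriv kj unfolding G_def H_def kron_trans transpose_one by auto
qed

lemma proj_deriv_last:
  assumes d: "1 \<le> d"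
  shows "\<exists>W. (\<forall>is. ((\<lambda>t. proj d n r d (c t) Z is) has_real_derivative W is) (at 0)) \<and>
    flat d n d (proj d n r d X W) =
        kron (1\<^sub>m (n d)) (Xle n r U (d - 1))
          * kron (1\<^sub>m (n d)) ((Vle n r U dV (d - 1))\<^sup>T) * flat d n d Z"
proof -
  obtain j where j: "d = Suc j" "j < d" using d by (cases d) auto
  let ?I = "1\<^sub>m (n d) :: real mat" let ?Z = "flat d n d Z"
  let ?X = "Xle n r U j" let ?V = "Vle n r U dV j"
  let ?D = "?V * ?X\<^sup>T + ?X * ?V\<^sup>T"
  note [simp] = Xle_dims[where r = r, OF r0]
  have [simp]: "nprod n 1 d = n d * nprod n 1 j" using j by (simp add: nprod_Suc)
  have XX: "?X\<^sup>T * ?X = 1\<^sub>m (r j)" by (rule Xle_orthonormal[OF r0 U_lo j(2)])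
  have VX: "?V\<^sup>T * ?X = 0\<^sub>m (r j) (r j)" by (rule Vle_orthogonal[OF r0 U_lo dV_gauge j(2)])
  have XV: "?X\<^sup>T * ?V = 0\<^sub>m (r j) (r j)"
    using arg_cong[OF VX, of transpose_mat] by (simp add: mat_trans_mult)
  have zero: "?X\<^sup>T * (?V * ?X\<^sup>T) = 0\<^sub>m (r j) (nprod n 1 j)"
    using mat_assoc[of "?X\<^sup>T" ?V "?X\<^sup>T"] by (simp add: XV mat_units)
  have proj: "proj d n r d Y B = unflat d n d (kron ?I (col_proj d n r j Y) * flat d n d B)" for Y B
    using proj_eq_last[of d n r Y B] j by simp
  have "has_mat_deriv (\<lambda>t. kron ?I (col_proj d n r j (c t)) * ?Z) (kron ?I ?D * ?Z)"
    by (intro has_mat_deriv_mult_const has_mat_deriv_kron col_proj_deriv(2) j) simp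
  then have deriv: "((\<lambda>t. proj d n r d (c t) Z is) has_real_derivative unflat d n d (kron ?I ?D * ?Z) is) (at 0)" for "is"
    unfolding proj by (rule unflat_has_deriv) simp_all
  have "flat d n d (proj d n r d X (unflat d n d (kron ?I ?D * ?Z))) = kron ?I (?X * ?X\<^sup>T) * (kron ?I ?D * ?Z)"
    unfolding proj col_proj_deriv(1)[OF j(2)] by (simp add: flat_unflat)
  also have "\<dots> = kron ?I (?X * ?X\<^sup>T) * kron ?I ?D * ?Z" by (simp add: mat_assoc)
  \<comment> \<open>The summand \<open>?V * ?X\<^sup>T\<close> is annihilated by the gauge
    condition, and \<open>?X\<^sup>T * ?X\<close> cancels in the other one.\<close>
  also have "kron ?I (?X * ?X\<^sup>T) * kron ?I ?D = kron ?I (?X * ?V\<^sup>T)"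
    by (simp add: kron_mult_id mat_left_add mat_assoc zero mat_cancel[OF XX] mat_units)
  also have "\<dots> = kron ?I ?X * kron ?I (?V\<^sup>T)" by (simp add: kron_mult_id)
  finally show ?thesis using deriv j by auto
qed

end

text \<open>Differentiability is part of the conclusion, as \<open>DP_along\<close> is a choice that
  carries information only where a derivative exists. The right-hand sides are the same for all
  curves through \<open>X\<close> with velocity \<open>V\<close>.\<close>

theorem theorem2:
  fixes d :: nat and n r :: "nat \<Rightarrow> nat"
    and X V Z :: tensor and U tU dV :: cores and R Rinv :: "nat \<Rightarrow> real mat"
  assumes d2: "d \<ge> 2"
    and n_pos: "\<forall>k\<in>{1..d}. n k > 0"
    and r_pos: "\<forall>k\<in>{1..<d}. r k > 0"
    and r0: "r 0 = 1" and rd: "r d = 1"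
    and X_M: "X \<in> Mr d n r"
    and U_dec: "minimal_TT d n r U X" and U_lo: "left_orth d n r U"
    and tU_dec: "minimal_TT d n r tU X" and tU_ro: "right_orth d n r tU"
    and R_def: "\<forall>k\<in>{1..<d}. R k \<in> carrier_mat (r k) (r k)
                  \<and> R k * Rinv k = 1\<^sub>m (r k) \<and> Rinv k * R k = 1\<^sub>m (r k)
                  \<and> Xge d n r U (Suc k) = Xge d n r tU (Suc k) * R k"
    and dV_ok: "cores_ok d n r dV" and dV_gauge: "gauge d n r U dV"
    and V_def: "V = tt_tangent d n r U dV"
    and Z_T: "Z \<in> tensors d n"
  shows "\<forall>c. smooth_curve_through d n r c X V \<longrightarrow>
    (\<forall>k\<in>{1..d}. \<forall>is. (\<lambda>t. proj d n r k (c t) Z is) differentiable (at 0))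
    \<and> (\<forall>k\<in>{1..<d}.
        flat d n k (proj d n r k X (DP_along d n r k c Z)) =
          kron (1\<^sub>m (n k)) (Xle n r U (k - 1))
            * ((1\<^sub>m (r (k - 1) * n k) - coreL n r U k * (coreL n r U k)\<^sup>T)
               * kron (1\<^sub>m (n k)) ((Vle n r U dV (k - 1))\<^sup>T) * flat d n k Z
               * Xge d n r tU (Suc k))
            * (Xge d n r tU (Suc k))\<^sup>T
        - kron (1\<^sub>m (n k)) (Xle n r U (k - 1))
            * (coreL n r dV k * (coreL n r U k)\<^sup>T
               * kron (1\<^sub>m (n k)) ((Xle n r U (k - 1))\<^sup>T) * flat d n k Z
               * Xge d n r tU (Suc k))
            * (Xge d n r tU (Suc k))\<^sup>T
        + kron (1\<^sub>m (n k)) (Xle n r U (k - 1))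
            * ((1\<^sub>m (r (k - 1) * n k) - coreL n r U k * (coreL n r U k)\<^sup>T)
               * kron (1\<^sub>m (n k)) ((Xle n r U (k - 1))\<^sup>T) * flat d n k Z
               * (1\<^sub>m (nprod n (Suc k) d) - Xge d n r tU (Suc k) * (Xge d n r tU (Suc k))\<^sup>T)
               * Vge d n r U dV (Suc k) * Rinv k)
            * (Xge d n r tU (Suc k))\<^sup>T)
    \<and> flat d n d (proj d n r d X (DP_along d n r d c Z)) =
        kron (1\<^sub>m (n d)) (Xle n r U (d - 1))
          * kron (1\<^sub>m (n d)) ((Vle n r U dV (d - 1))\<^sup>T) * flat d n d Z"
proof (rule allI, rule impI)
  fix c assume sc: "smooth_curve_through d n r c X V"
  then obtain e where e: "e > 0" "\<And>t. \<bar>t\<bar> < e \<Longrightarrow> c t \<in> Mr d n r"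
    unfolding smooth_curve_through_def by blast
  have c0: "c 0 = X" and c': "\<And>is. ((\<lambda>t. c t is) has_real_derivative V is) (at 0)"
    using sc unfolding smooth_curve_through_def by auto
  \<comment> \<open>The curve is known to lie in the manifold only near 0. Freezing it at
    \<open>X\<close> elsewhere makes the properties of the projectors hold for every
    \<open>t\<close> and leaves derivatives at 0 unchanged.\<close>
  define b where "b t = (if \<bar>t\<bar> < e then c t else X)" for t
  have near: "\<forall>\<^sub>F t in nhds 0. b t = c t"
    unfolding eventually_nhds_metric using e(1) by (intro exI[of _ e]) (simp add: b_def dist_real_def)
  have b: "b t \<in> Mr d n r" "b 0 = X" for t
    using e X_M c0 by (simp_all add: b_def)
  have b': "((\<lambda>t. b t is) has_real_derivative V is) (at 0)" for "is"
    using near by (intro DERIV_cong_ev[THEN iffD2, OF refl _ refl c']) (auto elim: eventually_mono)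
  note ctxt = r0 rd U_dec U_lo tU_ro R_def dV_ok dV_gauge V_def b(1) b(2) b'
  have transfer: "((\<lambda>t. proj d n r k (c t) Z is) has_real_derivative D) (at 0)"
    if "((\<lambda>t. proj d n r k (b t) Z is) has_real_derivative D) (at 0)" for k "is" D
    using near by (intro DERIV_cong_ev[THEN iffD1, OF refl _ refl that]) (auto elim: eventually_mono)
  note inner = proj_deriv[OF ctxt, where Z = Z]
  note outer = proj_deriv_last[OF ctxt, where Z = Z]
  have d1: "1 \<le> d" using d2 by simp
  have diff: "(\<lambda>t. proj d n r k (c t) Z is) differentiable (at 0)" if "k \<in> {1..d}" for k "is"
  proof -
    have "\<exists>D. ((\<lambda>t. proj d n r k (b t) Z is) has_real_derivative D) (at 0)"
    proof (cases "k = d")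
      case True
      with outer[OF d1] show ?thesis by blast
    next
      case False
      then have "k \<in> {1..<d}" using that by simp
      from inner[OF this] show ?thesis by blast
    qed
    then obtain D where "((\<lambda>t. proj d n r k (b t) Z is) has_real_derivative D) (at 0)" ..
    from transfer[OF this] show ?thesis unfolding real_differentiable_def by blast
  qed
  show "(\<forall>k\<in>{1..d}. \<forall>is. (\<lambda>t. proj d n r k (c t) Z is) differentiable (at 0))
    \<and> (\<forall>k\<in>{1..<d}.
        flat d n k (proj d n r k X (DP_along d n r k c Z)) =
          kron (1\<^sub>m (n k)) (Xle n r U (k - 1))
            * ((1\<^sub>m (r (k - 1) * n k) - coreL n r U k * (coreL n r U k)\<^sup>T)
               * kron (1\<^sub>m (n k)) ((Vle n r U dV (k - 1))\<^sup>T) * flat d n k Z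
               * Xge d n r tU (Suc k))
            * (Xge d n r tU (Suc k))\<^sup>T
        - kron (1\<^sub>m (n k)) (Xle n r U (k - 1))
            * (coreL n r dV k * (coreL n r U k)\<^sup>T
               * kron (1\<^sub>m (n k)) ((Xle n r U (k - 1))\<^sup>T) * flat d n k Z
               * Xge d n r tU (Suc k))
            * (Xge d n r tU (Suc k))\<^sup>T
        + kron (1\<^sub>m (n k)) (Xle n r U (k - 1))
            * ((1\<^sub>m (r (k - 1) * n k) - coreL n r U k * (coreL n r U k)\<^sup>T)
               * kron (1\<^sub>m (n k)) ((Xle n r U (k - 1))\<^sup>T) * flat d n k Z
               * (1\<^sub>m (nprod n (Suc k) d) - Xge d n r tU (Suc k) * (Xge d n r tU (Suc k))\<^sup>T)
               * Vge d n r U dV (Suc k) * Rinv k)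
            * (Xge d n r tU (Suc k))\<^sup>T)
    \<and> flat d n d (proj d n r d X (DP_along d n r d c Z)) =
        kron (1\<^sub>m (n d)) (Xle n r U (d - 1))
          * kron (1\<^sub>m (n d)) ((Vle n r U dV (d - 1))\<^sup>T) * flat d n d Z"
  proof (intro conjI ballI allI)
    fix k "is" assume "k \<in> {1..d}"
    then show "(\<lambda>t. proj d n r k (c t) Z is) differentiable (at 0)" by (rule diff)
  next
    fix k assume "k \<in> {1..<d}"
    from inner[OF this] obtain W where W: "\<And>is. ((\<lambda>t. proj d n r k (b t) Z is) has_real_derivative W is) (at 0)"
      and eq: "flat d n k (proj d n r k X W) =
          kron (1\<^sub>m (n k)) (Xle n r U (k - 1))
            * ((1\<^sub>m (r (k - 1) * n k) - coreL n r U k * (coreL n r U k)\<^sup>T)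
               * kron (1\<^sub>m (n k)) ((Vle n r U dV (k - 1))\<^sup>T) * flat d n k Z
               * Xge d n r tU (Suc k))
            * (Xge d n r tU (Suc k))\<^sup>T
        - kron (1\<^sub>m (n k)) (Xle n r U (k - 1))
            * (coreL n r dV k * (coreL n r U k)\<^sup>T
               * kron (1\<^sub>m (n k)) ((Xle n r U (k - 1))\<^sup>T) * flat d n k Z
               * Xge d n r tU (Suc k))
            * (Xge d n r tU (Suc k))\<^sup>T
        + kron (1\<^sub>m (n k)) (Xle n r U (k - 1))
            * ((1\<^sub>m (r (k - 1) * n k) - coreL n r U k * (coreL n r U k)\<^sup>T)
               * kron (1\<^sub>m (n k)) ((Xle n r U (k - 1))\<^sup>T) * flat d n k Z
               * (1\<^sub>m (nprod n (Suc k) d) - Xge d n r tU (Suc k) * (Xge d n r tU (Suc k))\<^sup>T)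
               * Vge d n r U dV (Suc k) * Rinv k)
            * (Xge d n r tU (Suc k))\<^sup>T" (is "_ = ?rhs")
      by blast
    have "DP_along d n r k c Z = W" by (intro DP_alongI transfer W)
    with eq show "flat d n k (proj d n r k X (DP_along d n r k c Z)) = ?rhs" by (simp only:)
  next
    from outer[OF d1] obtain W where W: "\<And>is. ((\<lambda>t. proj d n r d (b t) Z is) has_real_derivative W is) (at 0)"
      and eq: "flat d n d (proj d n r d X W) = kron (1\<^sub>m (n d)) (Xle n r U (d - 1))
          * kron (1\<^sub>m (n d)) ((Vle n r U dV (d - 1))\<^sup>T) * flat d n d Z"
      by blast
    have "DP_along d n r d c Z = W" by (intro DP_alongI transfer W)
    with eq show "flat d n d (proj d n r d X (DP_along d n r d c Z)) = kron (1\<^sub>m (n d)) (Xle n r U (d - 1))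
          * kron (1\<^sub>m (n d)) ((Vle n r U dV (d - 1))\<^sup>T) * flat d n d Z" by (simp only:)
  qed
qed

end
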